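(* Let $d\in\mathbb{N}$, fix $0<\alpha<1/2$, let $G$ be a trace-zero GUE matrix on $\mathbb{C}^d\otimes\mathbb{C}^d$, and set $\rho=\frac{1}{d^2}\left(\mathbb{1}+\frac{\alpha}{d}G\right)$. Then there are constants $c'_\alpha>0$ depending only on $\alpha$ and $c>0$ universal such that for every integer $1\leq k\leq c'_\alpha d$, \[ \mathbb{P}\big(\rho\notin\mathrm{SN}_k(\mathbb{C}^d:\mathbb{C}^d)\big)\geq 1-2e^{-cd}. \]
   Context: Trace-zero GUE matrix on $\mathbb{C}^n$ ($n=d^2$): let $\tilde G$ have independent complex Gaussian entries of mean $0$ and variance $1$, $G'=(\tilde G+\tilde G^\dagger)/\sqrt2$, $G=G'-(\mathrm{tr}\,G')\mathbb{1}/n$. $\mathrm{SN}_k(\mathbb{C}^d:\mathbb{C}^d)$ is the set of quantum states (unit-trace positive semidefinite matrices) on $\mathbb{C}^d\otimes\mathbb{C}^d$ with Schmidt number at most $k$, where the Schmidt number of $\rho$ is the minimum over decompositions $\rho=\sum_ip_i\ket{\psi_i}\bra{\psi_i}$ into convex combinations of pure states of $\max_i\mathrm{rank}(\mathrm{tr}_A\ket{\psi_i}\bra{\psi_i})$. *)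

theory Defs
  imports "HOL-Probability.Probability"
begin

text \<open>Index set of the computational basis of C^d (x) C^d: pairs (i,j) with i,j < d.
  Operators on C^d (x) C^d are functions of two indices, restricted to this set.\<close>
definition idx :: "nat \<Rightarrow> (nat \<times> nat) set" where
  "idx d = {..<d} \<times> {..<d}"

definition is_state :: "nat \<Rightarrow> ((nat \<times> nat) \<Rightarrow> (nat \<times> nat) \<Rightarrow> complex) \<Rightarrow> bool" where
  "is_state d \<rho> \<longleftrightarrow>
     (\<forall>a\<in>idx d. \<forall>b\<in>idx d. \<rho> a b = cnj (\<rho> b a)) \<and>
     (\<forall>v :: nat \<times> nat \<Rightarrow> complex.
        0 \<le> Re (\<Sum>a\<in>idx d. \<Sum>b\<in>idx d. cnj (v a) * \<rho> a b * v b)) \<and>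
     (\<Sum>a\<in>idx d. \<rho> a a) = 1"

definition ptrace_A_proj :: "nat \<Rightarrow> (nat \<times> nat \<Rightarrow> complex) \<Rightarrow> nat \<Rightarrow> nat \<Rightarrow> complex" where
  "ptrace_A_proj d \<psi> j j' = (\<Sum>i<d. \<psi> (i, j) * cnj (\<psi> (i, j')))"

definition mat_rank :: "nat \<Rightarrow> (nat \<Rightarrow> nat \<Rightarrow> complex) \<Rightarrow> nat" where
  "mat_rank d M = Max {card S | S. S \<subseteq> {..<d} \<and>
     (\<forall>c :: nat \<Rightarrow> complex. (\<forall>i<d. (\<Sum>j\<in>S. c j * M i j) = 0) \<longrightarrow> (\<forall>j\<in>S. c j = 0))}"

definition schmidt_number :: "nat \<Rightarrow> ((nat \<times> nat) \<Rightarrow> (nat \<times> nat) \<Rightarrow> complex) \<Rightarrow> nat" where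
  "schmidt_number d \<rho> = Inf {r. \<exists>(m::nat) (p :: nat \<Rightarrow> real) (\<psi> :: nat \<Rightarrow> nat \<times> nat \<Rightarrow> complex).
      0 < m \<and> (\<forall>l<m. 0 \<le> p l) \<and> (\<Sum>l<m. p l) = 1 \<and>
      (\<forall>l<m. (\<Sum>a\<in>idx d. (cmod (\<psi> l a))\<^sup>2) = 1) \<and>
      (\<forall>a\<in>idx d. \<forall>b\<in>idx d. \<rho> a b = (\<Sum>l<m. complex_of_real (p l) * \<psi> l a * cnj (\<psi> l b))) \<and>
      r = Max ((\<lambda>l. mat_rank d (ptrace_A_proj d (\<psi> l))) ` {..<m})}"

definition SN :: "nat \<Rightarrow> nat \<Rightarrow> ((nat \<times> nat) \<Rightarrow> (nat \<times> nat) \<Rightarrow> complex) set" where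
  "SN k d = {\<rho>. is_state d \<rho> \<and> schmidt_number d \<rho> \<le> k}"

text \<open>Standard complex Gaussian: independent real and imaginary parts N(0,1/2), so E|z|^2 = 1.\<close>
definition complex_gaussian :: "complex measure" where
  "complex_gaussian =
     distr (density lborel (normal_density 0 (1 / sqrt 2)) \<Otimes>\<^sub>M density lborel (normal_density 0 (1 / sqrt 2)))
           borel (\<lambda>(x, y). Complex x y)"

definition ginibre :: "nat \<Rightarrow> ((nat \<times> nat) \<times> (nat \<times> nat) \<Rightarrow> complex) measure" where
  "ginibre d = PiM (idx d \<times> idx d) (\<lambda>_. complex_gaussian)"

definition gue_herm :: "nat \<Rightarrow> ((nat \<times> nat) \<times> (nat \<times> nat) \<Rightarrow> complex) \<Rightarrow> (nat \<times> nat) \<Rightarrow> (nat \<times> nat) \<Rightarrow> complex" where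
  "gue_herm d g a b = (g (a, b) + cnj (g (b, a))) / complex_of_real (sqrt 2)"

definition gue0 :: "nat \<Rightarrow> ((nat \<times> nat) \<times> (nat \<times> nat) \<Rightarrow> complex) \<Rightarrow> (nat \<times> nat) \<Rightarrow> (nat \<times> nat) \<Rightarrow> complex" where
  "gue0 d g a b = gue_herm d g a b -
     (if a = b then (\<Sum>c\<in>idx d. gue_herm d g c c) / of_nat (d^2) else 0)"

definition rho_of :: "real \<Rightarrow> nat \<Rightarrow> ((nat \<times> nat) \<times> (nat \<times> nat) \<Rightarrow> complex) \<Rightarrow> (nat \<times> nat) \<Rightarrow> (nat \<times> nat) \<Rightarrow> complex" where
  "rho_of \<alpha> d g a b = (1 / of_nat (d^2)) *
     ((if a = b then 1 else 0) + complex_of_real (\<alpha> / real d) * gue0 d g a b)"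

end

theory Submission
  imports Defs
begin

text \<open>
  The operator \<open>G\<close> itself is a Schmidt number witness.  Since \<open>G\<close> is traceless,
  \<open>tr (\<rho> G) = (\<alpha> / d\<^sup>3) \<parallel>G\<parallel>\<^sup>2\<close>, where \<open>\<parallel>G\<parallel>\<^sup>2\<close> (Hilbert--Schmidt) is of order \<open>d\<^sup>4\<close>, so that
  \<open>tr (\<rho> G)\<close> is at least of order \<open>\<alpha> d\<close>.  If \<open>\<rho>\<close> has Schmidt number at most \<open>k\<close>, then
  \<open>tr (\<rho> G)\<close> is a convex combination of values \<open>\<langle>\<psi>, G \<psi>\<rangle>\<close> at unit vectors of Schmidt rank at most
  \<open>k\<close>.  These vectors have an \<open>\<epsilon>\<close>-net of cardinality \<open>exp (O(k d))\<close>, on which the Gaussian variables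
  \<open>\<langle>y, G y\<rangle>\<close> of bounded variance stay below a small multiple of \<open>\<alpha> d\<close> up to probability
  \<open>exp (O(k d) - \<Omega>(\<alpha>\<^sup>2 d\<^sup>2))\<close>; the error of passing from the net to \<open>\<psi>\<close> is controlled by the operator
  norm of \<open>G\<close>, which is \<open>O(d)\<close>.  For \<open>k \<le> c' d\<close> with small \<open>c'\<close> the two estimates contradict each
  other.  As the failure probability is \<open>exp (- \<Omega>(\<alpha>\<^sup>2 d\<^sup>2))\<close> and \<open>1 \<le> k \<le> c' d\<close> forces \<open>d\<close> to be
  large, the universal constant can be taken to be \<open>c = 1\<close>.

  The nets are lattice points in balls, counted by
  \<open>#{z \<in> \<int>\<^sup>n. |z|\<^sup>2 \<le> R} \<le> \<Sum>\<^sub>z exp (R - |z|\<^sup>2) \<le> exp R \<cdot> 4\<^sup>n\<close>.  The event has to be shown measurable as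
  well: the set of states of Schmidt number at most \<open>k\<close> is a countable union, over the number of pure
  states in the decomposition, of continuous images of compact parameter sets.
\<close>

section \<open>Lattice nets\<close>

definition nrm2 :: "'a set \<Rightarrow> ('a \<Rightarrow> complex) \<Rightarrow> real" where
  "nrm2 I x = (\<Sum>a\<in>I. (cmod (x a))\<^sup>2)"

lemma nrm2_nonneg: "0 \<le> nrm2 I x"
  unfolding nrm2_def by (simp add: sum_nonneg)

lemma cmod_add_sq_le: "(cmod (x + y))\<^sup>2 \<le> 2 * (cmod x)\<^sup>2 + 2 * (cmod y)\<^sup>2"
proof -
  have "(cmod (x + y))\<^sup>2 + (cmod (x - y))\<^sup>2 = 2 * (cmod x)\<^sup>2 + 2 * (cmod y)\<^sup>2"
    unfolding cmod_power2 by (simp add: power2_eq_square algebra_simps)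
  then show ?thesis
    by (smt (verit) zero_le_power2)
qed

lemma nrm2_add_le: "nrm2 I (\<lambda>a. x a + y a) \<le> 2 * nrm2 I x + 2 * nrm2 I y"
  unfolding nrm2_def sum_distrib_left sum.distrib[symmetric]
  by (intro sum_mono cmod_add_sq_le)

lemma nrm2_diff_le: "nrm2 I (\<lambda>a. x a - y a) \<le> 2 * nrm2 I x + 2 * nrm2 I y"
  using nrm2_add_le[of I x "\<lambda>a. - y a"] by (simp add: nrm2_def)

text \<open>As \<open>n <= n^2\<close> and \<open>exp (-1) <= 1/2\<close>, the nonnegative and the
  nonpositive integers are each dominated by a geometric series of sum at most 2; zero is counted
  twice.\<close>

lemma sum_exp_neg_sq_int_le:
  "(\<Sum>z\<in>{-int m..int m}. exp (- (real_of_int z)\<^sup>2)) \<le> 4"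
proof -
  let ?f = "\<lambda>z::int. exp (- (real_of_int z)\<^sup>2)"
  have le: "?f (int n) \<le> (1/2) ^ n" for n
  proof -
    have "real n \<le> (real n)\<^sup>2"
      by (cases n) (auto simp: power2_eq_square mult_le_cancel_left)
    then have "exp (- (real n)\<^sup>2) \<le> exp (real n * (- 1))" by simp
    also have "\<dots> = exp (- 1) ^ n" by (rule exp_of_nat_mult)
    also have "\<dots> \<le> (1/2) ^ n"
    proof (rule power_mono)
      have "2 \<le> exp (1::real)" using exp_ge_add_one_self[of "1::real"] by simp
      then show "exp (- 1) \<le> (1/2::real)" by (simp add: exp_minus field_simps)
    qed simp
    finally show ?thesis by simp
  qed
  have geo: "(\<Sum>n\<le>m. (1/2::real) ^ n) \<le> 2"
    using sum_gp_basic[of "1/2::real" m] by simp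
  have "{-int m..int m} \<subseteq> int ` {..m} \<union> (\<lambda>n. - int n) ` {..m}"
  proof
    fix z assume "z \<in> {-int m..int m}"
    then show "z \<in> int ` {..m} \<union> (\<lambda>n. - int n) ` {..m}"
      by (cases "z \<ge> 0") (auto simp: image_iff intro: bexI[of _ "nat \<bar>z\<bar>"])
  qed
  then have "(\<Sum>z\<in>{-int m..int m}. ?f z) \<le> (\<Sum>z\<in>int ` {..m} \<union> (\<lambda>n. - int n) ` {..m}. ?f z)"
    by (intro sum_mono2) auto
  also have "\<dots> \<le> (\<Sum>z\<in>int ` {..m}. ?f z) + (\<Sum>z\<in>(\<lambda>n. - int n) ` {..m}. ?f z)"
    by (subst sum_Un) (auto intro!: sum_nonneg)
  also have "(\<Sum>z\<in>int ` {..m}. ?f z) = (\<Sum>n\<le>m. ?f (int n))"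
    by (subst sum.reindex) (auto simp: inj_on_def)
  also have "(\<Sum>z\<in>(\<lambda>n. - int n) ` {..m}. ?f z) = (\<Sum>n\<le>m. ?f (int n))"
    by (subst sum.reindex) (auto simp: inj_on_def)
  also have "(\<Sum>n\<le>m. ?f (int n)) \<le> (\<Sum>n\<le>m. (1/2) ^ n)"
    by (intro sum_mono le)
  finally show ?thesis using geo by simp
qed

definition lattice_ball :: "'a set \<Rightarrow> real \<Rightarrow> ('a \<Rightarrow> int) set" where
  "lattice_ball I R = {z \<in> I \<rightarrow>\<^sub>E UNIV. (\<Sum>i\<in>I. (real_of_int (z i))\<^sup>2) \<le> R}"

lemma lattice_ball_card:
  assumes "finite I"
  shows "finite (lattice_ball I R)" "real (card (lattice_ball I R)) \<le> exp R * 4 ^ card I"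
proof -
  define m where "m = nat \<lceil>R\<rceil>"
  have sub: "lattice_ball I R \<subseteq> I \<rightarrow>\<^sub>E {-int m..int m}"
  proof
    fix z assume z: "z \<in> lattice_ball I R"
    have "z i \<in> {-int m..int m}" if "i \<in> I" for i
    proof -
      have "(real_of_int (z i))\<^sup>2 \<le> (\<Sum>i\<in>I. (real_of_int (z i))\<^sup>2)"
        by (rule member_le_sum[OF that _ assms]) auto
      also have "\<dots> \<le> R" using z by (simp add: lattice_ball_def)
      also have "R \<le> of_int (int m)" unfolding m_def by linarith
      finally have "real_of_int ((z i)\<^sup>2) \<le> real_of_int (int m)" by simp
      then have "(z i)\<^sup>2 \<le> int m" by linarith
      moreover have "\<bar>z i\<bar> \<le> (z i)\<^sup>2"
        using self_le_power[of "\<bar>z i\<bar>" 2] by (cases "z i = 0") auto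
      ultimately show ?thesis by auto
    qed
    then show "z \<in> I \<rightarrow>\<^sub>E {-int m..int m}" using z by (auto simp: lattice_ball_def PiE_iff)
  qed
  have fin: "finite (I \<rightarrow>\<^sub>E {-int m..int m})" using assms by (intro finite_PiE) auto
  show "finite (lattice_ball I R)" using sub fin finite_subset by blast
  have "real (card (lattice_ball I R)) = (\<Sum>z\<in>lattice_ball I R. 1)" by simp
  also have "\<dots> \<le> (\<Sum>z\<in>lattice_ball I R. exp R * (\<Prod>i\<in>I. exp (- (real_of_int (z i))\<^sup>2)))"
  proof (rule sum_mono)
    fix z assume "z \<in> lattice_ball I R"
    then have "0 \<le> R + (\<Sum>i\<in>I. - (real_of_int (z i))\<^sup>2)"
      by (simp add: lattice_ball_def sum_negf)
    then have "1 \<le> exp (R + (\<Sum>i\<in>I. - (real_of_int (z i))\<^sup>2))" by simp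
    then show "1 \<le> exp R * (\<Prod>i\<in>I. exp (- (real_of_int (z i))\<^sup>2))"
      using assms by (simp only: exp_add exp_sum)
  qed
  \<comment> \<open>Enlarging the ball to a box makes the sum of products factor over the
    coordinates.\<close>
  also have "\<dots> \<le> (\<Sum>z\<in>I \<rightarrow>\<^sub>E {-int m..int m}. exp R * (\<Prod>i\<in>I. exp (- (real_of_int (z i))\<^sup>2)))"
    by (intro sum_mono2 fin sub) (auto intro!: mult_nonneg_nonneg prod_nonneg)
  also have "\<dots> = exp R * (\<Prod>i\<in>I. \<Sum>z\<in>{-int m..int m}. exp (- (real_of_int z)\<^sup>2))"
    by (subst prod_sum_PiE[OF assms]) (auto simp: sum_distrib_left)
  also have "\<dots> \<le> exp R * (\<Prod>i\<in>I. 4)"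
    by (intro mult_left_mono prod_mono conjI sum_exp_neg_sq_int_le sum_nonneg) auto
  finally show "real (card (lattice_ball I R)) \<le> exp R * 4 ^ card I" by simp
qed

definition lattice_vec :: "real \<Rightarrow> ('a \<Rightarrow> int) \<Rightarrow> ('a \<Rightarrow> int) \<Rightarrow> 'a \<Rightarrow> complex" where
  "lattice_vec \<delta> z w i = Complex (\<delta> * z i) (\<delta> * w i)"

lemma mem_lattice_ball_of_close:
  fixes x :: "'a \<Rightarrow> real"
  assumes "finite I" "0 < \<delta>" "(\<Sum>i\<in>I. (x i)\<^sup>2) \<le> r"
    and "\<And>i. i \<in> I \<Longrightarrow> \<bar>x i - \<delta> * real_of_int (z i)\<bar> \<le> \<delta>" and "z \<in> I \<rightarrow>\<^sub>E UNIV"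
  shows "z \<in> lattice_ball I (2 * r / \<delta>\<^sup>2 + 2 * card I)"
proof -
  have "\<delta>\<^sup>2 * (real_of_int (z i))\<^sup>2 \<le> 2 * (x i)\<^sup>2 + 2 * \<delta>\<^sup>2" if "i \<in> I" for i
  proof -
    let ?e = "x i - \<delta> * real_of_int (z i)"
    have "?e\<^sup>2 \<le> \<delta>\<^sup>2" using assms(4)[OF that] assms(2) by (simp add: abs_le_square_iff[symmetric])
    moreover have "(x i - ?e)\<^sup>2 + (x i + ?e)\<^sup>2 = 2 * (x i)\<^sup>2 + 2 * ?e\<^sup>2"
      by (simp add: power2_eq_square algebra_simps)
    moreover have "(x i - ?e)\<^sup>2 = \<delta>\<^sup>2 * (real_of_int (z i))\<^sup>2" by (simp add: power_mult_distrib)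
    moreover have "0 \<le> (x i + ?e)\<^sup>2" by simp
    ultimately show ?thesis by linarith
  qed
  then have "(\<Sum>i\<in>I. \<delta>\<^sup>2 * (real_of_int (z i))\<^sup>2) \<le> (\<Sum>i\<in>I. 2 * (x i)\<^sup>2 + 2 * \<delta>\<^sup>2)"
    by (rule sum_mono)
  also have "\<dots> \<le> 2 * r + 2 * \<delta>\<^sup>2 * card I"
    using assms(3) by (simp add: sum.distrib sum_distrib_left[symmetric])
  finally have "(\<Sum>i\<in>I. (real_of_int (z i))\<^sup>2) * \<delta>\<^sup>2 \<le> 2 * r + 2 * \<delta>\<^sup>2 * card I"
    by (simp add: sum_distrib_left mult.commute)
  then have "(\<Sum>i\<in>I. (real_of_int (z i))\<^sup>2) \<le> (2 * r + 2 * \<delta>\<^sup>2 * card I) / \<delta>\<^sup>2"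
    using assms(2) by (simp add: pos_le_divide_eq)
  also have "\<dots> = 2 * r / \<delta>\<^sup>2 + 2 * card I"
    using assms(2) by (simp add: field_simps)
  finally show ?thesis using assms(5) by (simp add: lattice_ball_def)
qed

definition lattice_net :: "real \<Rightarrow> 'a set \<Rightarrow> real \<Rightarrow> ('a \<Rightarrow> complex) set" where
  "lattice_net \<delta> I R = (\<lambda>(z, w). lattice_vec \<delta> z w) ` (lattice_ball I R \<times> lattice_ball I R)"

lemma lattice_net_card:
  assumes "finite I"
  shows "finite (lattice_net \<delta> I R)"
    "real (card (lattice_net \<delta> I R)) \<le> exp (2 * R + 4 * card I)"
proof -
  note f = lattice_ball_card[OF assms, of R]
  show "finite (lattice_net \<delta> I R)" unfolding lattice_net_def using f by auto
  have "real (card (lattice_net \<delta> I R)) \<le> real (card (lattice_ball I R \<times> lattice_ball I R))"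
    unfolding lattice_net_def using f by (intro of_nat_mono card_image_le) auto
  also have "\<dots> = real (card (lattice_ball I R)) * real (card (lattice_ball I R))"
    by (simp add: card_cartesian_product)
  also have "\<dots> \<le> (exp R * 4 ^ card I) * (exp R * 4 ^ card I)"
    by (intro mult_mono f) auto
  \<comment> \<open>The bound \<open>4 <= exp 2\<close> turns the count into a pure exponential,
    ready to be compared with Gaussian tails.\<close>
  also have "\<dots> \<le> (exp R * exp (2 * card I)) * (exp R * exp (2 * card I))"
  proof -
    have "2 \<le> exp (1::real)" using exp_ge_add_one_self[of "1::real"] by simp
    then have "2 * 2 \<le> exp (1::real) * exp 1" by (intro mult_mono) auto
    then have "4 \<le> exp (2::real)" by (simp add: exp_add[symmetric])
    then have "4 ^ card I \<le> exp (2::real) ^ card I" by (intro power_mono) auto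
    then have "4 ^ card I \<le> exp (2 * real (card I))"
      by (simp add: exp_of_nat_mult[symmetric] mult.commute)
    then show ?thesis by (intro mult_mono) auto
  qed
  also have "\<dots> = exp (2 * R + 4 * card I)" by (simp add: exp_add[symmetric])
  finally show "real (card (lattice_net \<delta> I R)) \<le> exp (2 * R + 4 * card I)" .
qed

lemma lattice_vec_mem_net:
  fixes x :: "'a \<Rightarrow> complex"
  assumes "finite I" "0 < \<delta>" "nrm2 I x \<le> r"
    and z: "\<And>i. i \<in> I \<Longrightarrow> \<bar>Re (x i) - \<delta> * real_of_int (z i)\<bar> \<le> \<delta>" "z \<in> I \<rightarrow>\<^sub>E UNIV"
    and w: "\<And>i. i \<in> I \<Longrightarrow> \<bar>Im (x i) - \<delta> * real_of_int (w i)\<bar> \<le> \<delta>" "w \<in> I \<rightarrow>\<^sub>E UNIV"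
  shows "lattice_vec \<delta> z w \<in> lattice_net \<delta> I (2 * r / \<delta>\<^sup>2 + 2 * card I)"
proof -
  have eq: "nrm2 I x = (\<Sum>i\<in>I. (Re (x i))\<^sup>2) + (\<Sum>i\<in>I. (Im (x i))\<^sup>2)"
    by (simp add: nrm2_def cmod_power2 sum.distrib)
  have "0 \<le> (\<Sum>i\<in>I. (Re (x i))\<^sup>2)" "0 \<le> (\<Sum>i\<in>I. (Im (x i))\<^sup>2)" by (auto intro: sum_nonneg)
  with eq assms(3) have "(\<Sum>i\<in>I. (Re (x i))\<^sup>2) \<le> r" "(\<Sum>i\<in>I. (Im (x i))\<^sup>2) \<le> r" by auto
  then show ?thesis
    unfolding lattice_net_def
    using mem_lattice_ball_of_close[OF assms(1,2) _ z(1,2)] mem_lattice_ball_of_close[OF assms(1,2) _ w(1,2)]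
    by (auto intro!: image_eqI[of _ _ "(z, w)"])
qed

text \<open>Rounding down the real and imaginary parts costs at most \<delta> each, hence at most
  twice the square of \<delta> per coordinate.\<close>

lemma lattice_net_approx:
  fixes x :: "'a \<Rightarrow> complex"
  assumes "finite I" "0 < \<delta>" "nrm2 I x \<le> r"
  shows "\<exists>y\<in>lattice_net \<delta> I (2 * r / \<delta>\<^sup>2 + 2 * card I). nrm2 I (\<lambda>i. x i - y i) \<le> 2 * \<delta>\<^sup>2 * card I"
proof -
  define fl where "fl a = restrict (\<lambda>i. \<lfloor>a i / \<delta>\<rfloor>) I" for a :: "'a \<Rightarrow> real"
  have fl: "\<bar>a i - \<delta> * real_of_int (fl a i)\<bar> \<le> \<delta>" if "i \<in> I" for a i
  proof -
    have "real_of_int \<lfloor>a i / \<delta>\<rfloor> \<le> a i / \<delta>" "a i / \<delta> \<le> real_of_int \<lfloor>a i / \<delta>\<rfloor> + 1" by linarith+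
    moreover have "a i = \<delta> * (a i / \<delta>)" using assms(2) by simp
    ultimately have "\<delta> * real_of_int \<lfloor>a i / \<delta>\<rfloor> \<le> a i" "a i \<le> \<delta> * real_of_int \<lfloor>a i / \<delta>\<rfloor> + \<delta>"
      using mult_left_mono[of _ _ \<delta>] assms(2) by (metis less_imp_le, metis distrib_left less_imp_le mult.right_neutral)
    then show ?thesis using that assms(2) by (auto simp: fl_def abs_le_iff)
  qed
  have ext: "fl a \<in> I \<rightarrow>\<^sub>E UNIV" for a by (simp add: fl_def)
  let ?y = "lattice_vec \<delta> (fl (\<lambda>i. Re (x i))) (fl (\<lambda>i. Im (x i)))"
  have "(cmod (x i - ?y i))\<^sup>2 \<le> 2 * \<delta>\<^sup>2" if "i \<in> I" for i
  proof -
    have "(Re (x i - ?y i))\<^sup>2 \<le> \<delta>\<^sup>2" "(Im (x i - ?y i))\<^sup>2 \<le> \<delta>\<^sup>2"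
      using fl[OF that, of "\<lambda>i. Re (x i)"] fl[OF that, of "\<lambda>i. Im (x i)"] assms(2)
      by (auto simp: lattice_vec_def abs_le_square_iff[symmetric])
    then show ?thesis by (simp add: cmod_power2)
  qed
  then have "nrm2 I (\<lambda>i. x i - ?y i) \<le> (\<Sum>i\<in>I. 2 * \<delta>\<^sup>2)"
    unfolding nrm2_def by (rule sum_mono)
  moreover have "?y \<in> lattice_net \<delta> I (2 * r / \<delta>\<^sup>2 + 2 * card I)"
    by (rule lattice_vec_mem_net[OF assms fl ext fl ext])
  ultimately show ?thesis by (auto simp: mult.commute)
qed

text \<open>The two neighbouring lattice points leave errors of opposite sign, so one of them makes the
  cross term in the expansion of the square nonpositive.\<close>

lemma greedy_round_real:
  fixes x r :: "'j \<Rightarrow> complex" and a \<delta> :: real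
  assumes "0 < \<delta>"
  shows "\<exists>z::int. \<bar>a - \<delta> * z\<bar> \<le> \<delta> \<and>
    nrm2 J (\<lambda>j. x j + complex_of_real (a - \<delta> * z) * r j) \<le> nrm2 J x + \<delta>\<^sup>2 * nrm2 J r"
proof -
  define t where "t = (\<Sum>j\<in>J. Re (x j) * Re (r j) + Im (x j) * Im (r j))"
  have expand: "nrm2 J (\<lambda>j. x j + complex_of_real e * r j) = nrm2 J x + 2 * e * t + e\<^sup>2 * nrm2 J r" for e
    unfolding nrm2_def t_def sum_distrib_left sum.distrib[symmetric]
    by (intro sum.cong refl) (simp add: cmod_power2, simp add: power2_eq_square algebra_simps)
  define n where "n = \<lfloor>a / \<delta>\<rfloor>"
  have "real_of_int n \<le> a / \<delta>" "a / \<delta> \<le> real_of_int n + 1" unfolding n_def by linarith+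
  then have n: "\<delta> * n \<le> a" "a \<le> \<delta> * (n + 1)" using assms by (auto simp: field_simps)
  obtain z :: int where z: "\<bar>a - \<delta> * z\<bar> \<le> \<delta>" "(a - \<delta> * z) * t \<le> 0"
  proof (cases "t \<le> 0")
    case True
    show ?thesis
    proof (rule that[of n])
      show "(a - \<delta> * real_of_int n) * t \<le> 0" using n True by (intro mult_nonneg_nonpos) auto
      show "\<bar>a - \<delta> * real_of_int n\<bar> \<le> \<delta>" using n by (auto simp: algebra_simps)
    qed
  next
    case False
    show ?thesis
    proof (rule that[of "n + 1"])
      have "a - \<delta> * real_of_int (n + 1) \<le> 0" using n by simp
      then show "(a - \<delta> * real_of_int (n + 1)) * t \<le> 0" using False by (intro mult_nonpos_nonneg) auto
      show "\<bar>a - \<delta> * real_of_int (n + 1)\<bar> \<le> \<delta>" using n by (auto simp: algebra_simps)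
    qed
  qed
  have "(a - \<delta> * z)\<^sup>2 \<le> \<delta>\<^sup>2" using z(1) assms by (simp add: abs_le_square_iff[symmetric])
  then have "(a - \<delta> * z)\<^sup>2 * nrm2 J r \<le> \<delta>\<^sup>2 * nrm2 J r"
    by (intro mult_right_mono nrm2_nonneg)
  moreover have "2 * (a - \<delta> * z) * t \<le> 0" using z(2) by (simp only: mult.assoc)
  ultimately show ?thesis using z(1) unfolding expand by (intro exI[of _ z]) linarith
qed

text \<open>The coefficients are rounded one after the other, each in two real steps: the real part
  against \<open>r k\<close>, the imaginary part against \<open>\<i> * r k\<close>. Since no step
  has a positive cross term, the squared errors simply add up, and no factor \<open>k\<close> is
  lost to a triangle inequality.\<close>

lemma greedy_round:
  fixes r :: "nat \<Rightarrow> 'j \<Rightarrow> complex" and q :: "nat \<Rightarrow> complex" and \<delta> :: real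
  assumes "0 < \<delta>"
  shows "\<exists>z w :: nat \<Rightarrow> int. (\<forall>l<k. \<bar>Re (q l) - \<delta> * z l\<bar> \<le> \<delta>) \<and> (\<forall>l<k. \<bar>Im (q l) - \<delta> * w l\<bar> \<le> \<delta>) \<and>
    nrm2 J (\<lambda>j. \<Sum>l<k. (q l - lattice_vec \<delta> z w l) * r l j) \<le> 2 * \<delta>\<^sup>2 * (\<Sum>l<k. nrm2 J (r l))"
proof (induction k)
  case 0
  show ?case by (auto simp: nrm2_def)
next
  case (Suc k)
  then obtain z w where zw: "\<forall>l<k. \<bar>Re (q l) - \<delta> * z l\<bar> \<le> \<delta>" "\<forall>l<k. \<bar>Im (q l) - \<delta> * w l\<bar> \<le> \<delta>"
    "nrm2 J (\<lambda>j. \<Sum>l<k. (q l - lattice_vec \<delta> z w l) * r l j) \<le> 2 * \<delta>\<^sup>2 * (\<Sum>l<k. nrm2 J (r l))"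
    by blast
  define x where "x j = (\<Sum>l<k. (q l - lattice_vec \<delta> z w l) * r l j)" for j
  obtain s :: int where s: "\<bar>Re (q k) - \<delta> * s\<bar> \<le> \<delta>"
    "nrm2 J (\<lambda>j. x j + complex_of_real (Re (q k) - \<delta> * s) * r k j) \<le> nrm2 J x + \<delta>\<^sup>2 * nrm2 J (r k)"
    using greedy_round_real[OF assms] by blast
  define x' where "x' j = x j + complex_of_real (Re (q k) - \<delta> * s) * r k j" for j
  obtain t :: int where t: "\<bar>Im (q k) - \<delta> * t\<bar> \<le> \<delta>"
    "nrm2 J (\<lambda>j. x' j + complex_of_real (Im (q k) - \<delta> * t) * (\<i> * r k j)) \<le> nrm2 J x' + \<delta>\<^sup>2 * nrm2 J (\<lambda>j. \<i> * r k j)"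
    using greedy_round_real[OF assms, of "Im (q k)" J x' "\<lambda>j. \<i> * r k j"] by blast
  have i: "nrm2 J (\<lambda>j. \<i> * r k j) = nrm2 J (r k)" by (simp add: nrm2_def norm_mult)
  have q: "q k - lattice_vec \<delta> (z(k := s)) (w(k := t)) k
     = complex_of_real (Re (q k) - \<delta> * s) + complex_of_real (Im (q k) - \<delta> * t) * \<i>"
    by (simp add: complex_eq_iff lattice_vec_def)
  have "(\<Sum>l<Suc k. (q l - lattice_vec \<delta> (z(k := s)) (w(k := t)) l) * r l j)
      = x' j + complex_of_real (Im (q k) - \<delta> * t) * (\<i> * r k j)" for j
  proof -
    have "(\<Sum>l<k. (q l - lattice_vec \<delta> (z(k := s)) (w(k := t)) l) * r l j) = x j"
      unfolding x_def by (intro sum.cong) (auto simp: lattice_vec_def)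
    then show ?thesis unfolding sum.lessThan_Suc q x'_def by (simp add: algebra_simps)
  qed
  note eq = this
  have "nrm2 J (\<lambda>j. \<Sum>l<Suc k. (q l - lattice_vec \<delta> (z(k := s)) (w(k := t)) l) * r l j)
     \<le> 2 * \<delta>\<^sup>2 * (\<Sum>l<Suc k. nrm2 J (r l))"
    unfolding eq using t(2) s(2) zw(3) unfolding x'_def[symmetric] x_def[symmetric] i
    by (simp only: sum.lessThan_Suc distrib_left)
  moreover have "\<forall>l<Suc k. \<bar>Re (q l) - \<delta> * (z(k := s)) l\<bar> \<le> \<delta>"
    "\<forall>l<Suc k. \<bar>Im (q l) - \<delta> * (w(k := t)) l\<bar> \<le> \<delta>"
    using zw(1,2) s(1) t(1) by (auto simp: less_Suc_eq)
  ultimately show ?case by (intro exI[of _ "z(k := s)"] exI[of _ "w(k := t)"] conjI)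
qed

lemma unit_ball_net:
  fixes \<epsilon> :: real
  assumes "0 < \<epsilon>" "finite I" "I \<noteq> {}"
  shows "\<exists>N :: ('a \<Rightarrow> complex) set. finite N \<and> real (card N) \<le> exp ((8 / \<epsilon>\<^sup>2 + 8) * card I) \<and>
    (\<forall>x. nrm2 I x \<le> 1 \<longrightarrow> (\<exists>y\<in>N. nrm2 I (\<lambda>i. x i - y i) \<le> \<epsilon>\<^sup>2))"
proof -
  define n where "n = real (card I)"
  have n: "0 < n" using assms by (simp add: n_def card_gt_0_iff)
  \<comment> \<open>The mesh for which the squared rounding error
    \<open>2 * \<delta>\<^sup>2 * n\<close> is exactly \<open>\<epsilon>\<^sup>2\<close>.\<close>
  define \<delta> where "\<delta> = \<epsilon> / sqrt (2 * n)"
  have d: "0 < \<delta>" "\<delta>\<^sup>2 = \<epsilon>\<^sup>2 / (2 * n)"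
    using assms n by (auto simp: \<delta>_def power_divide)
  have R: "2 * 1 / \<delta>\<^sup>2 + 2 * n = (4 / \<epsilon>\<^sup>2 + 2) * n" "2 * \<delta>\<^sup>2 * n = \<epsilon>\<^sup>2"
    unfolding d(2) using assms n by (auto simp: field_simps)
  have card: "2 * (2 * 1 / \<delta>\<^sup>2 + 2 * n) + 4 * n = (8 / \<epsilon>\<^sup>2 + 8) * n"
    unfolding R(1) by (simp add: algebra_simps)
  show ?thesis
    using lattice_net_card[OF assms(2), of \<delta> "2 * 1 / \<delta>\<^sup>2 + 2 * n"]
      lattice_net_approx[OF assms(2) d(1), where r = 1]
    unfolding n_def[symmetric] of_nat_mult of_nat_numeral card R(2)
    by (intro exI[of _ "lattice_net \<delta> I (2 * 1 / \<delta>\<^sup>2 + 2 * n)"]) blast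
qed

text \<open>The assumptions on \<open>q\<close> are those of a system of orthonormal or zero vectors.  The factor \<open>r\<close> is
  rounded first, while \<open>q\<close> is still a contraction; then \<open>q\<close> is rounded greedily against the
  already rounded \<open>r\<close>, which avoids any control of the operator norm of the rounded \<open>q\<close>.\<close>

lemma low_rank_net:
  fixes \<epsilon> :: real
  assumes "0 < \<epsilon>" "\<epsilon> \<le> 1" "0 < d" "0 < k"
  shows "\<exists>N :: (nat \<times> nat \<Rightarrow> complex) set. finite N \<and>
    real (card N) \<le> exp ((500 / \<epsilon>\<^sup>2 + 16) * real (k * d)) \<and>
    (\<forall>q r. (\<forall>l<k. nrm2 {..<d} (q l) \<le> 1) \<longrightarrow>
       (\<forall>c. nrm2 {..<d} (\<lambda>i. \<Sum>l<k. q l i * c l) \<le> nrm2 {..<k} c) \<longrightarrow>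
       (\<Sum>l<k. nrm2 {..<d} (r l)) \<le> 1 \<longrightarrow>
       (\<exists>y\<in>N. nrm2 (idx d) (\<lambda>a. (\<Sum>l<k. q l (fst a) * r l (snd a)) - y a) \<le> \<epsilon>\<^sup>2))"
proof -
  define K where "K = {..<k} \<times> {..<d}"
  have K: "finite K" "card K = k * d" by (auto simp: K_def)
  define n where "n = real (k * d)"
  have n: "0 < n" using assms by (simp add: n_def)
  \<comment> \<open>The squared errors below add up to
    \<open>2 * \<eta>\<^sup>2 + 2 * (4 * \<eta>\<^sup>2)\<close>, which is less than
    \<open>16 * \<eta>\<^sup>2 = \<epsilon>\<^sup>2\<close>.\<close>
  define \<eta> where "\<eta> = \<epsilon> / 4"
  have \<eta>: "0 < \<eta>" "\<eta> \<le> 1" using assms by (auto simp: \<eta>_def)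
  \<comment> \<open>The factor \<open>r\<close> is rounded as a single vector of
    \<open>k * d\<close> entries. The factor \<open>q\<close> is rounded in \<open>d\<close>
    separate rows, so its mesh depends on \<open>d\<close> only; this coarser mesh offsets its
    larger squared norm \<open>k\<close>, and both lattice radii are of order
    \<open>k * d\<close>.\<close>
  define \<delta>1 where "\<delta>1 = \<eta> / sqrt (2 * n)"
  define \<delta>2 where "\<delta>2 = \<eta> / sqrt (2 * d)"
  have d1: "0 < \<delta>1" "\<delta>1\<^sup>2 = \<eta>\<^sup>2 / (2 * n)" and d2: "0 < \<delta>2" "\<delta>2\<^sup>2 = \<eta>\<^sup>2 / (2 * d)"
    using assms n \<eta> by (auto simp: \<delta>1_def \<delta>2_def power_divide)
  define R1 where "R1 = 2 * 1 / \<delta>1\<^sup>2 + 2 * real (card K)"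
  define R2 where "R2 = 2 * real k / \<delta>2\<^sup>2 + 2 * real (card K)"
  have R: "R1 = (4 / \<eta>\<^sup>2 + 2) * n" "R2 = (4 / \<eta>\<^sup>2 + 2) * n"
    unfolding R1_def R2_def d1(2) d2(2) K(2) n_def using \<eta> assms by (auto simp: field_simps)
  let ?N1 = "lattice_net \<delta>1 K R1" and ?N2 = "lattice_net \<delta>2 K R2"
  define prd :: "(nat \<times> nat \<Rightarrow> complex) \<times> (nat \<times> nat \<Rightarrow> complex) \<Rightarrow> nat \<times> nat \<Rightarrow> complex"
    where "prd = (\<lambda>(s, t) a. \<Sum>l<k. t (l, fst a) * s (l, snd a))"
  let ?N = "prd ` (?N1 \<times> ?N2)"
  have fin: "finite ?N" using K by (auto simp: lattice_net_card)
  have "real (card ?N) \<le> real (card (?N1 \<times> ?N2))"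
    using K by (intro of_nat_mono card_image_le) (auto simp: lattice_net_card)
  also have "\<dots> = real (card ?N1) * real (card ?N2)" by (simp add: card_cartesian_product)
  also have "\<dots> \<le> exp (2 * R1 + real (4 * card K)) * exp (2 * R2 + real (4 * card K))"
    by (intro mult_mono lattice_net_card K) auto
  also have "\<dots> = exp ((16 / \<eta>\<^sup>2 + 16) * n)"
    by (simp add: exp_add[symmetric] R K n_def algebra_simps)
  also have "\<dots> \<le> exp ((500 / \<epsilon>\<^sup>2 + 16) * n)"
    using n assms by (simp add: \<eta>_def power_divide field_simps)
  finally have card: "real (card ?N) \<le> exp ((500 / \<epsilon>\<^sup>2 + 16) * n)" .
  have "\<exists>y\<in>?N. nrm2 (idx d) (\<lambda>a. (\<Sum>l<k. q l (fst a) * r l (snd a)) - y a) \<le> \<epsilon>\<^sup>2"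
    if q1: "\<forall>l<k. nrm2 {..<d} (q l) \<le> 1"
      and q2: "\<forall>c. nrm2 {..<d} (\<lambda>i. \<Sum>l<k. q l i * c l) \<le> nrm2 {..<k} c"
      and r: "(\<Sum>l<k. nrm2 {..<d} (r l)) \<le> 1"
    for q r :: "nat \<Rightarrow> nat \<Rightarrow> complex"
  proof -
    have nK: "nrm2 K (\<lambda>a. f (fst a) (snd a)) = (\<Sum>l<k. nrm2 {..<d} (f l))" for f
      unfolding K_def nrm2_def by (simp add: sum.cartesian_product case_prod_unfold)
    have "nrm2 K (\<lambda>a. r (fst a) (snd a)) \<le> 1" using r nK by simp
    from lattice_net_approx[OF K(1) d1(1) this]
    obtain s where s: "s \<in> ?N1" "nrm2 K (\<lambda>a. r (fst a) (snd a) - s a) \<le> 2 * \<delta>1\<^sup>2 * card K"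
      unfolding R1_def by (auto simp: K)
    have s2: "nrm2 K (\<lambda>a. r (fst a) (snd a) - s a) \<le> \<eta>\<^sup>2"
      using s(2) n unfolding d1(2) K(2) n_def[symmetric] by simp
    define r' where "r' l j = s (l, j)" for l j
    have e1: "(\<Sum>l<k. nrm2 {..<d} (\<lambda>j. r l j - r' l j)) \<le> \<eta>\<^sup>2"
      using s2 nK[of "\<lambda>l j. r l j - r' l j"] by (simp add: r'_def)
    have "(\<Sum>l<k. nrm2 {..<d} (r' l)) \<le> (\<Sum>l<k. 2 * nrm2 {..<d} (r l) + 2 * nrm2 {..<d} (\<lambda>j. r l j - r' l j))"
    proof (rule sum_mono)
      fix l
      show "nrm2 {..<d} (r' l) \<le> 2 * nrm2 {..<d} (r l) + 2 * nrm2 {..<d} (\<lambda>j. r l j - r' l j)"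
        using nrm2_diff_le[of "{..<d}" "r l" "\<lambda>j. r l j - r' l j"] by simp
    qed
    also have "\<dots> \<le> 2 * 1 + 2 * \<eta>\<^sup>2"
      unfolding sum.distrib sum_distrib_left[symmetric] using r e1 by simp
    also have "\<dots> \<le> 4" using \<eta> by (simp add: power_le_one)
    finally have r'4: "(\<Sum>l<k. nrm2 {..<d} (r' l)) \<le> 4" .
    \<comment> \<open>For each fixed \<open>j\<close> the contraction property of \<open>q\<close>
      is applied to the coefficients \<open>r l j - r' l j\<close>.\<close>
    have E1: "nrm2 (idx d) (\<lambda>a. \<Sum>l<k. q l (fst a) * (r l (snd a) - r' l (snd a))) \<le> \<eta>\<^sup>2"
    proof -
      have "nrm2 (idx d) (\<lambda>a. \<Sum>l<k. q l (fst a) * (r l (snd a) - r' l (snd a)))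
        = (\<Sum>j<d. nrm2 {..<d} (\<lambda>i. \<Sum>l<k. q l i * (r l j - r' l j)))"
        unfolding idx_def nrm2_def sum.cartesian_product'
        by (subst sum.swap) simp
      also have "\<dots> \<le> (\<Sum>j<d. nrm2 {..<k} (\<lambda>l. r l j - r' l j))"
        by (intro sum_mono q2[rule_format])
      also have "\<dots> = (\<Sum>l<k. nrm2 {..<d} (\<lambda>j. r l j - r' l j))"
        unfolding nrm2_def by (rule sum.swap)
      finally show ?thesis using e1 by simp
    qed
    \<comment> \<open>Each row \<open>i\<close> of \<open>q\<close> is rounded on its own, against
      the same rounded vectors \<open>r' l\<close>.\<close>
    define good where "good i z w \<longleftrightarrow> (\<forall>l<k. \<bar>Re (q l i) - \<delta>2 * real_of_int (z l)\<bar> \<le> \<delta>2) \<and>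
      (\<forall>l<k. \<bar>Im (q l i) - \<delta>2 * real_of_int (w l)\<bar> \<le> \<delta>2) \<and>
      nrm2 {..<d} (\<lambda>j. \<Sum>l<k. (q l i - lattice_vec \<delta>2 z w l) * r' l j) \<le> 2 * \<delta>2\<^sup>2 * (\<Sum>l<k. nrm2 {..<d} (r' l))"
      for i z w
    have "\<forall>i. \<exists>z w. good i z w"
      unfolding good_def by (intro allI greedy_round[OF d2(1)])
    then obtain z w where "\<And>i. good i (z i) (w i)" by metis
    then have zw: "\<And>i l. l < k \<Longrightarrow> \<bar>Re (q l i) - \<delta>2 * z i l\<bar> \<le> \<delta>2" "\<And>i l. l < k \<Longrightarrow> \<bar>Im (q l i) - \<delta>2 * w i l\<bar> \<le> \<delta>2"
      "\<And>i. nrm2 {..<d} (\<lambda>j. \<Sum>l<k. (q l i - lattice_vec \<delta>2 (z i) (w i) l) * r' l j) \<le> 2 * \<delta>2\<^sup>2 * (\<Sum>l<k. nrm2 {..<d} (r' l))"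
      by (auto simp: good_def)
    define Z where "Z f = restrict (\<lambda>a. f (snd a) (fst a)) K" for f :: "nat \<Rightarrow> nat \<Rightarrow> int"
    define t where "t = lattice_vec \<delta>2 (Z z) (Z w)"
    have "t \<in> lattice_net \<delta>2 K (2 * real k / \<delta>2\<^sup>2 + 2 * card K)" unfolding t_def
    proof (rule lattice_vec_mem_net[OF K(1) d2(1)])
      have "(\<Sum>l<k. nrm2 {..<d} (q l)) \<le> (\<Sum>l<k. 1)" using q1 by (intro sum_mono) auto
      then show "nrm2 K (\<lambda>a. q (fst a) (snd a)) \<le> real k" using nK[of q] by simp
    qed (use zw in \<open>auto simp: Z_def K_def\<close>)
    then have t: "t \<in> ?N2" by (simp add: R2_def)
    have tl: "t (l, i) = lattice_vec \<delta>2 (z i) (w i) l" if "l < k" "i < d" for l i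
      using that by (simp add: t_def Z_def K_def lattice_vec_def)
    have E2: "nrm2 (idx d) (\<lambda>a. \<Sum>l<k. (q l (fst a) - t (l, fst a)) * r' l (snd a)) \<le> 4 * \<eta>\<^sup>2"
    proof -
      have "nrm2 (idx d) (\<lambda>a. \<Sum>l<k. (q l (fst a) - t (l, fst a)) * r' l (snd a))
        = (\<Sum>i<d. nrm2 {..<d} (\<lambda>j. \<Sum>l<k. (q l i - lattice_vec \<delta>2 (z i) (w i) l) * r' l j))"
        unfolding idx_def nrm2_def sum.cartesian_product'
        by (intro sum.cong refl arg_cong[where f = "\<lambda>x. (cmod x)\<^sup>2"]) (simp add: tl)
      also have "\<dots> \<le> (\<Sum>i<d. 2 * \<delta>2\<^sup>2 * 4)"
        by (intro sum_mono order_trans[OF zw(3)] mult_left_mono r'4) auto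
      also have "\<dots> = 4 * \<eta>\<^sup>2" unfolding d2(2) using assms by simp
      finally show ?thesis .
    qed
    \<comment> \<open>The telescoping identity \<open>q r - t s = q (r - s) + (q - t) s\<close> for
      the two factors.\<close>
    have split: "(\<Sum>l<k. q l (fst a) * r l (snd a)) - prd (s, t) a
       = (\<Sum>l<k. q l (fst a) * (r l (snd a) - r' l (snd a))) + (\<Sum>l<k. (q l (fst a) - t (l, fst a)) * r' l (snd a))" for a
      unfolding prd_def r'_def sum_subtractf[symmetric] sum.distrib[symmetric]
      by (simp add: algebra_simps sum_subtractf sum.distrib)
    have "nrm2 (idx d) (\<lambda>a. (\<Sum>l<k. q l (fst a) * r l (snd a)) - prd (s, t) a) \<le> 2 * \<eta>\<^sup>2 + 2 * (4 * \<eta>\<^sup>2)"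
      unfolding split by (rule order_trans[OF nrm2_add_le]) (use E1 E2 in simp)
    also have "\<dots> \<le> \<epsilon>\<^sup>2" by (simp add: \<eta>_def power_divide)
    finally show ?thesis using s(1) t by blast
  qed
  with fin card show ?thesis unfolding n_def by blast
qed


section \<open>Vectors of bounded Schmidt rank\<close>

definition ip :: "'a set \<Rightarrow> ('a \<Rightarrow> complex) \<Rightarrow> ('a \<Rightarrow> complex) \<Rightarrow> complex" where
  "ip I x y = (\<Sum>a\<in>I. cnj (x a) * y a)"

lemma ip_self: "ip I x x = complex_of_real (nrm2 I x)"
  unfolding ip_def nrm2_def of_real_sum
  by (intro sum.cong refl) (metis complex_norm_square mult.commute)

lemma ip_cnj: "cnj (ip I x y) = ip I y x"
  by (simp add: ip_def mult.commute)

lemma ip_sum_right: "ip I x (\<lambda>a. \<Sum>l\<in>L. f l a * c l) = (\<Sum>l\<in>L. ip I x (f l) * c l)"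
  unfolding ip_def sum_distrib_left sum_distrib_right by (subst sum.swap) (simp add: mult.assoc)

lemma ip_cong: "(\<And>a. a \<in> I \<Longrightarrow> y a = y' a) \<Longrightarrow> ip I x y = ip I x y'"
  by (simp add: ip_def)

lemma nrm2_eq_0: "finite I \<Longrightarrow> nrm2 I x = 0 \<longleftrightarrow> (\<forall>a\<in>I. x a = 0)"
  by (simp add: nrm2_def sum_nonneg_eq_0_iff)

text \<open>Zero vectors are allowed in the Gram--Schmidt system, so that no linear independence has to
  be assumed.\<close>

definition ortho_sys :: "'a set \<Rightarrow> nat \<Rightarrow> (nat \<Rightarrow> 'a \<Rightarrow> complex) \<Rightarrow> bool" where
  "ortho_sys I k q \<longleftrightarrow> (\<forall>l<k. \<forall>m<k. l \<noteq> m \<longrightarrow> ip I (q l) (q m) = 0) \<and>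
     (\<forall>l<k. nrm2 I (q l) = 1 \<or> (\<forall>a\<in>I. q l a = 0))"

text \<open>For an \<open>ortho_sys\<close> this says that \<open>x\<close> equals its orthogonal
  projection onto the span of \<open>q\<close>. The form is linear in \<open>x\<close> and names the
  coefficients, which later become the second factor of a Schmidt rank factorisation.\<close>

definition in_span :: "'a set \<Rightarrow> nat \<Rightarrow> (nat \<Rightarrow> 'a \<Rightarrow> complex) \<Rightarrow> ('a \<Rightarrow> complex) \<Rightarrow> bool" where
  "in_span I k q x \<longleftrightarrow> (\<forall>a\<in>I. x a = (\<Sum>l<k. q l a * ip I (q l) x))"

lemma in_span_sum:
  assumes "\<And>s. s \<in> S \<Longrightarrow> in_span I k q (x s)" "\<And>a. a \<in> I \<Longrightarrow> y a = (\<Sum>s\<in>S. x s a * c s)"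
  shows "in_span I k q y"
  unfolding in_span_def
proof
  fix a assume a: "a \<in> I"
  have "y a = (\<Sum>s\<in>S. (\<Sum>l<k. q l a * ip I (q l) (x s)) * c s)"
    using assms a by (simp add: in_span_def)
  also have "\<dots> = (\<Sum>l<k. q l a * (\<Sum>s\<in>S. ip I (q l) (x s) * c s))"
    unfolding sum_distrib_left sum_distrib_right by (subst sum.swap) (simp add: mult.assoc)
  also have "\<dots> = (\<Sum>l<k. q l a * ip I (q l) y)"
    unfolding ip_sum_right[symmetric] using assms(2) by (simp cong: ip_cong)
  finally show "y a = (\<Sum>l<k. q l a * ip I (q l) y)" .
qed

lemma ip_ortho_sum:
  assumes "ortho_sys I k q" "l < k"
  shows "ip I (q l) (\<lambda>a. \<Sum>m<k. q m a * c m) = complex_of_real (nrm2 I (q l)) * c l"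
proof -
  have "(\<Sum>m<k. ip I (q l) (q m) * c m) = (\<Sum>m<k. if m = l then complex_of_real (nrm2 I (q l)) * c l else 0)"
    using assms by (intro sum.cong) (auto simp: ortho_sys_def ip_self)
  then show ?thesis using assms(2) unfolding ip_sum_right by simp
qed

lemma ip_scale_right: "ip I x (\<lambda>a. c * y a) = c * ip I x y"
  by (simp add: ip_def sum_distrib_left mult.left_commute)

lemma ip_diff_right: "ip I x (\<lambda>a. y a - z a) = ip I x y - ip I x z"
  by (simp add: ip_def sum_subtractf right_diff_distrib)

lemma ortho_nrm2_le_1: "ortho_sys I k q \<Longrightarrow> l < k \<Longrightarrow> nrm2 I (q l) \<le> 1"
  by (auto simp: ortho_sys_def nrm2_def)

lemma ip_ortho_absorb:
  assumes "ortho_sys I k q" "l < k"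
  shows "complex_of_real (nrm2 I (q l)) * ip I (q l) x = ip I (q l) x"
proof (cases "nrm2 I (q l) = 1")
  case False
  then have "\<forall>a\<in>I. q l a = 0" using assms by (auto simp: ortho_sys_def)
  then show ?thesis by (simp add: ip_def)
qed simp

lemma gram_schmidt:
  assumes "finite I"
  shows "\<exists>q. ortho_sys I k q \<and> (\<forall>l<k. in_span I k q (x l))"
proof (induction k)
  case 0
  show ?case by (simp add: ortho_sys_def)
next
  case (Suc k)
  then obtain q where q: "ortho_sys I k q" "\<And>l. l < k \<Longrightarrow> in_span I k q (x l)" by blast
  define y where "y a = x k a - (\<Sum>l<k. q l a * ip I (q l) (x k))" for a
  \<comment> \<open>If \<open>nrm2 I y = 0\<close>, division by zero makes \<open>v\<close> the zero
    vector, the degenerate case that \<open>ortho_sys\<close> admits.\<close>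
  define v where "v a = (1 / complex_of_real (sqrt (nrm2 I y))) * y a" for a
  define q' where "q' = q(k := v)"
  have orth_y: "ip I (q l) y = 0" if "l < k" for l
    unfolding y_def ip_diff_right ip_ortho_sum[OF q(1) that] using ip_ortho_absorb[OF q(1) that] by simp
  have orth_v: "ip I (q l) v = 0" "ip I v (q l) = 0" if "l < k" for l
  proof -
    show *: "ip I (q l) v = 0" unfolding v_def ip_scale_right using orth_y[OF that] by simp
    show "ip I v (q l) = 0" using ip_cnj[of I "q l" v] * by simp
  qed
  have nrm_v: "nrm2 I v = 1 \<or> (\<forall>a\<in>I. v a = 0)"
  proof (cases "nrm2 I y = 0")
    case True
    then show ?thesis using nrm2_eq_0[OF assms, of y] by (simp add: v_def)
  next
    case False
    then have "0 < nrm2 I y" using nrm2_nonneg[of I y] by simp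
    moreover have "nrm2 I v = (1 / sqrt (nrm2 I y))\<^sup>2 * nrm2 I y"
      unfolding nrm2_def v_def sum_distrib_left
      by (intro sum.cong refl) (simp add: norm_mult norm_divide power_mult_distrib power_divide)
    ultimately show ?thesis by (simp add: power_divide)
  qed
  have "ortho_sys I (Suc k) q'"
    using q(1) orth_v nrm_v by (auto simp: ortho_sys_def q'_def less_Suc_eq)
  moreover have "in_span I (Suc k) q' (x l)" if "l < k" for l
    unfolding in_span_def
  proof
    fix a assume a: "a \<in> I"
    have "ip I v (x l) = ip I v (\<lambda>a. \<Sum>m<k. q m a * ip I (q m) (x l))"
      using q(2)[OF that] by (intro ip_cong) (simp add: in_span_def)
    also have "\<dots> = 0" unfolding ip_sum_right by (simp add: orth_v)
    finally have "ip I v (x l) = 0" .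
    then show "x l a = (\<Sum>m<Suc k. q' m a * ip I (q' m) (x l))"
      using q(2)[OF that] a by (simp add: in_span_def q'_def)
  qed
  moreover have "in_span I (Suc k) q' (x k)"
    unfolding in_span_def
  proof
    fix a assume a: "a \<in> I"
    have xk: "x k = (\<lambda>a. y a + (\<Sum>l<k. q l a * ip I (q l) (x k)))" by (simp add: y_def)
    have "ip I v (x k) = ip I v y + ip I v (\<lambda>a. \<Sum>l<k. q l a * ip I (q l) (x k))"
      by (subst xk) (simp add: ip_def sum.distrib distrib_left)
    also have "ip I v (\<lambda>a. \<Sum>l<k. q l a * ip I (q l) (x k)) = 0"
      unfolding ip_sum_right by (simp add: orth_v)
    also have "ip I v y = (1 / complex_of_real (sqrt (nrm2 I y))) * nrm2 I y"
      unfolding ip_self[symmetric] by (simp add: v_def ip_def sum_distrib_left sum_divide_distrib)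
    finally have ipv: "ip I v (x k) = (1 / complex_of_real (sqrt (nrm2 I y))) * nrm2 I y" by simp
    have "v a * ip I v (x k) = y a"
    proof (cases "nrm2 I y = 0")
      case True
      then show ?thesis using nrm2_eq_0[OF assms, of y] a by (simp add: v_def)
    next
      case False
      have "complex_of_real (sqrt (nrm2 I y)) * complex_of_real (sqrt (nrm2 I y)) = complex_of_real (nrm2 I y)"
        unfolding of_real_mult[symmetric] using nrm2_nonneg[of I y] by simp
      then show ?thesis using False unfolding ipv by (simp add: v_def field_simps)
    qed
    then show "x k a = (\<Sum>m<Suc k. q' m a * ip I (q' m) (x k))"
      by (simp add: q'_def y_def)
  qed
  ultimately show ?case by (intro exI[of _ q']) (auto simp: less_Suc_eq)
qed

lemma nrm2_ortho_sum:
  assumes "ortho_sys I k q"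
  shows "nrm2 I (\<lambda>a. \<Sum>l<k. q l a * c l) = (\<Sum>l<k. nrm2 I (q l) * (cmod (c l))\<^sup>2)"
proof -
  let ?y = "\<lambda>a. \<Sum>l<k. q l a * c l"
  have "complex_of_real (nrm2 I ?y) = ip I ?y ?y" by (simp add: ip_self)
  also have "\<dots> = (\<Sum>l<k. ip I ?y (q l) * c l)" by (rule ip_sum_right)
  also have "\<dots> = (\<Sum>l<k. cnj (ip I (q l) ?y) * c l)" by (simp only: ip_cnj)
  also have "\<dots> = (\<Sum>l<k. complex_of_real (nrm2 I (q l) * (cmod (c l))\<^sup>2))"
  proof (intro sum.cong refl)
    fix l assume "l \<in> {..<k}"
    then have "cnj (ip I (q l) ?y) * c l = complex_of_real (nrm2 I (q l)) * (c l * cnj (c l))"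
      using ip_ortho_sum[OF assms, of l c] by (simp add: mult_ac)
    then show "cnj (ip I (q l) ?y) * c l = complex_of_real (nrm2 I (q l) * (cmod (c l))\<^sup>2)"
      by (simp only: complex_norm_square[symmetric] of_real_mult of_real_power)
  qed
  finally show ?thesis unfolding of_real_sum[symmetric] of_real_eq_iff .
qed

text \<open>Supplies the contraction hypothesis on \<open>q\<close> in
  \<open>low_rank_net\<close>.\<close>

lemma nrm2_ortho_sum_le:
  assumes "ortho_sys I k q"
  shows "nrm2 I (\<lambda>a. \<Sum>l<k. q l a * c l) \<le> nrm2 {..<k} c"
  unfolding nrm2_ortho_sum[OF assms] nrm2_def[of "{..<k}"]
  by (intro sum_mono mult_left_le_one_le nrm2_nonneg) (auto simp: ortho_nrm2_le_1[OF assms])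

lemma in_span_parseval:
  assumes "ortho_sys I k q" "in_span I k q x"
  shows "(\<Sum>l<k. (cmod (ip I (q l) x))\<^sup>2) = nrm2 I x"
proof -
  have "nrm2 I x = nrm2 I (\<lambda>a. \<Sum>l<k. q l a * ip I (q l) x)"
    unfolding nrm2_def using assms(2) by (intro sum.cong) (auto simp: in_span_def)
  also have "\<dots> = (\<Sum>l<k. nrm2 I (q l) * (cmod (ip I (q l) x))\<^sup>2)"
    by (rule nrm2_ortho_sum[OF assms(1)])
  also have "\<dots> = (\<Sum>l<k. (cmod (ip I (q l) x))\<^sup>2)"
  proof (intro sum.cong refl)
    fix l assume "l \<in> {..<k}"
    then show "nrm2 I (q l) * (cmod (ip I (q l) x))\<^sup>2 = (cmod (ip I (q l) x))\<^sup>2"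
      using assms(1) by (cases "nrm2 I (q l) = 1") (auto simp: ortho_sys_def ip_def)
  qed
  finally show ?thesis by simp
qed

section \<open>Rank of the partial trace and factorisation of pure states\<close>

definition col_indep :: "nat \<Rightarrow> (nat \<Rightarrow> nat \<Rightarrow> complex) \<Rightarrow> nat set \<Rightarrow> bool" where
  "col_indep d M S \<longleftrightarrow> (\<forall>c :: nat \<Rightarrow> complex. (\<forall>i<d. (\<Sum>j\<in>S. c j * M i j) = 0) \<longrightarrow> (\<forall>j\<in>S. c j = 0))"

lemma mat_rank_le_iff:
  "mat_rank d M \<le> k \<longleftrightarrow> (\<forall>S\<subseteq>{..<d}. col_indep d M S \<longrightarrow> card S \<le> k)"
proof -
  let ?C = "{card S | S. S \<subseteq> {..<d} \<and> col_indep d M S}"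
  have eq: "mat_rank d M = Max ?C" by (simp add: mat_rank_def col_indep_def)
  have "?C \<subseteq> card ` Pow {..<d}" by auto
  then have "finite ?C" by (rule finite_subset) auto
  moreover have "card {} \<in> ?C" by (rule CollectI, rule exI[of _ "{}"]) (simp add: col_indep_def)
  ultimately show ?thesis unfolding eq by (subst Max_le_iff) auto
qed

text \<open>The partial trace is a Gram matrix, so its kernel is that of the conjugated coefficient
  matrix of \<open>\<psi>\<close>.\<close>

lemma ptrace_A_kernel:
  assumes S: "S \<subseteq> {..<d}" and c: "\<forall>i<d. (\<Sum>j\<in>S. c j * ptrace_A_proj d \<psi> i j) = 0"
  shows "\<forall>i<d. (\<Sum>j\<in>S. cnj (c j) * \<psi> (i, j)) = 0"
proof -
  define u where "u i = (\<Sum>j\<in>S. c j * cnj (\<psi> (i, j)))" for i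
  have "ip {..<d} u u = (\<Sum>i<d. \<Sum>j\<in>S. cnj (c j) * \<psi> (i, j) * u i)"
    by (simp add: ip_def u_def sum_distrib_right)
  also have "\<dots> = (\<Sum>j\<in>S. cnj (c j) * (\<Sum>i<d. \<psi> (i, j) * u i))"
    by (subst sum.swap) (simp add: sum_distrib_left mult.assoc)
  also have "\<dots> = (\<Sum>j\<in>S. cnj (c j) * (\<Sum>j'\<in>S. c j' * ptrace_A_proj d \<psi> j j'))"
  proof (intro sum.cong refl)
    fix j
    have "(\<Sum>i<d. \<psi> (i, j) * u i) = (\<Sum>j'\<in>S. c j' * ptrace_A_proj d \<psi> j j')"
      unfolding u_def ptrace_A_proj_def sum_distrib_left
      by (subst sum.swap) (intro sum.cong refl, simp only: mult_ac)
    then show "cnj (c j) * (\<Sum>i<d. \<psi> (i, j) * u i) = cnj (c j) * (\<Sum>j'\<in>S. c j' * ptrace_A_proj d \<psi> j j')"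
      by simp
  qed
  also have "\<dots> = 0" using c S by (intro sum.neutral) auto
  finally have "nrm2 {..<d} u = 0" by (simp add: ip_self)
  then have "\<forall>i<d. u i = 0" by (simp add: nrm2_eq_0)
  then have "\<forall>i<d. cnj (u i) = 0" by simp
  then show ?thesis by (simp add: u_def)
qed

text \<open>A maximal independent set \<open>S\<close> of columns of the partial trace has at most
  \<open>k\<close> elements. By maximality every other column is dependent on \<open>S\<close>, and
  \<open>ptrace_A_kernel\<close> carries this dependence over to the columns of \<psi>.
  Orthonormalising the columns in \<open>S\<close> gives \<open>q\<close>; the inner products with
  \<open>q\<close> give \<open>r\<close>, and Parseval gives its norm.\<close>

lemma low_rank_factor:
  assumes "mat_rank d (ptrace_A_proj d \<psi>) \<le> k"
  shows "\<exists>q r. ortho_sys {..<d} k q \<and> (\<forall>i<d. \<forall>j<d. \<psi> (i, j) = (\<Sum>l<k. q l i * r l j)) \<and>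
    (\<Sum>l<k. nrm2 {..<d} (r l)) = nrm2 (idx d) \<psi>"
proof -
  let ?M = "ptrace_A_proj d \<psi>"
  let ?P = "\<lambda>S. S \<subseteq> {..<d} \<and> col_indep d ?M S"
  have "?P {}" by (simp add: col_indep_def)
  moreover have "\<forall>S. ?P S \<longrightarrow> card S < Suc d"
    using card_mono[of "{..<d}"] by (auto simp: less_Suc_eq_le)
  ultimately have "\<exists>S. ?P S \<and> (\<forall>T. ?P T \<longrightarrow> card T \<le> card S)"
    by (rule ex_has_greatest_nat)
  then obtain S where S: "?P S" "\<And>T. ?P T \<Longrightarrow> card T \<le> card S"
    by (elim exE conjE) simp
  have finS: "finite S" using S(1) finite_subset by blast
  have cardS: "card S \<le> k" using assms S(1) unfolding mat_rank_le_iff by blast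
  obtain e where e: "bij_betw e {..<card S} S"
    using ex_bij_betw_nat_finite[OF finS] by (auto simp: atLeast0LessThan)
  \<comment> \<open>For \<open>l\<close> from \<open>card S\<close> up to \<open>k\<close> the value
    \<open>e l\<close> is arbitrary; these padding vectors can only enlarge the span.\<close>
  define x where "x l = (\<lambda>i. \<psi> (i, e l))" for l
  obtain q where q: "ortho_sys {..<d} k q" "\<And>l. l < k \<Longrightarrow> in_span {..<d} k q (x l)"
    using gram_schmidt[of "{..<d}" k x] by auto
  have col_S: "in_span {..<d} k q (\<lambda>i. \<psi> (i, j))" if "j \<in> S" for j
  proof -
    have "j \<in> e ` {..<card S}" using e that by (simp add: bij_betw_def)
    then obtain l where "l < card S" "e l = j" by auto
    then show ?thesis using q(2)[of l] cardS by (simp add: x_def)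
  qed
  have col: "in_span {..<d} k q (\<lambda>i. \<psi> (i, j))" if j: "j < d" for j
  proof (cases "j \<in> S")
    case False
    have "\<not> ?P (insert j S)" using S(2)[of "insert j S"] False finS by auto
    then obtain c where c: "\<forall>i<d. (\<Sum>j\<in>insert j S. c j * ?M i j) = 0" "\<exists>j\<in>insert j S. c j \<noteq> 0"
      using S(1) j unfolding col_indep_def by blast
    have cj: "c j \<noteq> 0"
    proof
      assume "c j = 0"
      with c(1) finS False have "\<forall>i<d. (\<Sum>j\<in>S. c j * ?M i j) = 0" by simp
      then have "\<forall>j\<in>S. c j = 0" using S(1) by (auto simp: col_indep_def)
      with c(2) \<open>c j = 0\<close> show False by auto
    qed
    have ker: "\<forall>i<d. (\<Sum>j\<in>insert j S. cnj (c j) * \<psi> (i, j)) = 0"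
      using ptrace_A_kernel[OF _ c(1)] S(1) j by auto
    have "\<psi> (i, j) = (\<Sum>s\<in>S. \<psi> (i, s) * (- cnj (c s) / cnj (c j)))" if "i < d" for i
    proof -
      have "cnj (c j) * \<psi> (i, j) + (\<Sum>s\<in>S. cnj (c s) * \<psi> (i, s)) = 0"
        using ker that finS False by simp
      then have "cnj (c j) * \<psi> (i, j) = - (\<Sum>s\<in>S. cnj (c s) * \<psi> (i, s))"
        by (simp add: eq_neg_iff_add_eq_0)
      moreover have "\<psi> (i, j) = cnj (c j) * \<psi> (i, j) * (1 / cnj (c j))" using cj by simp
      ultimately have "\<psi> (i, j) = (\<Sum>s\<in>S. cnj (c s) * \<psi> (i, s)) * (- 1 / cnj (c j))"
        by simp
      also have "\<dots> = (\<Sum>s\<in>S. \<psi> (i, s) * (- cnj (c s) / cnj (c j)))"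
        unfolding sum_distrib_right by (intro sum.cong refl) simp
      finally show ?thesis .
    qed
    then show ?thesis
      by (intro in_span_sum[where S = S and c = "\<lambda>s. - cnj (c s) / cnj (c j)", OF col_S]) simp_all
  qed (rule col_S)
  define r where "r l j = ip {..<d} (q l) (\<lambda>i. \<psi> (i, j))" for l j
  have "(\<Sum>l<k. nrm2 {..<d} (r l)) = (\<Sum>j<d. \<Sum>l<k. (cmod (r l j))\<^sup>2)"
    unfolding nrm2_def by (rule sum.swap)
  also have "\<dots> = (\<Sum>j<d. nrm2 {..<d} (\<lambda>i. \<psi> (i, j)))"
    unfolding r_def by (intro sum.cong in_span_parseval[OF q(1)] col) auto
  also have "\<dots> = nrm2 (idx d) \<psi>"
    unfolding nrm2_def idx_def sum.cartesian_product' by (rule sum.swap)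
  finally have "(\<Sum>l<k. nrm2 {..<d} (r l)) = nrm2 (idx d) \<psi>" .
  moreover have "\<forall>i<d. \<forall>j<d. \<psi> (i, j) = (\<Sum>l<k. q l i * r l j)"
    using col by (auto simp: in_span_def r_def)
  ultimately show ?thesis using q(1) by blast
qed

definition qform :: "'a set \<Rightarrow> ('a \<Rightarrow> 'a \<Rightarrow> complex) \<Rightarrow> ('a \<Rightarrow> complex) \<Rightarrow> complex" where
  "qform I H x = (\<Sum>a\<in>I. \<Sum>b\<in>I. cnj (x a) * H a b * x b)"

lemma finite_idx [simp]: "finite (idx d)" and card_idx: "card (idx d) = d\<^sup>2"
  by (simp_all add: idx_def power2_eq_square)


section \<open>Gaussian tail bounds\<close>

abbreviation half_normal :: "real measure" where
  "half_normal \<equiv> density lborel (normal_density 0 (1 / sqrt 2))"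

lemma prob_space_half_normal: "prob_space half_normal"
  by (rule prob_space_normal_density) simp

lemma measurable_Complex_pair [measurable]:
  "(\<lambda>(x, y). Complex x y) \<in> borel \<Otimes>\<^sub>M borel \<rightarrow>\<^sub>M borel"
proof -
  have eq: "(\<lambda>(x, y). Complex x y) = (\<lambda>p. complex_of_real (fst p) + \<i> * complex_of_real (snd p))"
    by (auto simp: complex_eq_iff)
  show ?thesis unfolding eq by measurable
qed

lemma measurable_half_normal_pair [measurable]:
  "(\<lambda>(x, y). Complex x y) \<in> half_normal \<Otimes>\<^sub>M half_normal \<rightarrow>\<^sub>M borel"
  using measurable_Complex_pair by (simp cong: measurable_cong_sets sets_pair_measure_cong)

lemma sets_complex_gaussian [measurable_cong, simp]: "sets complex_gaussian = sets borel"
  by (simp add: complex_gaussian_def)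

lemma space_complex_gaussian [simp]: "space complex_gaussian = UNIV"
  by (simp add: complex_gaussian_def)

lemma prob_space_complex_gaussian: "prob_space complex_gaussian"
proof -
  interpret N: prob_space half_normal by (rule prob_space_half_normal)
  interpret P: pair_prob_space half_normal half_normal ..
  show ?thesis unfolding complex_gaussian_def
    by (rule P.prob_space_distr) (rule measurable_half_normal_pair)
qed

text \<open>Completing the square: tilting by \<open>exp (t * x)\<close> moves the mean to
  \<open>t / 2\<close> and leaves the variance unchanged.\<close>

lemma half_normal_mgf:
  "(\<integral>\<^sup>+x. ennreal (exp (t * x)) \<partial>half_normal) = ennreal (exp (t\<^sup>2 / 4))"
proof -
  have eq: "normal_density 0 (1 / sqrt 2) x * exp (t * x) = exp (t\<^sup>2 / 4) * normal_density (t / 2) (1 / sqrt 2) x" for x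
  proof -
    have "- (x - 0)\<^sup>2 / (2 * (1 / sqrt 2)\<^sup>2) + t * x = t\<^sup>2 / 4 + - (x - t / 2)\<^sup>2 / (2 * (1 / sqrt 2)\<^sup>2)"
      by (simp add: power_divide power2_eq_square field_simps)
    then show ?thesis
      unfolding normal_density_def by (simp only: mult.assoc exp_add[symmetric] mult.left_commute[of "exp _"])
  qed
  interpret N: prob_space "density lborel (normal_density (t / 2) (1 / sqrt 2))"
    by (rule prob_space_normal_density) simp
  have one: "(\<integral>\<^sup>+x. ennreal (normal_density (t / 2) (1 / sqrt 2) x) \<partial>lborel) = 1"
    using N.emeasure_space_1 by (simp add: emeasure_density)
  have "(\<integral>\<^sup>+x. ennreal (exp (t * x)) \<partial>half_normal)
     = (\<integral>\<^sup>+x. ennreal (normal_density 0 (1 / sqrt 2) x * exp (t * x)) \<partial>lborel)"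
    by (subst nn_integral_density) (auto simp: ennreal_mult)
  also have "\<dots> = (\<integral>\<^sup>+x. ennreal (exp (t\<^sup>2 / 4)) * ennreal (normal_density (t / 2) (1 / sqrt 2) x) \<partial>lborel)"
    unfolding eq by (simp add: ennreal_mult)
  also have "\<dots> = ennreal (exp (t\<^sup>2 / 4))"
    by (subst nn_integral_cmult) (auto simp: one)
  finally show ?thesis .
qed

lemma complex_gaussian_mgf:
  "(\<integral>\<^sup>+z. ennreal (exp (sqrt 2 * Re (z * m))) \<partial>complex_gaussian) = ennreal (exp ((cmod m)\<^sup>2 / 2))"
proof -
  interpret N: prob_space half_normal by (rule prob_space_half_normal)
  define s t where "s = sqrt 2 * Re m" and "t = - sqrt 2 * Im m"
  have "(\<integral>\<^sup>+z. ennreal (exp (sqrt 2 * Re (z * m))) \<partial>complex_gaussian)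
     = (\<integral>\<^sup>+p. ennreal (exp (sqrt 2 * Re ((case p of (x, y) \<Rightarrow> Complex x y) * m))) \<partial>(half_normal \<Otimes>\<^sub>M half_normal))"
    unfolding complex_gaussian_def by (subst nn_integral_distr) auto
  also have "\<dots> = (\<integral>\<^sup>+p. ennreal (exp (s * fst p)) * ennreal (exp (t * snd p)) \<partial>(half_normal \<Otimes>\<^sub>M half_normal))"
    by (intro nn_integral_cong)
      (auto simp: s_def t_def ennreal_mult[symmetric] exp_add[symmetric] algebra_simps split: prod.split)
  also have "\<dots> = (\<integral>\<^sup>+x. \<integral>\<^sup>+y. ennreal (exp (s * x)) * ennreal (exp (t * y)) \<partial>half_normal \<partial>half_normal)"
    by (subst N.nn_integral_fst[symmetric]) auto
  also have "\<dots> = (\<integral>\<^sup>+x. ennreal (exp (s * x)) * ennreal (exp (t\<^sup>2 / 4)) \<partial>half_normal)"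
    by (subst nn_integral_cmult) (auto simp: half_normal_mgf)
  also have "\<dots> = ennreal (exp (s\<^sup>2 / 4)) * ennreal (exp (t\<^sup>2 / 4))"
    by (subst nn_integral_multc) (auto simp: half_normal_mgf)
  also have "\<dots> = ennreal (exp ((cmod m)\<^sup>2 / 2))"
    by (simp add: ennreal_mult[symmetric] exp_add[symmetric] cmod_power2 s_def t_def power_mult_distrib field_simps)
  finally show ?thesis .
qed

lemma complex_gaussian_Re: "distr complex_gaussian borel Re = half_normal"
proof -
  interpret N: prob_space half_normal by (rule prob_space_half_normal)
  have "distr complex_gaussian borel Re = distr (half_normal \<Otimes>\<^sub>M half_normal) half_normal (Re \<circ> (\<lambda>(x, y). Complex x y))"
    unfolding complex_gaussian_def by (subst distr_distr) (auto intro!: distr_cong)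
  also have "Re \<circ> (\<lambda>(x, y). Complex x y) = fst" by auto
  also have "distr (half_normal \<Otimes>\<^sub>M half_normal) half_normal fst = half_normal"
    by (rule N.distr_pair_fst)
  finally show ?thesis .
qed

lemma measurable_Re_complex_gaussian [measurable]: "Re \<in> borel_measurable complex_gaussian"
  using borel_measurable_Re by (simp cong: measurable_cong_sets)

lemma product_prob_space_gaussian: "product_prob_space (\<lambda>_. complex_gaussian)"
  by (simp add: product_prob_space_def product_prob_space_axioms_def product_sigma_finite_def
      prob_space_complex_gaussian prob_space_imp_sigma_finite)

lemma prob_space_ginibre: "prob_space (ginibre d)"
  unfolding ginibre_def by (rule prob_space_PiM) (rule prob_space_complex_gaussian)

lemma measurable_ginibre_component [measurable]:
  "p \<in> idx d \<times> idx d \<Longrightarrow> (\<lambda>g. g p) \<in> borel_measurable (ginibre d)"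
  unfolding ginibre_def
  using measurable_component_singleton[of p "idx d \<times> idx d" "\<lambda>_. complex_gaussian"]
  by (simp cong: measurable_cong_sets)

text \<open>The factor \<open>sqrt 2\<close> makes this a centred real Gaussian of variance exactly
  \<open>nrm2 (idx d \<times> idx d) M\<close>. It is also the factor produced by the Hermitian
  symmetrisation, since \<open>2 / sqrt 2 = sqrt 2\<close>.\<close>

definition lin_form :: "nat \<Rightarrow> ((nat \<times> nat) \<times> (nat \<times> nat) \<Rightarrow> complex) \<Rightarrow> ((nat \<times> nat) \<times> (nat \<times> nat) \<Rightarrow> complex) \<Rightarrow> real" where
  "lin_form d M g = sqrt 2 * Re (\<Sum>p\<in>idx d \<times> idx d. g p * M p)"

lemma measurable_lin_form [measurable]: "lin_form d M \<in> borel_measurable (ginibre d)"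
  unfolding lin_form_def[abs_def] by measurable

lemma lin_form_mgf:
  "(\<integral>\<^sup>+g. ennreal (exp (lin_form d M g)) \<partial>ginibre d) = ennreal (exp (nrm2 (idx d \<times> idx d) M / 2))"
proof -
  interpret P: product_prob_space "\<lambda>_. complex_gaussian" by (rule product_prob_space_gaussian)
  let ?I = "idx d \<times> idx d"
  have "(\<integral>\<^sup>+g. ennreal (exp (lin_form d M g)) \<partial>ginibre d)
      = (\<integral>\<^sup>+g. (\<Prod>p\<in>?I. ennreal (exp (sqrt 2 * Re (g p * M p)))) \<partial>PiM ?I (\<lambda>_. complex_gaussian))"
    unfolding ginibre_def lin_form_def
    by (intro nn_integral_cong) (simp add: prod_ennreal exp_sum[symmetric] sum_distrib_left)
  also have "\<dots> = (\<Prod>p\<in>?I. \<integral>\<^sup>+z. ennreal (exp (sqrt 2 * Re (z * M p))) \<partial>complex_gaussian)"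
  proof (rule P.product_nn_integral_prod)
    have "(\<lambda>z. ennreal (exp (sqrt 2 * Re (z * m)))) \<in> borel_measurable complex_gaussian" for m
      by measurable
    then show "(\<lambda>z. ennreal (exp (sqrt 2 * Re (z * M p)))) \<in> borel_measurable complex_gaussian" for p .
  qed simp
  also have "\<dots> = ennreal (exp (nrm2 ?I M / 2))"
    unfolding complex_gaussian_mgf
    by (simp add: prod_ennreal exp_sum[symmetric] nrm2_def sum_divide_distrib)
  finally show ?thesis .
qed

lemma lin_form_scale: "lin_form d (\<lambda>p. complex_of_real c * M p) g = c * lin_form d M g"
proof -
  have "(\<Sum>p\<in>idx d \<times> idx d. g p * (complex_of_real c * M p)) = complex_of_real c * (\<Sum>p\<in>idx d \<times> idx d. g p * M p)"
    by (simp add: sum_distrib_left mult_ac)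
  then show ?thesis unfolding lin_form_def by simp
qed

lemma lin_form_tail:
  assumes "nrm2 (idx d \<times> idx d) M \<le> v" "0 < v" "0 \<le> t"
  shows "measure (ginibre d) {g \<in> space (ginibre d). t < lin_form d M g} \<le> exp (- t\<^sup>2 / (2 * v))"
proof -
  interpret prob_space "ginibre d" by (rule prob_space_ginibre)
  \<comment> \<open>The parameter that minimises the Chernoff exponent
    \<open>- l * t + l^2 * v / 2\<close>.\<close>
  define l where "l = t / v"
  let ?M = "\<lambda>p. complex_of_real l * M p"
  have "emeasure (ginibre d) {g \<in> space (ginibre d). t < lin_form d M g}
     \<le> emeasure (ginibre d) {g \<in> space (ginibre d). 1 \<le> ennreal (exp (- l * t)) * ennreal (exp (lin_form d ?M g))}"
  proof (intro emeasure_mono subsetI)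
    fix g assume g: "g \<in> {g \<in> space (ginibre d). t < lin_form d M g}"
    then have "l * t \<le> l * lin_form d M g" using assms by (intro mult_left_mono) (auto simp: l_def)
    then have "1 \<le> exp (- l * t) * exp (lin_form d ?M g)"
      unfolding lin_form_scale exp_add[symmetric] by simp
    then have "ennreal 1 \<le> ennreal (exp (- l * t) * exp (lin_form d ?M g))"
      by (intro ennreal_leI)
    then show "g \<in> {g \<in> space (ginibre d). 1 \<le> ennreal (exp (- l * t)) * ennreal (exp (lin_form d ?M g))}"
      using g by (simp add: ennreal_mult)
  qed measurable
  also have "\<dots> \<le> ennreal (exp (- l * t)) * (\<integral>\<^sup>+g. ennreal (exp (lin_form d ?M g)) * indicator (space (ginibre d)) g \<partial>ginibre d)"
    by (rule nn_integral_Markov_inequality) auto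
  also have "(\<integral>\<^sup>+g. ennreal (exp (lin_form d ?M g)) * indicator (space (ginibre d)) g \<partial>ginibre d)
     = ennreal (exp (nrm2 (idx d \<times> idx d) ?M / 2))"
    unfolding lin_form_mgf[symmetric] by (intro nn_integral_cong) simp
  also have "ennreal (exp (- l * t)) * \<dots> = ennreal (exp (- l * t + nrm2 (idx d \<times> idx d) ?M / 2))"
    by (simp add: ennreal_mult[symmetric] exp_add[symmetric])
  also have "\<dots> \<le> ennreal (exp (- t\<^sup>2 / (2 * v)))"
  proof (intro ennreal_leI, simp only: exp_le_cancel_iff)
    have "nrm2 (idx d \<times> idx d) ?M = l\<^sup>2 * nrm2 (idx d \<times> idx d) M"
      by (simp add: nrm2_def norm_mult power_mult_distrib sum_distrib_left)
    also have "\<dots> \<le> l\<^sup>2 * v" using assms by (intro mult_left_mono) auto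
    finally have "- l * t + nrm2 (idx d \<times> idx d) ?M / 2 \<le> - l * t + l\<^sup>2 * v / 2" by simp
    also have "\<dots> = - t\<^sup>2 / (2 * v)" using assms by (simp add: l_def field_simps power2_eq_square)
    finally show "- l * t + nrm2 (idx d \<times> idx d) ?M / 2 \<le> - t\<^sup>2 / (2 * v)" .
  qed
  finally show ?thesis by (simp add: emeasure_eq_measure)
qed

text \<open>The traceless part of the rank one matrix built from \<open>x\<close>. Subtracting the
  trace from the random matrix is the same as subtracting it from the coefficient matrix, so the
  variance can be read off here.\<close>

definition witness_mat :: "nat \<Rightarrow> (nat \<times> nat \<Rightarrow> complex) \<Rightarrow> (nat \<times> nat) \<times> (nat \<times> nat) \<Rightarrow> complex" where
  "witness_mat d x p = cnj (x (fst p)) * x (snd p) -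
     (if fst p = snd p then complex_of_real (nrm2 (idx d) x / (d\<^sup>2)) else 0)"

lemma sum_diag: "finite I \<Longrightarrow> (\<Sum>a\<in>I. \<Sum>b\<in>I. if a = b then f a b else 0) = (\<Sum>a\<in>I. f a a :: 'b :: comm_monoid_add)"
  by simp

lemma qform_gue0: "qform (idx d) (gue0 d g) x = complex_of_real (lin_form d (witness_mat d x) g)"
proof -
  let ?I = "idx d"
  define T where "T = (\<Sum>a\<in>?I. \<Sum>b\<in>?I. cnj (x a) * g (a, b) * x b)"
  define t where "t = (\<Sum>c\<in>?I. g (c, c))"
  define s where "s = complex_of_real (sqrt 2)"
  have s: "s * s = 2" "s \<noteq> 0"
    unfolding s_def of_real_mult[symmetric] by auto
  have cT: "cnj T = (\<Sum>a\<in>?I. \<Sum>b\<in>?I. cnj (x a) * cnj (g (b, a)) * x b)"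
    unfolding T_def by (subst sum.swap) (simp add: mult_ac)
  have herm: "(\<Sum>a\<in>?I. \<Sum>b\<in>?I. cnj (x a) * gue_herm d g a b * x b) = (T + cnj T) / s"
    unfolding cT unfolding T_def gue_herm_def s_def[symmetric] sum.distrib[symmetric] sum_divide_distrib
    by (intro sum.cong refl) (simp add: field_simps s)
  have tr: "(\<Sum>c\<in>?I. gue_herm d g c c) = (t + cnj t) / s"
    unfolding t_def gue_herm_def s_def[symmetric] by (simp add: sum.distrib sum_divide_distrib add_divide_distrib)
  define n where "n = (of_nat (d^2) :: complex)"
  have "qform ?I (gue0 d g) x = (\<Sum>a\<in>?I. \<Sum>b\<in>?I. cnj (x a) * gue_herm d g a b * x b)
     - (\<Sum>a\<in>?I. \<Sum>b\<in>?I. if a = b then cnj (x a) * x b * ((\<Sum>c\<in>?I. gue_herm d g c c) / n) else 0)"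
    unfolding qform_def gue0_def n_def[symmetric] sum_subtractf[symmetric]
    by (intro sum.cong refl) (simp add: algebra_simps)
  also have "(\<Sum>a\<in>?I. \<Sum>b\<in>?I. if a = b then cnj (x a) * x b * ((\<Sum>c\<in>?I. gue_herm d g c c) / n) else 0)
     = complex_of_real (nrm2 ?I x) * ((t + cnj t) / s / n)"
    unfolding tr sum_diag[OF finite_idx] ip_self[symmetric] ip_def sum_distrib_right ..
  finally have 1: "qform ?I (gue0 d g) x = (T + cnj T) / s - complex_of_real (nrm2 ?I x) * ((t + cnj t) / s / n)"
    unfolding herm .
  have "(\<Sum>p\<in>?I \<times> ?I. g p * witness_mat d x p)
     = (\<Sum>a\<in>?I. \<Sum>b\<in>?I. cnj (x a) * g (a, b) * x b) -
       (\<Sum>a\<in>?I. \<Sum>b\<in>?I. if a = b then g (a, b) * complex_of_real (nrm2 ?I x / (d\<^sup>2)) else 0)"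
    unfolding sum.cartesian_product' sum_subtractf[symmetric] witness_mat_def
    by (intro sum.cong refl) (simp add: algebra_simps)
  also have "\<dots> = T - t * complex_of_real (nrm2 ?I x / (d\<^sup>2))"
    unfolding sum_diag[OF finite_idx] T_def t_def sum_distrib_right ..
  finally have 2: "lin_form d (witness_mat d x) g = sqrt 2 * Re (T - t * complex_of_real (nrm2 ?I x / (d\<^sup>2)))"
    by (simp add: lin_form_def)
  have 3: "z + cnj z = 2 * complex_of_real (Re z)" for z by (simp add: complex_eq_iff)
  have 4: "2 / s = s" using s by (simp add: field_simps)
  have "qform ?I (gue0 d g) x = (2 / s) * (complex_of_real (Re T) - complex_of_real (nrm2 ?I x) * complex_of_real (Re t) / n)"
    unfolding 1 3 by (simp add: right_diff_distrib diff_divide_distrib mult_ac)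
  also have "\<dots> = complex_of_real (sqrt 2 * (Re T - nrm2 ?I x * Re t / (d\<^sup>2)))"
    unfolding 4 unfolding n_def s_def by simp
  also have "sqrt 2 * (Re T - nrm2 ?I x * Re t / (d\<^sup>2)) = lin_form d (witness_mat d x) g"
    unfolding 2 by (simp add: mult.commute)
  finally show ?thesis .
qed

text \<open>Removing the trace is an orthogonal projection in Hilbert--Schmidt norm. For
  \<open>d > 0\<close> the exact value is \<open>N^2 - N^2 / n\<close> with
  \<open>N = nrm2 (idx d) x\<close> and \<open>n = d^2\<close>.\<close>

lemma nrm2_witness_mat: "nrm2 (idx d \<times> idx d) (witness_mat d x) \<le> (nrm2 (idx d) x)\<^sup>2"
proof (cases "d = 0")
  case True
  then show ?thesis by (simp add: nrm2_def idx_def)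
next
  case False
  let ?I = "idx d"
  define N where "N = nrm2 ?I x"
  define n where "n = real (d\<^sup>2)"
  have n: "n > 0" using False by (simp add: n_def)
  have pt: "(cmod (witness_mat d x (a, b)))\<^sup>2 = (cmod (x a))\<^sup>2 * (cmod (x b))\<^sup>2
     + (if a = b then (N / n)\<^sup>2 - 2 * (N / n) * (cmod (x a))\<^sup>2 else 0)" for a b
  proof (cases "a = b")
    case True
    have "witness_mat d x (a, b) = complex_of_real ((cmod (x a))\<^sup>2 - N / n)"
      using True complex_norm_square[of "x a"]
      by (simp add: witness_mat_def N_def n_def mult.commute)
    then have "(cmod (witness_mat d x (a, b)))\<^sup>2 = ((cmod (x a))\<^sup>2 - N / n)\<^sup>2"
      by (simp only: norm_of_real power2_abs)
    then show ?thesis using True by (simp add: power2_eq_square algebra_simps)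
  next
    case False
    then show ?thesis by (simp add: witness_mat_def norm_mult power_mult_distrib)
  qed
  have "nrm2 (?I \<times> ?I) (witness_mat d x) = (\<Sum>a\<in>?I. \<Sum>b\<in>?I. (cmod (x a))\<^sup>2 * (cmod (x b))\<^sup>2)
     + (\<Sum>a\<in>?I. \<Sum>b\<in>?I. if a = b then (N / n)\<^sup>2 - 2 * (N / n) * (cmod (x a))\<^sup>2 else 0)"
    unfolding nrm2_def[of "?I \<times> ?I"] sum.cartesian_product' pt sum.distrib ..
  also have "(\<Sum>a\<in>?I. \<Sum>b\<in>?I. (cmod (x a))\<^sup>2 * (cmod (x b))\<^sup>2) = N\<^sup>2"
    unfolding N_def nrm2_def power2_eq_square sum_product ..
  also have "(\<Sum>a\<in>?I. \<Sum>b\<in>?I. if a = b then (N / n)\<^sup>2 - 2 * (N / n) * (cmod (x a))\<^sup>2 else 0)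
     = n * (N / n)\<^sup>2 - 2 * (N / n) * N"
    unfolding sum_diag[OF finite_idx] sum_subtractf sum_distrib_left[symmetric] N_def nrm2_def
    by (simp add: card_idx n_def)
  also have "\<dots> = - N\<^sup>2 / n" using n by (simp add: power2_eq_square field_simps)
  also have "N\<^sup>2 + - N\<^sup>2 / n \<le> N\<^sup>2" using n by simp
  finally show ?thesis by (simp add: N_def)
qed

text \<open>A union bound over the points of \<open>F\<close> and over both signs. Net points have
  squared norm at most 4, hence variance at most 16, which gives the 32 in the exponent.\<close>

lemma qform_net_tail:
  assumes "finite F" "\<And>x. x \<in> F \<Longrightarrow> nrm2 (idx d) x \<le> 4" "0 \<le> t"
  shows "measure (ginibre d) {g \<in> space (ginibre d). \<exists>x\<in>F. t < \<bar>Re (qform (idx d) (gue0 d g) x)\<bar>}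
     \<le> 2 * real (card F) * exp (- t\<^sup>2 / 32)"
proof -
  interpret prob_space "ginibre d" by (rule prob_space_ginibre)
  let ?S = "\<lambda>M. {g \<in> space (ginibre d). t < lin_form d M g}"
  let ?W = "witness_mat d"
  have neg: "lin_form d (\<lambda>p. - M p) g = - lin_form d M g" for M g
    using lin_form_scale[of d "-1" M g] by simp
  have less_abs: "t < \<bar>Re (complex_of_real y)\<bar> \<longleftrightarrow> t < y \<or> t < - y" for y by auto
  have tail: "prob (?S M) \<le> exp (- t\<^sup>2 / 32)" if "nrm2 (idx d \<times> idx d) M \<le> 16" for M
    using lin_form_tail[OF that _ assms(3)] by simp
  have W: "nrm2 (idx d \<times> idx d) (?W x) \<le> 16" if "x \<in> F" for x
  proof -
    have "(nrm2 (idx d) x)\<^sup>2 \<le> 4\<^sup>2" using assms(2)[OF that] nrm2_nonneg[of "idx d" x] by (intro power_mono)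
    then show ?thesis using nrm2_witness_mat[of d x] by simp
  qed
  have sets: "?S M \<in> events" for M by measurable
  have "{g \<in> space (ginibre d). \<exists>x\<in>F. t < \<bar>Re (qform (idx d) (gue0 d g) x)\<bar>}
     = (\<Union>x\<in>F. ?S (?W x) \<union> ?S (\<lambda>p. - ?W x p))"
    unfolding qform_gue0 neg less_abs by auto
  also have "prob \<dots> \<le> (\<Sum>x\<in>F. prob (?S (?W x) \<union> ?S (\<lambda>p. - ?W x p)))"
    using sets by (intro measure_UNION_le assms(1)) auto
  also have "\<dots> \<le> (\<Sum>x\<in>F. exp (- t\<^sup>2 / 32) + exp (- t\<^sup>2 / 32))"
  proof (rule sum_mono)
    fix x assume "x \<in> F"
    have "nrm2 (idx d \<times> idx d) (\<lambda>p. - ?W x p) = nrm2 (idx d \<times> idx d) (?W x)" by (simp add: nrm2_def)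
    then show "prob (?S (?W x) \<union> ?S (\<lambda>p. - ?W x p)) \<le> exp (- t\<^sup>2 / 32) + exp (- t\<^sup>2 / 32)"
      using W[OF \<open>x \<in> F\<close>] by (intro order_trans[OF measure_Un_le[OF sets sets]] add_mono tail) auto
  qed
  finally show ?thesis by simp
qed


section \<open>Lower tail of the Hilbert--Schmidt norm\<close>

lemma exp_neg_square_std_normal:
  "(\<integral>\<^sup>+x. ennreal (std_normal_density x) * ennreal (exp (- x\<^sup>2)) \<partial>lborel) = ennreal (1 / sqrt 3)"
proof -
  \<comment> \<open>The product of the two exponentials is the exponential of a centred normal
    density of variance 1/3; the ratio of the normalising constants is
    \<open>1 / sqrt 3\<close>.\<close>
  have eq: "std_normal_density x * exp (- x\<^sup>2) = (1 / sqrt 3) * normal_density 0 (1 / sqrt 3) x" for x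
  proof -
    have "- (x - 0)\<^sup>2 / (2 * 1\<^sup>2) + - x\<^sup>2 = - (x - 0)\<^sup>2 / (2 * (1 / sqrt 3)\<^sup>2)"
      by (simp add: power_divide)
    moreover have "1 / sqrt (2 * pi * 1\<^sup>2) = (1 / sqrt 3) * (1 / sqrt (2 * pi * (1 / sqrt 3)\<^sup>2))"
      by (simp add: power_divide real_sqrt_divide)
    ultimately show ?thesis
      unfolding normal_density_def by (metis (no_types, lifting) exp_add mult.assoc)
  qed
  interpret N: prob_space "density lborel (normal_density 0 (1 / sqrt 3))"
    by (rule prob_space_normal_density) simp
  have one: "(\<integral>\<^sup>+x. ennreal (normal_density 0 (1 / sqrt 3) x) \<partial>lborel) = 1"
    using N.emeasure_space_1 by (simp add: emeasure_density)
  have "(\<integral>\<^sup>+x. ennreal (std_normal_density x) * ennreal (exp (- x\<^sup>2)) \<partial>lborel)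
     = (\<integral>\<^sup>+x. ennreal (1 / sqrt 3) * ennreal (normal_density 0 (1 / sqrt 3) x) \<partial>lborel)"
    by (simp add: ennreal_mult[symmetric] eq)
  also have "\<dots> = ennreal (1 / sqrt 3)"
    by (subst nn_integral_cmult) (auto simp: one)
  finally show ?thesis .
qed

text \<open>Selects one entry from each transposed pair of off-diagonal entries. The real parts of
  the selected entries of the Hermitian matrix are independent, and the trace correction does not
  touch them.\<close>

definition lex_pairs :: "nat \<Rightarrow> ((nat \<times> nat) \<times> (nat \<times> nat)) set" where
  "lex_pairs d = {p \<in> idx d \<times> idx d. fst (fst p) < fst (snd p) \<or>
     fst (fst p) = fst (snd p) \<and> snd (fst p) < snd (snd p)}"

lemma lex_pairs_subset: "lex_pairs d \<subseteq> idx d \<times> idx d"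
  by (auto simp: lex_pairs_def)

lemma finite_lex_pairs [simp]: "finite (lex_pairs d)"
  by (rule finite_subset[OF lex_pairs_subset]) simp

lemma idx_square_decomp:
  "idx d \<times> idx d = (\<lambda>a. (a, a)) ` idx d \<union> (lex_pairs d \<union> prod.swap ` lex_pairs d)"
  by (auto simp: lex_pairs_def image_iff idx_def prod.swap_def)

lemma card_lex_pairs:
  assumes "2 \<le> d"
  shows "real (card (lex_pairs d)) \<ge> real d ^ 4 / 4"
proof -
  have "card (idx d \<times> idx d) \<le> card ((\<lambda>a. (a, a)) ` idx d) + (card (lex_pairs d) + card (prod.swap ` lex_pairs d))"
    unfolding idx_square_decomp by (intro order_trans[OF card_Un_le] add_left_mono card_Un_le)
  also have "\<dots> \<le> card (idx d) + (card (lex_pairs d) + card (lex_pairs d))"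
    by (intro add_mono card_image_le) auto
  finally have "d\<^sup>2 * d\<^sup>2 \<le> d\<^sup>2 + 2 * card (lex_pairs d)" by (simp add: card_cartesian_product card_idx)
  \<comment> \<open>For \<open>d >= 2\<close> the diagonal is at most half of all entries, so at
    least a quarter of them lies above it.\<close>
  moreover have "2 * d\<^sup>2 \<le> d\<^sup>2 * d\<^sup>2"
  proof -
    have "2 * 2 \<le> d * d" using assms by (rule mult_le_mono[OF assms])
    then show ?thesis unfolding power2_eq_square by (intro mult_right_mono) auto
  qed
  ultimately have "d\<^sup>2 * d\<^sup>2 \<le> 4 * card (lex_pairs d)" by simp
  then have "real (d\<^sup>2 * d\<^sup>2) \<le> real (4 * card (lex_pairs d))" by (simp only: of_nat_le_iff)
  then show ?thesis by (simp add: power_add[symmetric])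
qed

text \<open>For an off-diagonal \<open>p\<close> this is \<open>sqrt 2\<close> times the real part
  of the entry of the random matrix, a sum of two independent normals of variance 1/2 and thus
  standard normal.\<close>

definition sym_re :: "((nat \<times> nat) \<times> (nat \<times> nat) \<Rightarrow> complex) \<Rightarrow> (nat \<times> nat) \<times> (nat \<times> nat) \<Rightarrow> real" where
  "sym_re g p = Re (g p) + Re (g (prod.swap p))"

lemma measurable_sym_re [measurable]:
  assumes "p \<in> idx d \<times> idx d" shows "(\<lambda>g. sym_re g p) \<in> borel_measurable (ginibre d)"
proof -
  have "prod.swap p \<in> idx d \<times> idx d" using assms by auto
  note [measurable] = measurable_ginibre_component[OF this] measurable_ginibre_component[OF assms]
  show ?thesis unfolding sym_re_def by measurable
qed

lemma indep_ginibre_Re: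
  assumes "0 < d"
  shows "prob_space.indep_vars (ginibre d) (\<lambda>_. borel) (\<lambda>p g. Re (g p)) (idx d \<times> idx d)"
proof -
  interpret P: product_prob_space "\<lambda>_. complex_gaussian" "idx d \<times> idx d"
    by (rule product_prob_space_gaussian)
  interpret prob_space "ginibre d" by (rule prob_space_ginibre)
  let ?I = "idx d \<times> idx d"
  have ne: "?I \<noteq> {}" using assms by (auto simp: idx_def)
  have rv: "(\<lambda>g. g p) \<in> measurable (ginibre d) complex_gaussian" if "p \<in> ?I" for p
    unfolding ginibre_def using that by (rule measurable_component_singleton)
  have "distr (ginibre d) (PiM ?I (\<lambda>_. complex_gaussian)) (\<lambda>g. \<lambda>p\<in>?I. g p) = ginibre d"
    unfolding ginibre_def
    by (subst (3) distr_id[symmetric]) (intro distr_cong, auto simp: space_PiM PiE_iff extensional_restrict)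
  also have "\<dots> = PiM ?I (\<lambda>p. distr (ginibre d) complex_gaussian (\<lambda>g. g p))"
    unfolding ginibre_def by (intro PiM_cong refl P.PiM_component[symmetric])
  finally have "indep_vars (\<lambda>_. complex_gaussian) (\<lambda>p g. g p) ?I"
    by (subst indep_vars_iff_distr_eq_PiM'[OF ne rv]) auto
  then have "indep_vars (\<lambda>_. borel) (\<lambda>p g. Re (g p)) ?I"
    by (rule indep_vars_compose2[where Y = "\<lambda>_. Re"]) (rule measurable_Re_complex_gaussian)
  then show ?thesis .
qed

lemma sym_re_distr:
  assumes "p \<in> lex_pairs d"
  shows "(\<integral>\<^sup>+g. ennreal (exp (- (sym_re g p)\<^sup>2)) \<partial>ginibre d) = ennreal (1 / sqrt 3)"
proof -
  interpret P: product_prob_space "\<lambda>_. complex_gaussian" "idx d \<times> idx d"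
    by (rule product_prob_space_gaussian)
  interpret prob_space "ginibre d" by (rule prob_space_ginibre)
  have d: "0 < d" and p: "p \<in> idx d \<times> idx d" "prod.swap p \<in> idx d \<times> idx d" "p \<noteq> prod.swap p"
    using assms by (auto simp: lex_pairs_def idx_def prod.swap_def)
  have dist: "distributed (ginibre d) lborel (\<lambda>g. Re (g q)) (normal_density 0 (1 / sqrt 2))"
    if q: "q \<in> idx d \<times> idx d" for q
  proof -
    note [measurable] = measurable_ginibre_component[OF q]
    have "distr (ginibre d) lborel (\<lambda>g. Re (g q)) = distr (ginibre d) borel (Re \<circ> (\<lambda>g. g q))"
      by (intro distr_cong) (auto simp: comp_def)
    also have "\<dots> = distr (distr (ginibre d) complex_gaussian (\<lambda>g. g q)) borel Re"
      by (rule distr_distr[symmetric]) (auto simp: ginibre_def intro!: measurable_component_singleton q measurable_Re_complex_gaussian)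
    also have "distr (ginibre d) complex_gaussian (\<lambda>g. g q) = complex_gaussian"
      unfolding ginibre_def by (rule P.PiM_component[OF q])
    finally show ?thesis unfolding distributed_def complex_gaussian_Re by auto
  qed
  have "indep_vars (\<lambda>_. borel) (\<lambda>p g. Re (g p)) {p, prod.swap p}"
    using indep_ginibre_Re[OF d] p by (rule_tac indep_vars_subset) auto
  then have "distributed (ginibre d) lborel (\<lambda>g. \<Sum>q\<in>{p, prod.swap p}. Re (g q))
      (normal_density (\<Sum>q\<in>{p, prod.swap p}. 0) (sqrt (\<Sum>q\<in>{p, prod.swap p}. (1 / sqrt 2)\<^sup>2)))"
    using p dist by (intro sum_indep_normal) auto
  then have "distributed (ginibre d) lborel (\<lambda>g. sym_re g p) std_normal_density"
    using p(3) by (simp add: sym_re_def[abs_def] power_divide)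
  from distributed_nn_integral[OF this, of "\<lambda>x. ennreal (exp (- x\<^sup>2))"] show ?thesis
    by (simp add: exp_neg_square_std_normal)
qed

text \<open>Distinct \<open>p\<close> in \<open>lex_pairs d\<close> use disjoint blocks
  \<open>{p, prod.swap p}\<close> of independent coordinates, so the expectation factors into equal
  one-dimensional integrals.\<close>

lemma sym_re_laplace:
  assumes "0 < d"
  shows "(\<integral>\<^sup>+g. ennreal (exp (- (\<Sum>p\<in>lex_pairs d. (sym_re g p)\<^sup>2))) \<partial>ginibre d)
    = ennreal ((1 / sqrt 3) ^ card (lex_pairs d))"
proof -
  interpret prob_space "ginibre d" by (rule prob_space_ginibre)
  let ?K = "\<lambda>p. {p, prod.swap p}"
  define Y where "Y p h = exp (- (\<Sum>q\<in>?K p. h q)\<^sup>2)" for p :: "(nat \<times> nat) \<times> (nat \<times> nat)" and h :: "_ \<Rightarrow> real"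
  have ne: "p \<noteq> prod.swap p" if "p \<in> lex_pairs d" for p
    using that by (auto simp: lex_pairs_def prod.swap_def)
  have "indep_vars (\<lambda>p. PiM (?K p) (\<lambda>_. borel)) (\<lambda>p g. restrict (\<lambda>q. Re (g q)) (?K p)) (lex_pairs d)"
  proof (rule indep_vars_restrict[OF indep_ginibre_Re[OF assms]])
    show "?K p \<subseteq> idx d \<times> idx d" if "p \<in> lex_pairs d" for p
      using that by (auto simp: lex_pairs_def prod.swap_def)
    show "disjoint_family_on ?K (lex_pairs d)"
      by (auto simp: disjoint_family_on_def lex_pairs_def prod.swap_def)
  qed
  then have "indep_vars (\<lambda>_. borel) (\<lambda>p g. Y p (restrict (\<lambda>q. Re (g q)) (?K p))) (lex_pairs d)"
  proof (rule indep_vars_compose2)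
    fix p assume "p \<in> lex_pairs d"
    show "Y p \<in> borel_measurable (PiM (?K p) (\<lambda>_. borel))"
      unfolding Y_def[abs_def] by measurable
  qed
  note indep = this
  have Y: "Y p (restrict (\<lambda>q. Re (g q)) (?K p)) = exp (- (sym_re g p)\<^sup>2)" if "p \<in> lex_pairs d" for p g
    using ne[OF that] by (simp add: Y_def sym_re_def)
  have "(\<integral>\<^sup>+g. ennreal (exp (- (\<Sum>p\<in>lex_pairs d. (sym_re g p)\<^sup>2))) \<partial>ginibre d)
     = (\<integral>\<^sup>+g. (\<Prod>p\<in>lex_pairs d. ennreal (Y p (restrict (\<lambda>q. Re (g q)) (?K p)))) \<partial>ginibre d)"
    by (intro nn_integral_cong) (simp add: prod_ennreal exp_sum[symmetric] sum_negf[symmetric] Y)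
  also have "\<dots> = (\<Prod>p\<in>lex_pairs d. \<integral>\<^sup>+g. ennreal (Y p (restrict (\<lambda>q. Re (g q)) (?K p))) \<partial>ginibre d)"
    by (rule indep_vars_nn_integral) (auto intro!: indep_vars_compose2[OF indep])
  also have "\<dots> = (\<Prod>p\<in>lex_pairs d. ennreal (1 / sqrt 3))"
    by (intro prod.cong refl) (simp add: Y sym_re_distr)
  also have "\<dots> = ennreal ((1 / sqrt 3) ^ card (lex_pairs d))"
    by (simp add: ennreal_power)
  finally show ?thesis .
qed

definition hs2 :: "nat \<Rightarrow> (nat \<times> nat \<Rightarrow> nat \<times> nat \<Rightarrow> complex) \<Rightarrow> real" where
  "hs2 d H = (\<Sum>a\<in>idx d. \<Sum>b\<in>idx d. (cmod (H a b))\<^sup>2)"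

text \<open>The diagonal and all imaginary parts are discarded. Each of two transposed entries still
  contributes at least half the square of \<open>sym_re\<close>.\<close>

lemma hs2_gue0_ge: "(\<Sum>p\<in>lex_pairs d. (sym_re g p)\<^sup>2) \<le> hs2 d (gue0 d g)"
proof -
  let ?f = "\<lambda>p. (cmod (gue0 d g (fst p) (snd p)))\<^sup>2"
  have half: "(sym_re g p)\<^sup>2 / 2 \<le> ?f p" "(sym_re g p)\<^sup>2 / 2 \<le> ?f (prod.swap p)" if "p \<in> lex_pairs d" for p
  proof -
    have ne: "fst p \<noteq> snd p" using that by (auto simp: lex_pairs_def)
    have "Re (gue0 d g (fst p) (snd p)) = sym_re g p / sqrt 2" "Re (gue0 d g (snd p) (fst p)) = sym_re g p / sqrt 2"
      using ne by (auto simp: gue0_def gue_herm_def sym_re_def prod.swap_def add.commute add_divide_distrib)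
    then have R: "(Re (gue0 d g (fst p) (snd p)))\<^sup>2 = (sym_re g p)\<^sup>2 / 2" "(Re (gue0 d g (snd p) (fst p)))\<^sup>2 = (sym_re g p)\<^sup>2 / 2"
      by (simp_all add: power_divide)
    show "(sym_re g p)\<^sup>2 / 2 \<le> ?f p" "(sym_re g p)\<^sup>2 / 2 \<le> ?f (prod.swap p)"
      by (simp_all add: cmod_power2 R)
  qed
  have disj: "lex_pairs d \<inter> prod.swap ` lex_pairs d = {}"
    by (auto simp: lex_pairs_def prod.swap_def)
  have "(\<Sum>p\<in>lex_pairs d. (sym_re g p)\<^sup>2) = (\<Sum>p\<in>lex_pairs d. (sym_re g p)\<^sup>2 / 2) + (\<Sum>p\<in>lex_pairs d. (sym_re g p)\<^sup>2 / 2)"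
    by (simp add: sum.distrib[symmetric])
  also have "\<dots> \<le> (\<Sum>p\<in>lex_pairs d. ?f p) + (\<Sum>p\<in>lex_pairs d. ?f (prod.swap p))"
    by (intro add_mono sum_mono half)
  also have "(\<Sum>p\<in>lex_pairs d. ?f (prod.swap p)) = (\<Sum>p\<in>prod.swap ` lex_pairs d. ?f p)"
    by (subst sum.reindex) (auto intro: inj_on_subset[OF inj_swap])
  also have "(\<Sum>p\<in>lex_pairs d. ?f p) + (\<Sum>p\<in>prod.swap ` lex_pairs d. ?f p) = (\<Sum>p\<in>lex_pairs d \<union> prod.swap ` lex_pairs d. ?f p)"
    by (rule sum.union_disjoint[symmetric]) (auto simp: disj)
  also have "\<dots> \<le> (\<Sum>p\<in>idx d \<times> idx d. ?f p)"
    by (rule sum_mono2) (auto simp: idx_square_decomp)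
  also have "\<dots> = hs2 d (gue0 d g)" by (simp add: hs2_def sum.cartesian_product')
  finally show ?thesis .
qed

text \<open>Markov's inequality for \<open>exp (- Z)\<close>, with \<open>Z\<close> a sum of
  \<open>N\<close> squares of independent standard normals, at the threshold \<open>N / 4\<close>,
  which is at least \<open>d^4 / 16\<close>.\<close>

lemma hs2_lower_tail:
  assumes "2 \<le> d"
  shows "measure (ginibre d) {g \<in> space (ginibre d). (\<Sum>p\<in>lex_pairs d. (sym_re g p)\<^sup>2) < real d ^ 4 / 16}
    \<le> exp (- (real d ^ 4 / 16))"
proof -
  interpret prob_space "ginibre d" by (rule prob_space_ginibre)
  let ?Z = "\<lambda>g. \<Sum>p\<in>lex_pairs d. (sym_re g p)\<^sup>2"
  define N where "N = card (lex_pairs d)"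
  have N: "real d ^ 4 / 4 \<le> real N" using card_lex_pairs[OF assms] by (simp add: N_def)
  have [measurable]: "?Z \<in> borel_measurable (ginibre d)"
    using lex_pairs_subset by (intro borel_measurable_sum borel_measurable_power measurable_sym_re) auto
  have "emeasure (ginibre d) {g \<in> space (ginibre d). ?Z g < real d ^ 4 / 16}
     \<le> emeasure (ginibre d) {g \<in> space (ginibre d). 1 \<le> ennreal (exp (N / 4)) * ennreal (exp (- ?Z g))}"
  proof (intro emeasure_mono subsetI)
    fix g assume g: "g \<in> {g \<in> space (ginibre d). ?Z g < real d ^ 4 / 16}"
    then have "?Z g \<le> N / 4" using N by simp
    then have "ennreal 1 \<le> ennreal (exp (N / 4) * exp (- ?Z g))"
      unfolding exp_add[symmetric] by (intro ennreal_leI) simp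
    then show "g \<in> {g \<in> space (ginibre d). 1 \<le> ennreal (exp (N / 4)) * ennreal (exp (- ?Z g))}"
      using g by (simp add: ennreal_mult)
  qed measurable
  also have "\<dots> \<le> ennreal (exp (N / 4)) * (\<integral>\<^sup>+g. ennreal (exp (- ?Z g)) * indicator (space (ginibre d)) g \<partial>ginibre d)"
    by (rule nn_integral_Markov_inequality) auto
  also have "(\<integral>\<^sup>+g. ennreal (exp (- ?Z g)) * indicator (space (ginibre d)) g \<partial>ginibre d) = ennreal ((1 / sqrt 3) ^ N)"
    unfolding N_def using assms by (subst sym_re_laplace[symmetric]) (auto intro!: nn_integral_cong)
  also have "ennreal (exp (N / 4)) * ennreal ((1 / sqrt 3) ^ N) = ennreal (exp (N / 4) * (1 / sqrt 3) ^ N)"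
    by (simp add: ennreal_mult)
  also have "\<dots> \<le> ennreal (exp (- (real d ^ 4 / 16)))"
  proof (rule ennreal_leI)
    \<comment> \<open>As \<open>e <= 3\<close>, the Laplace transform is at most
      \<open>exp (- N / 2)\<close>, which beats the Markov factor
      \<open>exp (N / 4)\<close>.\<close>
    have "exp (1 / 2 :: real) \<le> sqrt 3"
    proof (rule real_le_rsqrt)
      have "(exp (1 / 2 :: real))\<^sup>2 = exp 1" by (simp add: exp_double[symmetric])
      then show "(exp (1 / 2 :: real))\<^sup>2 \<le> 3" using exp_le by simp
    qed
    then have "1 / sqrt 3 \<le> 1 / exp (1 / 2 :: real)" by (intro divide_left_mono) auto
    then have "1 / sqrt 3 \<le> exp (- (1 / 2) :: real)" by (simp add: exp_minus field_simps)
    then have "(1 / sqrt 3) ^ N \<le> exp (- (1 / 2) :: real) ^ N" by (intro power_mono) auto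
    also have "\<dots> = exp (- (N / 2))" by (simp add: exp_of_nat_mult[symmetric])
    finally have "exp (N / 4) * (1 / sqrt 3) ^ N \<le> exp (N / 4) * exp (- (N / 2))"
      by (intro mult_left_mono) auto
    also have "\<dots> = exp (- (N / 4))" by (simp add: exp_add[symmetric])
    also have "\<dots> \<le> exp (- (real d ^ 4 / 16))" using N by simp
    finally show "exp (N / 4) * (1 / sqrt 3) ^ N \<le> exp (- (real d ^ 4 / 16))" .
  qed
  finally show ?thesis by (simp add: emeasure_eq_measure)
qed


section \<open>Schmidt decompositions of states\<close>

text \<open>The decompositions in \<open>schmidt_number\<close>, with the bound \<open>k\<close> on
  all Schmidt ranks built in. The case \<open>k = d\<close> covers every decomposition into pure
  states.\<close>

definition schmidt_decomp :: "nat \<Rightarrow> nat \<Rightarrow> (nat \<times> nat \<Rightarrow> nat \<times> nat \<Rightarrow> complex) \<Rightarrow> nat \<Rightarrow> (nat \<Rightarrow> real) \<Rightarrow> (nat \<Rightarrow> nat \<times> nat \<Rightarrow> complex) \<Rightarrow> bool" where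
  "schmidt_decomp k d \<rho> m p \<psi> \<longleftrightarrow> 0 < m \<and> (\<forall>l<m. 0 \<le> p l) \<and> (\<Sum>l<m. p l) = 1 \<and>
     (\<forall>l<m. nrm2 (idx d) (\<psi> l) = 1) \<and>
     (\<forall>a\<in>idx d. \<forall>b\<in>idx d. \<rho> a b = (\<Sum>l<m. complex_of_real (p l) * \<psi> l a * cnj (\<psi> l b))) \<and>
     (\<forall>l<m. mat_rank d (ptrace_A_proj d (\<psi> l)) \<le> k)"

lemma qform_insert:
  assumes "finite F" "z \<notin> F"
  shows "qform (insert z F) H y = qform F H y + cnj (y z) * (\<Sum>b\<in>F. H z b * y b)
    + (\<Sum>a\<in>F. cnj (y a) * H a z) * y z + cnj (y z) * H z z * y z"
  unfolding qform_def using assms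
  by (simp add: sum.distrib sum_distrib_left sum_distrib_right algebra_simps)

lemma qform_cong: "(\<And>a. a \<in> I \<Longrightarrow> x a = y a) \<Longrightarrow> qform I H x = qform I H y"
  unfolding qform_def by (intro sum.cong refl) simp

text \<open>Cholesky elimination of one index at a time.\<close>

lemma psd_decomp:
  assumes "finite I" "\<And>a b. a \<in> I \<Longrightarrow> b \<in> I \<Longrightarrow> H a b = cnj (H b a)" "\<And>v. 0 \<le> Re (qform I H v)"
  shows "\<exists>m (v :: nat \<Rightarrow> 'a \<Rightarrow> complex). \<forall>a\<in>I. \<forall>b\<in>I. H a b = (\<Sum>l<m. v l a * cnj (v l b))"
  using assms
proof (induction I arbitrary: H rule: finite_induct)
  case empty
  then show ?case by auto
next
  case (insert z F H)
  define h where "h = Re (H z z)"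
  have hz: "H z z = complex_of_real h"
    using insert.prems(1)[of z z] by (simp add: h_def complex_eq_iff)
  have herm: "H a z = cnj (H z a)" if "a \<in> F" for a
    using insert.prems(1)[of a z] that by simp
  have expand: "Re (qform (insert z F) H y) = Re (qform F H y) + 2 * Re (cnj (y z) * (\<Sum>b\<in>F. H z b * y b)) + h * (cmod (y z))\<^sup>2"
    for y
  proof -
    define S where "S = (\<Sum>b\<in>F. H z b * y b)"
    have "(\<Sum>a\<in>F. cnj (y a) * H a z) = cnj S"
      by (simp add: herm mult.commute S_def)
    then have 1: "(\<Sum>a\<in>F. cnj (y a) * H a z) * y z = cnj (cnj (y z) * S)"
      by (simp add: mult.commute)
    have 2: "cnj (y z) * H z z * y z = complex_of_real (h * (cmod (y z))\<^sup>2)"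
      using complex_norm_square[of "y z"] by (simp add: hz mult_ac)
    show ?thesis
      unfolding qform_insert[OF insert.hyps] 1 2 S_def[symmetric] plus_complex.sel cnj.sel Re_complex_of_real
      by simp
  qed
  have h0: "0 \<le> h"
  proof -
    have "0 \<le> Re (qform (insert z F) H (\<lambda>a. if a = z then 1 else 0))" by (rule insert.prems)
    moreover have "(\<Sum>b\<in>F. H z b * (if b = z then 1 else 0)) = 0"
      using insert.hyps by (intro sum.neutral) auto
    moreover have "qform F H (\<lambda>a. if a = z then 1 else 0) = 0"
      unfolding qform_def using insert.hyps by (intro sum.neutral ballI) auto
    ultimately show ?thesis unfolding expand by simp
  qed
  show ?case
  proof (cases "h = 0")
    case True
    have zero: "H z b = 0" if b: "b \<in> F" for b
    proof (rule ccontr)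
      assume nz: "H z b \<noteq> 0"
      \<comment> \<open>With a zero pivot the form at the test vector is affine in \<open>s\<close>;
        this value of \<open>s\<close> makes it equal to -1.\<close>
      define s where "s = (Re (H b b) + 1) / (2 * (cmod (H z b))\<^sup>2)"
      define y where "y a = (if a = z then - complex_of_real s * H z b else if a = b then 1 else 0)" for a
      have bz: "b \<noteq> z" using b insert.hyps by auto
      have "(\<Sum>c\<in>F. H z c * y c) = (\<Sum>c\<in>F. if c = b then H z b else 0)"
        using insert.hyps by (intro sum.cong) (auto simp: y_def)
      then have 1: "(\<Sum>c\<in>F. H z c * y c) = H z b" using b insert.hyps by simp
      have "qform F H y = (\<Sum>a\<in>F. \<Sum>c\<in>F. if a = b \<and> c = b then H b b else 0)"
        unfolding qform_def using insert.hyps by (intro sum.cong refl) (auto simp: y_def)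
      also have "\<dots> = (\<Sum>a\<in>F. if a = b then H b b else 0)"
        using b insert.hyps by (intro sum.cong refl) auto
      finally have 2: "qform F H y = H b b" using b insert.hyps by simp
      have 3: "Re (cnj (y z) * H z b) = - s * (cmod (H z b))\<^sup>2"
        unfolding cmod_power2 by (simp add: y_def power2_eq_square algebra_simps)
      have "0 \<le> Re (qform (insert z F) H y)" by (rule insert.prems)
      also have "\<dots> = Re (H b b) - 2 * s * (cmod (H z b))\<^sup>2"
        unfolding expand 1 2 3 using True by simp
      also have "\<dots> = - 1" using nz by (simp add: s_def field_simps)
      finally show False by simp
    qed
    have "\<exists>m (v :: nat \<Rightarrow> 'a \<Rightarrow> complex). \<forall>a\<in>F. \<forall>b\<in>F. H a b = (\<Sum>l<m. v l a * cnj (v l b))"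
    proof (rule insert.IH)
      show "H a b = cnj (H b a)" if "a \<in> F" "b \<in> F" for a b using insert.prems(1) that by blast
      fix v
      have "qform F H v = qform F H (v(z := 0))" using insert.hyps by (intro qform_cong) auto
      then show "0 \<le> Re (qform F H v)" using insert.prems(2)[of "v(z := 0)"] unfolding expand by simp
    qed
    then obtain m and v :: "nat \<Rightarrow> 'a \<Rightarrow> complex" where v: "\<forall>a\<in>F. \<forall>b\<in>F. H a b = (\<Sum>l<m. v l a * cnj (v l b))" by blast
    show ?thesis
      by (rule exI[of _ m], rule exI[of _ "\<lambda>l a. if a = z then 0 else v l a"])
        (use v insert.hyps hz True zero herm in \<open>auto intro!: sum.cong\<close>)
  next
    case False
    with h0 have h: "0 < h" by simp
    define w where "w a = H a z / complex_of_real (sqrt h)" for a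
    define H' where "H' a b = H a b - w a * cnj (w b)" for a b
    have sq: "complex_of_real (sqrt h) * complex_of_real (sqrt h) = complex_of_real h"
      unfolding of_real_mult[symmetric] using h by simp
    have "\<exists>m (v :: nat \<Rightarrow> 'a \<Rightarrow> complex). \<forall>a\<in>F. \<forall>b\<in>F. H' a b = (\<Sum>l<m. v l a * cnj (v l b))"
    proof (rule insert.IH)
      show "H' a b = cnj (H' b a)" if "a \<in> F" "b \<in> F" for a b
      proof -
        have "H a b = cnj (H b a)" using insert.prems(1) that by blast
        then show ?thesis by (simp add: H'_def mult.commute)
      qed
      fix x :: "'a \<Rightarrow> complex"
      define S where "S = (\<Sum>b\<in>F. H z b * x b)"
      \<comment> \<open>The choice of the coordinate at \<open>z\<close> that minimises the form for
        given \<open>x\<close> on \<open>F\<close>; the minimum is the form of the Schur complement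
        \<open>H'\<close>.\<close>
      define y where "y = x(z := - S / complex_of_real h)"
      have Sy: "(\<Sum>b\<in>F. H z b * y b) = S"
        unfolding S_def y_def using insert.hyps by (intro sum.cong) auto
      have Fy: "qform F H y = qform F H x" using insert.hyps by (intro qform_cong) (auto simp: y_def)
      have "Re (cnj (y z) * S) = - (cmod S)\<^sup>2 / h"
        unfolding cmod_power2 using h by (simp add: y_def power2_eq_square field_simps)
      moreover have "h * (cmod (y z))\<^sup>2 = (cmod S)\<^sup>2 / h"
        using h by (simp add: y_def norm_divide power_divide power2_eq_square)
      ultimately have "Re (qform (insert z F) H y) = Re (qform F H x) - (cmod S)\<^sup>2 / h"
        unfolding expand Sy Fy by simp
      then have ge: "0 \<le> Re (qform F H x) - (cmod S)\<^sup>2 / h" using insert.prems(2)[of y] by simp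
      have "(\<Sum>a\<in>F. \<Sum>b\<in>F. cnj (x a) * (w a * cnj (w b)) * x b) = (\<Sum>a\<in>F. cnj (x a) * w a) * (\<Sum>b\<in>F. cnj (w b) * x b)"
        unfolding sum_product by (simp add: mult_ac)
      also have "(\<Sum>b\<in>F. cnj (w b) * x b) = S / complex_of_real (sqrt h)"
        unfolding S_def sum_divide_distrib by (intro sum.cong refl) (simp add: w_def herm)
      also have "(\<Sum>a\<in>F. cnj (x a) * w a) = cnj S / complex_of_real (sqrt h)"
        unfolding S_def cnj_sum sum_divide_distrib by (intro sum.cong refl) (simp add: w_def herm mult.commute)
      also have "cnj S / complex_of_real (sqrt h) * (S / complex_of_real (sqrt h)) = complex_of_real ((cmod S)\<^sup>2 / h)"
        using complex_norm_square[of S] by (simp add: sq mult.commute)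
      finally have "qform F H' x = qform F H x - complex_of_real ((cmod S)\<^sup>2 / h)"
        unfolding qform_def H'_def by (simp add: algebra_simps sum_subtractf)
      then show "0 \<le> Re (qform F H' x)" using ge by simp
    qed
    then obtain m and v :: "nat \<Rightarrow> 'a \<Rightarrow> complex" where v: "\<forall>a\<in>F. \<forall>b\<in>F. H' a b = (\<Sum>l<m. v l a * cnj (v l b))" by blast
    define v' where "v' l = (if l = m then w else (\<lambda>a. if a = z then 0 else v l a))" for l
    have sum: "(\<Sum>l<Suc m. v' l a * cnj (v' l b)) = (\<Sum>l<m. v' l a * cnj (v' l b)) + w a * cnj (w b)" for a b
      by (simp add: v'_def)
    have wz: "w z * cnj (w z) = H z z" using h by (simp add: w_def hz sq)
    have wzb: "w z * cnj (w b) = H z b" "w b * cnj (w z) = H b z" if "b \<in> F" for b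
      using h that by (auto simp: w_def hz sq herm)
    have "H a b = (\<Sum>l<Suc m. v' l a * cnj (v' l b))" if "a \<in> insert z F" "b \<in> insert z F" for a b
    proof (cases "a = z \<or> b = z")
      case True
      then have "(\<Sum>l<m. v' l a * cnj (v' l b)) = 0" by (intro sum.neutral) (auto simp: v'_def)
      then show ?thesis unfolding sum using True that wz wzb by auto
    next
      case False
      then have "(\<Sum>l<m. v' l a * cnj (v' l b)) = H' a b"
        using v that by (auto simp: v'_def)
      then show ?thesis unfolding sum by (simp add: H'_def)
    qed
    then show ?thesis by blast
  qed
qed

lemma mat_rank_le_dim: "mat_rank d M \<le> d"
  unfolding mat_rank_le_iff using card_mono[of "{..<d}"] by auto

text \<open>Shows that the infimum defining \<open>schmidt_number\<close> ranges over a nonempty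
  set, so that it is attained.\<close>

lemma state_schmidt_decomp:
  assumes "is_state d \<rho>"
  shows "\<exists>m p \<psi>. schmidt_decomp d d \<rho> m p \<psi>"
proof -
  let ?I = "idx d"
  have "\<exists>m (v :: nat \<Rightarrow> nat \<times> nat \<Rightarrow> complex). \<forall>a\<in>?I. \<forall>b\<in>?I. \<rho> a b = (\<Sum>l<m. v l a * cnj (v l b))"
  proof (rule psd_decomp)
    show "\<rho> a b = cnj (\<rho> b a)" if "a \<in> ?I" "b \<in> ?I" for a b
      using assms that unfolding is_state_def by blast
    show "0 \<le> Re (qform ?I \<rho> v)" for v
      using assms unfolding is_state_def qform_def by blast
  qed simp
  then obtain m and v :: "nat \<Rightarrow> nat \<times> nat \<Rightarrow> complex"
    where v: "\<forall>a\<in>?I. \<forall>b\<in>?I. \<rho> a b = (\<Sum>l<m. v l a * cnj (v l b))" by blast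
  define p where "p l = nrm2 ?I (v l)" for l
  have "complex_of_real (\<Sum>l<m. p l) = (\<Sum>l<m. ip ?I (v l) (v l))"
    by (simp add: p_def ip_self)
  also have "\<dots> = (\<Sum>a\<in>?I. \<rho> a a)"
    unfolding ip_def by (subst sum.swap) (simp add: v mult.commute)
  also have tr: "\<dots> = complex_of_real 1" using assms unfolding is_state_def by (metis of_real_1)
  finally have p1: "(\<Sum>l<m. p l) = 1" by (simp only: of_real_eq_iff)
  have m: "0 < m" using p1 by (cases m) auto
  have "?I \<noteq> {}" using tr by auto
  then obtain a0 where a0: "a0 \<in> ?I" by auto
  \<comment> \<open>A vanishing component cannot be normalised. It is replaced by a basis vector,
    whose weight is \<open>p l = 0\<close>.\<close>
  define \<psi> where "\<psi> l = (if p l = 0 then (\<lambda>a. if a = a0 then 1 else 0) else (\<lambda>a. v l a / complex_of_real (sqrt (p l))))" for l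
  have p0: "0 \<le> p l" for l by (simp add: p_def nrm2_nonneg)
  have "nrm2 ?I (\<psi> l) = 1" for l
  proof (cases "p l = 0")
    case True
    then have "nrm2 ?I (\<psi> l) = (\<Sum>a\<in>?I. if a = a0 then 1 else 0)"
      unfolding nrm2_def by (intro sum.cong) (auto simp: \<psi>_def)
    then show ?thesis using a0 by simp
  next
    case False
    then have "nrm2 ?I (\<psi> l) = nrm2 ?I (v l) / p l"
      unfolding nrm2_def sum_divide_distrib using p0[of l]
      by (intro sum.cong) (auto simp: \<psi>_def norm_divide power_divide)
    then show ?thesis using False by (simp add: p_def)
  qed
  moreover have "complex_of_real (p l) * \<psi> l a * cnj (\<psi> l b) = v l a * cnj (v l b)"
    if "a \<in> ?I" "b \<in> ?I" for l a b
  proof (cases "p l = 0")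
    case True
    then show ?thesis using that nrm2_eq_0[of ?I "v l"] by (simp add: p_def)
  next
    case False
    have "complex_of_real (sqrt (p l)) * complex_of_real (sqrt (p l)) = complex_of_real (p l)"
      unfolding of_real_mult[symmetric] using p0[of l] by simp
    moreover have "complex_of_real (p l) * \<psi> l a * cnj (\<psi> l b) = complex_of_real (p l) * (v l a * cnj (v l b)) /
        (complex_of_real (sqrt (p l)) * complex_of_real (sqrt (p l)))"
      using False by (simp add: \<psi>_def)
    ultimately show ?thesis using False by simp
  qed
  moreover from this have "\<rho> a b = (\<Sum>l<m. complex_of_real (p l) * \<psi> l a * cnj (\<psi> l b))"
    if "a \<in> ?I" "b \<in> ?I" for a b
    using v that by (simp only:)
  ultimately have "schmidt_decomp d d \<rho> m p \<psi>"
    unfolding schmidt_decomp_def using m p0 p1 by (intro conjI ballI allI impI mat_rank_le_dim)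
  then show ?thesis by blast
qed

lemma schmidt_decomp_qform:
  assumes "\<forall>a\<in>I. \<forall>b\<in>I. \<rho> a b = (\<Sum>l<m. complex_of_real (p l) * \<psi> l a * cnj (\<psi> l b))"
  shows "qform I \<rho> x = (\<Sum>l<m. complex_of_real (p l * (cmod (ip I x (\<psi> l)))\<^sup>2))"
proof -
  have "qform I \<rho> x = (\<Sum>a\<in>I. \<Sum>b\<in>I. \<Sum>l<m. complex_of_real (p l) * ((cnj (x a) * \<psi> l a) * (cnj (\<psi> l b) * x b)))"
    unfolding qform_def using assms
    by (intro sum.cong refl) (simp add: sum_distrib_left sum_distrib_right mult_ac)
  also have "\<dots> = (\<Sum>l<m. \<Sum>a\<in>I. \<Sum>b\<in>I. complex_of_real (p l) * ((cnj (x a) * \<psi> l a) * (cnj (\<psi> l b) * x b)))"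
    by (subst sum.swap[of _ "{..<m}"], subst sum.swap[of _ "{..<m}"]) (rule refl)
  also have "\<dots> = (\<Sum>l<m. complex_of_real (p l) * (ip I x (\<psi> l) * ip I (\<psi> l) x))"
    unfolding ip_def sum_product by (simp only: sum_distrib_left)
  also have "\<dots> = (\<Sum>l<m. complex_of_real (p l * (cmod (ip I x (\<psi> l)))\<^sup>2))"
    by (intro sum.cong refl) (simp only: of_real_mult complex_norm_square ip_cnj)
  finally show ?thesis .
qed

lemma schmidt_decomp_iff:
  "schmidt_decomp k d \<rho> m p \<psi> \<longleftrightarrow>
    schmidt_decomp d d \<rho> m p \<psi> \<and> (\<forall>l<m. mat_rank d (ptrace_A_proj d (\<psi> l)) \<le> k)"
  unfolding schmidt_decomp_def by (simp only: mat_rank_le_dim simp_thms conj_assoc)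

lemma schmidt_number_eq:
  "schmidt_number d \<rho> = Inf {r. \<exists>m p \<psi>. schmidt_decomp d d \<rho> m p \<psi> \<and>
     r = Max ((\<lambda>l. mat_rank d (ptrace_A_proj d (\<psi> l))) ` {..<m})}"
  unfolding schmidt_number_def schmidt_decomp_def nrm2_def
  by (simp only: mat_rank_le_dim simp_thms conj_assoc)

lemma is_state_of_schmidt_decomp:
  assumes D: "schmidt_decomp k d \<rho> m p \<psi>"
  shows "is_state d \<rho>"
proof -
  note D' = D[unfolded schmidt_decomp_def]
  have \<rho>: "\<forall>a\<in>idx d. \<forall>b\<in>idx d. \<rho> a b = (\<Sum>l<m. complex_of_real (p l) * \<psi> l a * cnj (\<psi> l b))"
    using D' by simp
  have "\<rho> a b = cnj (\<rho> b a)" if "a \<in> idx d" "b \<in> idx d" for a b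
    using \<rho> that by (simp add: mult_ac)
  moreover have "0 \<le> Re (qform (idx d) \<rho> v)" for v
    unfolding schmidt_decomp_qform[OF \<rho>] of_real_sum[symmetric] Re_complex_of_real
    using D' by (intro sum_nonneg) auto
  moreover have "(\<Sum>a\<in>idx d. \<rho> a a) = 1"
  proof -
    have "(\<Sum>a\<in>idx d. \<rho> a a) = (\<Sum>l<m. complex_of_real (p l) * ip (idx d) (\<psi> l) (\<psi> l))"
      unfolding ip_def sum_distrib_left using \<rho> by (subst sum.swap) (simp add: mult_ac)
    also have "\<dots> = complex_of_real (\<Sum>l<m. p l)"
      unfolding of_real_sum using D' by (intro sum.cong) (auto simp: ip_self)
    also have "\<dots> = 1" using D' by simp
    finally show ?thesis .
  qed
  ultimately show ?thesis unfolding is_state_def qform_def by (intro conjI ballI allI)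
qed

lemma SN_iff: "\<rho> \<in> SN k d \<longleftrightarrow> (\<exists>m p \<psi>. schmidt_decomp k d \<rho> m p \<psi>)"
proof
  let ?rk = "\<lambda>m \<psi>. Max ((\<lambda>l. mat_rank d (ptrace_A_proj d (\<psi> l))) ` {..<m})"
  let ?S = "{r. \<exists>m p \<psi>. schmidt_decomp d d \<rho> m p \<psi> \<and> r = ?rk m \<psi>}"
  {
    assume \<rho>: "\<rho> \<in> SN k d"
    then have le: "schmidt_number d \<rho> \<le> k" and "is_state d \<rho>" by (simp_all add: SN_def)
    from state_schmidt_decomp[OF this(2)] have "?S \<noteq> {}" by blast
    then have "schmidt_number d \<rho> \<in> ?S" unfolding schmidt_number_eq by (rule Inf_nat_def1)
    then obtain m p \<psi> where *: "schmidt_decomp d d \<rho> m p \<psi>" "schmidt_number d \<rho> = ?rk m \<psi>"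
      by auto
    have "mat_rank d (ptrace_A_proj d (\<psi> l)) \<le> k" if "l < m" for l
    proof -
      have "mat_rank d (ptrace_A_proj d (\<psi> l)) \<le> schmidt_number d \<rho>"
        unfolding *(2) using that by (intro Max_ge) auto
      then show ?thesis using le by simp
    qed
    with *(1) show "\<exists>m p \<psi>. schmidt_decomp k d \<rho> m p \<psi>"
      unfolding schmidt_decomp_iff[of k] by blast
  }
  {
    assume "\<exists>m p \<psi>. schmidt_decomp k d \<rho> m p \<psi>"
    then obtain m p \<psi> where D: "schmidt_decomp k d \<rho> m p \<psi>" by blast
    then have m: "0 < m" by (simp add: schmidt_decomp_def)
    have "?rk m \<psi> \<in> ?S" using D unfolding schmidt_decomp_iff[of k] by blast
    then have "schmidt_number d \<rho> \<le> ?rk m \<psi>"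
      unfolding schmidt_number_eq by (intro cInf_lower) simp_all
    also have "\<dots> \<le> k" using D m unfolding schmidt_decomp_iff[of k] by (subst Max_le_iff) auto
    finally show "\<rho> \<in> SN k d" using is_state_of_schmidt_decomp[OF D] by (simp add: SN_def)
  }
qed


section \<open>Measurability\<close>

text \<open>Tychonoff's theorem, stated for the topology on function types.\<close>

lemma compact_coordinatewise:
  assumes "\<And>i. compact (C i)"
  shows "compact {f :: 'i \<Rightarrow> 'b :: topological_space. \<forall>i. f i \<in> C i}"
proof -
  have "compactin (product_topology (\<lambda>_. euclidean) UNIV) (PiE UNIV C)"
    using assms by (simp add: compactin_PiE)
  moreover have "PiE UNIV C = {f. \<forall>i. f i \<in> C i}" by auto
  ultimately show ?thesis by (simp add: euclidean_product_topology)
qed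

text \<open>Function types are not an instance of \<open>t2_space\<close>, hence the detour through abstract topologies.\<close>

lemma compact_fun_imp_closed:
  fixes S :: "('i \<Rightarrow> 'b :: metric_space) set"
  assumes "compact S" shows "closed S"
proof -
  have "Hausdorff_space (euclidean :: ('i \<Rightarrow> 'b) topology)"
    unfolding euclidean_product_topology[symmetric] by (simp add: Hausdorff_space_product_topology)
  then show ?thesis
    using compactin_imp_closedin[of euclidean S] assms by simp
qed

type_synonym params = "(nat \<Rightarrow> real) \<times> (nat \<Rightarrow> nat \<times> nat \<Rightarrow> complex) \<times> (nat \<Rightarrow> nat set \<Rightarrow> nat \<Rightarrow> complex)"

text \<open>The third parameter certifies the rank bound: for every set of more than \<open>k\<close> columns it
  contains a normalised linear dependency.\<close>

definition decomp_params :: "nat \<Rightarrow> nat \<Rightarrow> nat \<Rightarrow> params set" where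
  "decomp_params k d m = {(p, \<psi>, c).
     (\<forall>l. p l \<in> {0..1}) \<and> (\<forall>l a. \<psi> l a \<in> cball 0 1) \<and> (\<forall>l S j. c l S j \<in> cball 0 1) \<and>
     (\<Sum>l<m. p l) = 1 \<and> (\<forall>l<m. (\<Sum>a\<in>idx d. (cmod (\<psi> l a))\<^sup>2) = 1) \<and>
     (\<forall>l<m. \<forall>S. S \<subseteq> {..<d} \<and> k < card S \<longrightarrow> (\<Sum>j\<in>S. (cmod (c l S j))\<^sup>2) = 1 \<and>
        (\<forall>i<d. (\<Sum>j\<in>S. c l S j * (\<Sum>i'<d. \<psi> l (i', i) * cnj (\<psi> l (i', j)))) = 0))}"

text \<open>The matrix becomes one function of index pairs, set to zero outside
  \<open>idx d\<close>, so that it is a point of a product space and continuity can be checked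
  coordinatewise.\<close>

definition state_of_params :: "nat \<Rightarrow> nat \<Rightarrow> params \<Rightarrow> (nat \<times> nat) \<times> (nat \<times> nat) \<Rightarrow> complex" where
  "state_of_params d m x ab = (if ab \<in> idx d \<times> idx d
     then \<Sum>l<m. complex_of_real (fst x l) * fst (snd x) l (fst ab) * cnj (fst (snd x) l (snd ab)) else 0)"

lemma continuous_params:
  "continuous_on UNIV (\<lambda>x :: params. fst x l)"
  "continuous_on UNIV (\<lambda>x :: params. fst (snd x) l a)"
  "continuous_on UNIV (\<lambda>x :: params. snd (snd x) l S j)"
proof -
  have 1: "continuous_on UNIV (\<lambda>x :: params. fst x)" "continuous_on UNIV (\<lambda>x :: params. fst (snd x))"
    "continuous_on UNIV (\<lambda>x :: params. snd (snd x))"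
    by (intro continuous_on_fst continuous_on_snd continuous_on_id)+
  note coord = continuous_on_product_then_coordinatewise
  show "continuous_on UNIV (\<lambda>x :: params. fst x l)" by (rule coord[OF 1(1)])
  show "continuous_on UNIV (\<lambda>x :: params. fst (snd x) l a)" by (rule coord[OF coord[OF 1(2)]])
  show "continuous_on UNIV (\<lambda>x :: params. snd (snd x) l S j)" by (rule coord[OF coord[OF coord[OF 1(3)]]])
qed

lemma closed_Collect_all_imp:
  assumes "\<And>i. P i \<Longrightarrow> closed {x. Q i x}"
  shows "closed {x. \<forall>i. P i \<longrightarrow> Q i x}"
proof -
  have "{x. \<forall>i. P i \<longrightarrow> Q i x} = (\<Inter>i\<in>{i. P i}. {x. Q i x})" by auto
  then show ?thesis using assms by (simp add: closed_INT)
qed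

lemma compact_decomp_params: "compact (decomp_params k d m)"
proof -
  let ?B = "{p. \<forall>l. p l \<in> {0..1::real}} \<times> {\<psi>. \<forall>l. \<psi> l \<in> {f. \<forall>a. f a \<in> cball (0::complex) 1}} \<times>
    {c. \<forall>l. c l \<in> {f. \<forall>S. f S \<in> {f. \<forall>j. f j \<in> cball (0::complex) 1}}} :: params set"
  let ?C = "{x :: params. (\<Sum>l<m. fst x l) = 1 \<and> (\<forall>l<m. (\<Sum>a\<in>idx d. (cmod (fst (snd x) l a))\<^sup>2) = 1) \<and>
     (\<forall>l<m. \<forall>S. S \<subseteq> {..<d} \<and> k < card S \<longrightarrow> (\<Sum>j\<in>S. (cmod (snd (snd x) l S j))\<^sup>2) = 1 \<and>
        (\<forall>i<d. (\<Sum>j\<in>S. snd (snd x) l S j * (\<Sum>i'<d. fst (snd x) l (i', i) * cnj (fst (snd x) l (i', j)))) = 0))}"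
  have B: "compact ?B"
    by (intro compact_Times compact_coordinatewise compact_Icc compact_cball)
  have C: "closed ?C"
    by (intro closed_Collect_conj closed_Collect_all_imp closed_Collect_eq continuous_intros continuous_params)
  have "decomp_params k d m = ?B \<inter> ?C"
  proof (intro set_eqI)
    fix x :: params
    obtain p \<psi> c where x: "x = (p, \<psi>, c)" by (cases x)
    show "x \<in> decomp_params k d m \<longleftrightarrow> x \<in> ?B \<inter> ?C"
      unfolding decomp_params_def x
      by (simp only: mem_Collect_eq prod.case Int_iff mem_Times_iff fst_conv snd_conv conj_assoc)
  qed
  then show ?thesis using compact_Int_closed[OF B C] by simp
qed

lemma closed_state_of_params: "closed (state_of_params d m ` decomp_params k d m)"
proof (intro compact_fun_imp_closed compact_continuous_image compact_decomp_params)
  have "continuous_on UNIV (\<lambda>x. state_of_params d m x ab)" for ab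
    unfolding state_of_params_def
    by (cases "ab \<in> idx d \<times> idx d") (simp_all, intro continuous_intros continuous_params)
  then have "continuous_on UNIV (state_of_params d m)"
    by (rule continuous_on_coordinatewise_then_product)
  then show "continuous_on (decomp_params k d m) (state_of_params d m)"
    by (rule continuous_on_subset) simp
qed

text \<open>Being nonzero is not a closed condition, but having unit norm is; scaling replaces the
  one by the other and also places the certificate in the unit balls of the parameter space.\<close>

lemma col_dep_normalised:
  assumes "finite S" "\<not> col_indep d M S"
  shows "\<exists>c. (\<forall>j. cmod (c j) \<le> 1) \<and> (\<Sum>j\<in>S. (cmod (c j))\<^sup>2) = 1 \<and> (\<forall>i<d. (\<Sum>j\<in>S. c j * M i j) = 0)"
proof -
  obtain c where c: "\<forall>i<d. (\<Sum>j\<in>S. c j * M i j) = 0" "\<exists>j\<in>S. c j \<noteq> 0"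
    using assms(2) unfolding col_indep_def by blast
  define s where "s = sqrt (nrm2 S c)"
  have "nrm2 S c \<noteq> 0" using c(2) nrm2_eq_0[OF assms(1), of c] by blast
  then have "0 < nrm2 S c" using nrm2_nonneg[of S c] by linarith
  then have s: "0 < s" "s\<^sup>2 = nrm2 S c" by (simp_all add: s_def)
  define c' where "c' j = (if j \<in> S then c j / complex_of_real s else 0)" for j
  have one: "(\<Sum>j\<in>S. (cmod (c' j))\<^sup>2) = 1"
  proof -
    have "(\<Sum>j\<in>S. (cmod (c' j))\<^sup>2) = nrm2 S c / s\<^sup>2"
      unfolding nrm2_def sum_divide_distrib by (intro sum.cong refl) (simp add: c'_def norm_divide power_divide)
    then show ?thesis using s \<open>nrm2 S c \<noteq> 0\<close> by simp
  qed
  have "cmod (c' j) \<le> 1" for j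
  proof (cases "j \<in> S")
    case True
    then have "(cmod (c' j))\<^sup>2 \<le> (\<Sum>j\<in>S. (cmod (c' j))\<^sup>2)" using assms(1) by (intro member_le_sum) auto
    then have "(cmod (c' j))\<^sup>2 \<le> 1\<^sup>2" using one by simp
    then show ?thesis by (rule power2_le_imp_le) simp
  qed (simp add: c'_def)
  moreover have "(\<Sum>j\<in>S. c' j * M i j) = 0" if "i < d" for i
  proof -
    have "(\<Sum>j\<in>S. c' j * M i j) = (\<Sum>j\<in>S. c j * M i j) / complex_of_real s"
      unfolding sum_divide_distrib by (intro sum.cong refl) (simp add: c'_def)
    then show ?thesis using c(1) that by simp
  qed
  ultimately show ?thesis using one by blast
qed

lemma schmidt_decomp_image:
  "(\<exists>p \<psi>. schmidt_decomp k d \<rho> m p \<psi>) \<longleftrightarrow> 0 < m \<and>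
    (\<lambda>ab. if ab \<in> idx d \<times> idx d then \<rho> (fst ab) (snd ab) else 0) \<in> state_of_params d m ` decomp_params k d m"
    (is "_ \<longleftrightarrow> _ \<and> ?R \<in> _")
proof
  assume "\<exists>p \<psi>. schmidt_decomp k d \<rho> m p \<psi>"
  then obtain p \<psi> where D: "schmidt_decomp k d \<rho> m p \<psi>" by blast
  note D' = D[unfolded schmidt_decomp_def]
  from D' have m: "0 < m" by (elim conjE)
  from D' have p: "\<forall>l<m. 0 \<le> p l" "(\<Sum>l<m. p l) = 1" by simp_all
  from D' have \<psi>: "\<forall>l<m. nrm2 (idx d) (\<psi> l) = 1" by (elim conjE)
  from D' have \<rho>: "\<forall>a\<in>idx d. \<forall>b\<in>idx d. \<rho> a b = (\<Sum>l<m. complex_of_real (p l) * \<psi> l a * cnj (\<psi> l b))"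
    by (elim conjE)
  from D' have rk: "\<forall>l<m. mat_rank d (ptrace_A_proj d (\<psi> l)) \<le> k" by (elim conjE)
  \<comment> \<open>The parameter space also constrains the values at indices out of range; there
    everything is set to zero.\<close>
  define p' where "p' l = (if l < m then p l else 0)" for l
  define \<psi>' where "\<psi>' l a = (if l < m \<and> a \<in> idx d then \<psi> l a else 0)" for l a
  define good where "good l S c \<longleftrightarrow> (\<forall>j. cmod (c j) \<le> 1) \<and> (l < m \<longrightarrow> S \<subseteq> {..<d} \<longrightarrow> k < card S \<longrightarrow>
      (\<Sum>j\<in>S. (cmod (c j))\<^sup>2) = 1 \<and> (\<forall>i<d. (\<Sum>j\<in>S. c j * ptrace_A_proj d (\<psi> l) i j) = 0))"
    for l and S :: "nat set" and c :: "nat \<Rightarrow> complex"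
  have "\<exists>c. good l S c" for l S
  proof (cases "l < m \<and> S \<subseteq> {..<d} \<and> k < card S")
    case True
    then have "\<not> col_indep d (ptrace_A_proj d (\<psi> l)) S"
      using rk unfolding mat_rank_le_iff by (meson leD)
    moreover have "finite S" using True finite_subset by blast
    ultimately show ?thesis using col_dep_normalised[of S d "ptrace_A_proj d (\<psi> l)"] unfolding good_def by blast
  next
    case False
    then show ?thesis unfolding good_def by (intro exI[of _ "\<lambda>_. 0"]) auto
  qed
  then have "\<forall>l. \<exists>f. \<forall>S. good l S (f S)" by metis
  then obtain c where "\<And>l S. good l S (c l S)" by metis
  then have c: "\<And>l S j. cmod (c l S j) \<le> 1"
    "\<And>l S. l < m \<Longrightarrow> S \<subseteq> {..<d} \<Longrightarrow> k < card S \<Longrightarrow> (\<Sum>j\<in>S. (cmod (c l S j))\<^sup>2) = 1"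
    "\<And>l S i. l < m \<Longrightarrow> S \<subseteq> {..<d} \<Longrightarrow> k < card S \<Longrightarrow> i < d \<Longrightarrow> (\<Sum>j\<in>S. c l S j * ptrace_A_proj d (\<psi> l) i j) = 0"
    unfolding good_def by simp_all
  have P1: "p' l \<in> {0..1}" for l
  proof (cases "l < m")
    case True
    have "p l \<le> (\<Sum>l<m. p l)" using True p(1) by (intro member_le_sum) auto
    then show ?thesis using True p by (simp add: p'_def)
  qed (simp add: p'_def)
  have P2: "\<psi>' l a \<in> cball 0 1" for l a
  proof (cases "l < m \<and> a \<in> idx d")
    case True
    have "(cmod (\<psi> l a))\<^sup>2 \<le> nrm2 (idx d) (\<psi> l)" unfolding nrm2_def using True by (intro member_le_sum) auto
    then have "(cmod (\<psi> l a))\<^sup>2 \<le> 1\<^sup>2" using True \<psi> by simp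
    then have "cmod (\<psi> l a) \<le> 1" by (rule power2_le_imp_le) simp
    then show ?thesis using True by (simp add: \<psi>'_def)
  qed (auto simp: \<psi>'_def)
  have P3: "(\<Sum>l<m. p' l) = 1" using p(2) by (simp add: p'_def)
  have P4: "(\<Sum>a\<in>idx d. (cmod (\<psi>' l a))\<^sup>2) = 1" if "l < m" for l
    using \<psi> that by (simp add: \<psi>'_def nrm2_def)
  have P5: "(\<Sum>j\<in>S. c l S j * (\<Sum>i'<d. \<psi>' l (i', i) * cnj (\<psi>' l (i', j)))) = 0"
    if "l < m" "S \<subseteq> {..<d}" "k < card S" "i < d" for l S i
  proof -
    have "(\<Sum>j\<in>S. c l S j * (\<Sum>i'<d. \<psi>' l (i', i) * cnj (\<psi>' l (i', j)))) = (\<Sum>j\<in>S. c l S j * ptrace_A_proj d (\<psi> l) i j)"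
      unfolding ptrace_A_proj_def using that
      by (intro sum.cong refl arg_cong2[where f = times]) (auto simp: \<psi>'_def idx_def)
    then show ?thesis using c(3)[OF that] by simp
  qed
  have mem: "(p', \<psi>', c) \<in> decomp_params k d m"
    unfolding decomp_params_def mem_Collect_eq prod.case
  proof (intro conjI allI impI P1 P2 P3 P4)
    show "c l S j \<in> cball 0 1" for l S j using c(1) by simp
    show "(\<Sum>j\<in>S. (cmod (c l S j))\<^sup>2) = 1" if "l < m" "S \<subseteq> {..<d} \<and> k < card S" for l S
      using c(2) that by blast
    show "(\<Sum>j\<in>S. c l S j * (\<Sum>i'<d. \<psi>' l (i', i) * cnj (\<psi>' l (i', j)))) = 0"
      if "l < m" "S \<subseteq> {..<d} \<and> k < card S" "i < d" for l S i
      using P5 that by blast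
  qed
  have "?R = state_of_params d m (p', \<psi>', c)"
  proof
    fix ab
    show "?R ab = state_of_params d m (p', \<psi>', c) ab"
    proof (cases "ab \<in> idx d \<times> idx d")
      case True
      then show ?thesis using \<rho> by (auto simp: state_of_params_def p'_def \<psi>'_def)
    qed (simp only: state_of_params_def if_False)
  qed
  with mem m show "0 < m \<and> ?R \<in> state_of_params d m ` decomp_params k d m" by blast
next
  assume "0 < m \<and> ?R \<in> state_of_params d m ` decomp_params k d m"
  then obtain p \<psi> c where m: "0 < m" and mem: "(p, \<psi>, c) \<in> decomp_params k d m"
    and R: "?R = state_of_params d m (p, \<psi>, c)" by auto
  have P: "(\<forall>l. 0 \<le> p l)" "(\<Sum>l<m. p l) = 1" "\<forall>l<m. nrm2 (idx d) (\<psi> l) = 1"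
    using mem unfolding decomp_params_def mem_Collect_eq prod.case nrm2_def by auto
  have dep: "(\<Sum>j\<in>S. (cmod (c l S j))\<^sup>2) = 1 \<and> (\<forall>i<d. (\<Sum>j\<in>S. c l S j * ptrace_A_proj d (\<psi> l) i j) = 0)"
    if "l < m" "S \<subseteq> {..<d}" "k < card S" for l S
    using mem that unfolding decomp_params_def mem_Collect_eq prod.case ptrace_A_proj_def by blast
  have "mat_rank d (ptrace_A_proj d (\<psi> l)) \<le> k" if "l < m" for l
    unfolding mat_rank_le_iff
  proof (intro allI impI, rule ccontr)
    fix S assume S: "S \<subseteq> {..<d}" "col_indep d (ptrace_A_proj d (\<psi> l)) S" "\<not> card S \<le> k"
    note dep' = dep[OF that S(1)]
    \<comment> \<open>Independence would force the certificate to vanish, against its unit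
      norm.\<close>
    have "\<forall>j\<in>S. c l S j = 0" using dep' S unfolding col_indep_def by simp
    then have "(\<Sum>j\<in>S. (cmod (c l S j))\<^sup>2) = 0" by simp
    then show False using dep' S(3) by simp
  qed
  moreover have "\<rho> a b = (\<Sum>l<m. complex_of_real (p l) * \<psi> l a * cnj (\<psi> l b))"
    if "a \<in> idx d" "b \<in> idx d" for a b
    using fun_cong[OF R, of "(a, b)"] that by (simp add: state_of_params_def)
  ultimately have "schmidt_decomp k d \<rho> m p \<psi>"
    unfolding schmidt_decomp_def using m P by (intro conjI ballI allI impI) simp_all
  then show "\<exists>p \<psi>. schmidt_decomp k d \<rho> m p \<psi>" by blast
qed

text \<open>Extension by zero turns \<open>R\<close> into a Borel map to a product space. Membership
  in \<open>SN k d\<close> is then a countable union of preimages of closed sets, one for each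
  length \<open>m\<close>.\<close>

lemma borel_SN:
  assumes "\<And>a b. a \<in> idx d \<Longrightarrow> b \<in> idx d \<Longrightarrow> (\<lambda>g. R g a b) \<in> borel_measurable M"
  shows "{g \<in> space M. R g \<in> SN k d} \<in> sets M"
proof -
  define f where "f g ab = (if ab \<in> idx d \<times> idx d then R g (fst ab) (snd ab) else 0)" for g ab
  have "(\<lambda>g. f g ab) \<in> borel_measurable M" for ab
    using assms by (cases "ab \<in> idx d \<times> idx d") (auto simp: f_def)
  then have f [measurable]: "f \<in> borel_measurable M"
    by (rule measurable_coordinatewise_then_product)
  have "{g \<in> space M. R g \<in> SN k d} = (\<Union>m\<in>{0<..}. f -` (state_of_params d m ` decomp_params k d m) \<inter> space M)"
    unfolding SN_iff schmidt_decomp_image f_def[symmetric] by auto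
  also have "\<dots> \<in> sets M"
    by (intro sets.countable_UN') (auto intro!: measurable_sets[OF f borel_closed[OF closed_state_of_params]])
  finally show ?thesis .
qed


section \<open>Quadratic forms on nets\<close>

definition bform :: "'a set \<Rightarrow> ('a \<Rightarrow> 'a \<Rightarrow> complex) \<Rightarrow> ('a \<Rightarrow> complex) \<Rightarrow> ('a \<Rightarrow> complex) \<Rightarrow> complex" where
  "bform I H x y = (\<Sum>a\<in>I. \<Sum>b\<in>I. cnj (x a) * H a b * y b)"

lemma qform_eq_bform: "qform I H x = bform I H x x"
  by (simp add: qform_def bform_def)

lemma bform_add_left: "bform I H (\<lambda>a. x a + y a) z = bform I H x z + bform I H y z"
  by (simp add: bform_def sum.distrib algebra_simps)

lemma bform_diff_left: "bform I H (\<lambda>a. x a - y a) z = bform I H x z - bform I H y z"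
  by (simp add: bform_def sum_subtractf algebra_simps)

lemma bform_add_right: "bform I H x (\<lambda>a. y a + z a) = bform I H x y + bform I H x z"
  by (simp add: bform_def sum.distrib algebra_simps)

lemma bform_diff_right: "bform I H x (\<lambda>a. y a - z a) = bform I H x y - bform I H x z"
  by (simp add: bform_def sum_subtractf algebra_simps)

lemma bform_scale: "bform I H (\<lambda>a. complex_of_real s * x a) (\<lambda>a. complex_of_real t * y a) = complex_of_real (s * t) * bform I H x y"
  by (simp add: bform_def sum_distrib_left mult_ac)

definition hermitian_on :: "'a set \<Rightarrow> ('a \<Rightarrow> 'a \<Rightarrow> complex) \<Rightarrow> bool" where
  "hermitian_on I H \<longleftrightarrow> (\<forall>a\<in>I. \<forall>b\<in>I. cnj (H a b) = H b a)"

lemma bform_herm: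
  assumes "hermitian_on I H"
  shows "Re (bform I H y x) = Re (bform I H x y)"
proof -
  have "cnj (bform I H x y) = (\<Sum>a\<in>I. \<Sum>b\<in>I. x a * cnj (H a b) * cnj (y b))"
    by (simp add: bform_def)
  also have "\<dots> = (\<Sum>a\<in>I. \<Sum>b\<in>I. cnj (y b) * H b a * x a)"
    using assms by (intro sum.cong refl) (simp add: hermitian_on_def mult_ac)
  also have "\<dots> = bform I H y x" unfolding bform_def by (rule sum.swap)
  finally show ?thesis by (metis cnj.sel(1))
qed

lemma qform_scale: "qform I H (\<lambda>a. complex_of_real s * x a) = complex_of_real (s\<^sup>2) * qform I H x"
  unfolding qform_eq_bform bform_scale by (simp add: power2_eq_square)

lemma nrm2_scale: "nrm2 I (\<lambda>a. complex_of_real s * x a) = s\<^sup>2 * nrm2 I x"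
  by (simp add: nrm2_def norm_mult power_mult_distrib sum_distrib_left)

lemma nrm2_parallelogram: "nrm2 I (\<lambda>a. x a + y a) + nrm2 I (\<lambda>a. x a - y a) = 2 * nrm2 I x + 2 * nrm2 I y"
  unfolding nrm2_def sum_distrib_left sum.distrib[symmetric]
  by (intro sum.cong refl, unfold cmod_power2) (simp add: power2_eq_square algebra_simps)

text \<open>A weighted polarisation: the form \<open>Re \<langle>x - y, H (x + y)\<rangle>\<close> is rewritten as a difference of two
  quadratic forms after rescaling its two arguments by \<open>1 / \<surd>\<epsilon>\<close> and \<open>\<surd>\<epsilon>\<close>.\<close>

lemma qform_diff_le:
  assumes H: "hermitian_on I H" and s: "\<And>x. \<bar>Re (qform I H x)\<bar> \<le> s * nrm2 I x"
    and eps: "0 < \<epsilon>" and s0: "0 \<le> s" and x1: "nrm2 I x \<le> 1"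
    and xy: "nrm2 I (\<lambda>a. x a - y a) \<le> \<epsilon>\<^sup>2" and eps1: "\<epsilon> \<le> 1"
  shows "\<bar>Re (qform I H x) - Re (qform I H y)\<bar> \<le> 11 / 2 * \<epsilon> * s"
proof -
  define u v where "u a = x a - y a" and "v a = x a + y a" for a
  define e where "e = sqrt \<epsilon>"
  have e: "0 < e" "e\<^sup>2 = \<epsilon>" "1 / e * e = 1" using eps by (auto simp: e_def)
  define u' v' where "u' a = complex_of_real (1 / e) * u a" and "v' a = complex_of_real e * v a" for a
  have "Re (qform I H x) - Re (qform I H y) = Re (bform I H u v)"
    unfolding u_def[abs_def] v_def[abs_def] qform_eq_bform bform_diff_left bform_add_right
    using bform_herm[OF H, of y x] by simp
  also have "bform I H u v = bform I H u' v'"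
    unfolding u'_def[abs_def] v'_def[abs_def] bform_scale using e by simp
  also have "4 * Re (bform I H u' v') = Re (qform I H (\<lambda>a. u' a + v' a)) - Re (qform I H (\<lambda>a. u' a - v' a))"
    unfolding qform_eq_bform bform_diff_left bform_add_right bform_diff_right bform_add_left
    using bform_herm[OF H, of v' u'] by simp
  finally have "4 * \<bar>Re (qform I H x) - Re (qform I H y)\<bar>
      \<le> s * nrm2 I (\<lambda>a. u' a + v' a) + s * nrm2 I (\<lambda>a. u' a - v' a)"
    using s[of "\<lambda>a. u' a + v' a"] s[of "\<lambda>a. u' a - v' a"] by linarith
  also have "\<dots> = s * (2 * nrm2 I u' + 2 * nrm2 I v')"
    unfolding distrib_left[symmetric] nrm2_parallelogram ..
  also have "\<dots> \<le> s * (2 * \<epsilon> + 2 * (\<epsilon> * 10))"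
  proof (intro mult_left_mono add_mono)
    have "nrm2 I u' = nrm2 I u / \<epsilon>"
      unfolding u'_def[abs_def] nrm2_scale using e(2) by (simp add: power_divide)
    also have "\<dots> \<le> \<epsilon>\<^sup>2 / \<epsilon>" using eps xy by (intro divide_right_mono) (auto simp: u_def[abs_def])
    also have "\<dots> = \<epsilon>" using eps by (simp add: power2_eq_square)
    finally show "nrm2 I u' \<le> \<epsilon>" .
    \<comment> \<open>Through this identity the bound \<open>2 * 4 + 2 * 1 = 10\<close> on
      \<open>nrm2 I v\<close> needs no estimate of \<open>y\<close>.\<close>
    have v: "v = (\<lambda>a. complex_of_real 2 * x a - u a)" by (simp add: v_def u_def fun_eq_iff)
    have "nrm2 I v \<le> 2 * (2\<^sup>2 * nrm2 I x) + 2 * nrm2 I u"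
      unfolding v nrm2_scale[symmetric] by (rule nrm2_diff_le)
    moreover have "nrm2 I u \<le> 1"
      using xy power_le_one[of \<epsilon> 2] eps eps1 by (simp add: u_def[abs_def])
    ultimately have "nrm2 I v \<le> 10" using x1 by simp
    then show "nrm2 I v' \<le> \<epsilon> * 10"
      unfolding v'_def[abs_def] nrm2_scale e(2) using eps by (intro mult_left_mono) auto
  qed (use s0 in auto)
  finally show ?thesis by (simp add: mult_ac)
qed

text \<open>Ensures that the supremum in the net argument below is finite.\<close>

lemma qform_crude_bound:
  assumes "finite I" "nrm2 I x \<le> 1"
  shows "\<bar>Re (qform I H x)\<bar> \<le> (\<Sum>a\<in>I. \<Sum>b\<in>I. cmod (H a b))"
proof -
  have x: "cmod (x a) \<le> 1" if "a \<in> I" for a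
  proof -
    have "(cmod (x a))\<^sup>2 \<le> nrm2 I x" unfolding nrm2_def using that assms(1) by (intro member_le_sum) auto
    then have "(cmod (x a))\<^sup>2 \<le> 1\<^sup>2" using assms(2) by simp
    then show ?thesis by (rule power2_le_imp_le) simp
  qed
  have "\<bar>Re (qform I H x)\<bar> \<le> cmod (qform I H x)" by (rule abs_Re_le_cmod)
  also have "\<dots> \<le> (\<Sum>a\<in>I. \<Sum>b\<in>I. cmod (cnj (x a) * H a b * x b))"
    unfolding qform_def by (intro order_trans[OF norm_sum] sum_mono norm_sum)
  also have "\<dots> \<le> (\<Sum>a\<in>I. \<Sum>b\<in>I. 1 * cmod (H a b) * 1)"
    unfolding norm_mult complex_mod_cnj by (intro sum_mono mult_mono x) auto
  finally show ?thesis by simp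
qed

text \<open>A self-bounding argument: for the supremum \<open>s\<close> over the unit ball, net
  radius 1/11 makes the error in \<open>qform_diff_le\<close> equal to \<open>s / 2\<close>. Hence
  \<open>s <= t + s / 2\<close>, that is \<open>s <= 2 * t\<close>.\<close>

lemma qform_bound_from_net:
  assumes "finite I" "hermitian_on I H"
    and net: "\<And>x. nrm2 I x \<le> 1 \<Longrightarrow> \<exists>y\<in>N. nrm2 I (\<lambda>i. x i - y i) \<le> (1 / 11)\<^sup>2"
    and t: "\<And>y. y \<in> N \<Longrightarrow> nrm2 I y \<le> 4 \<Longrightarrow> \<bar>Re (qform I H y)\<bar> \<le> t"
  shows "\<bar>Re (qform I H x)\<bar> \<le> 2 * t * nrm2 I x"
proof -
  let ?V = "(\<lambda>x. \<bar>Re (qform I H x)\<bar>) ` {x. nrm2 I x \<le> 1}"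
  define s where "s = Sup ?V"
  have bdd: "bdd_above ?V" using qform_crude_bound[OF assms(1)] by (intro bdd_aboveI2) auto
  have ne: "?V \<noteq> {}" by (auto intro: exI[of _ "\<lambda>_. 0"] simp: nrm2_def)
  have le_s: "\<bar>Re (qform I H x)\<bar> \<le> s" if "nrm2 I x \<le> 1" for x
    unfolding s_def using that by (intro cSup_upper bdd) auto
  have s0: "0 \<le> s" using le_s[of "\<lambda>_. 0"] by (simp add: nrm2_def)
  \<comment> \<open>Homogeneity of degree two extends a bound on the unit ball to all vectors. It
    serves both for \<open>s\<close> inside the argument and for the conclusion.\<close>
  have scaled: "\<bar>Re (qform I H x)\<bar> \<le> b * nrm2 I x"
    if b: "\<And>x. nrm2 I x \<le> 1 \<Longrightarrow> \<bar>Re (qform I H x)\<bar> \<le> b" for b x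
  proof (cases "nrm2 I x = 0")
    case True
    then have "qform I H x = 0"
      unfolding qform_def using nrm2_eq_0[OF assms(1), of x] by (intro sum.neutral ballI) simp
    then show ?thesis using True by simp
  next
    case False
    then have pos: "0 < nrm2 I x" using nrm2_nonneg[of I x] by simp
    define r where "r = 1 / sqrt (nrm2 I x)"
    have r: "r\<^sup>2 = 1 / nrm2 I x" using pos by (simp add: r_def power_divide)
    have "\<bar>Re (qform I H (\<lambda>a. complex_of_real r * x a))\<bar> \<le> b"
      by (rule b) (use pos in \<open>simp add: nrm2_scale r\<close>)
    then have "\<bar>Re (qform I H x)\<bar> / nrm2 I x \<le> b"
      unfolding qform_scale r using pos by (simp add: abs_mult)
    then show ?thesis using pos by (simp add: pos_divide_le_eq)
  qed
  have "\<bar>Re (qform I H x)\<bar> \<le> t + s / 2" if x: "nrm2 I x \<le> 1" for x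
  proof -
    obtain y where y: "y \<in> N" "nrm2 I (\<lambda>i. x i - y i) \<le> (1 / 11)\<^sup>2" using net[OF x] by blast
    have "y = (\<lambda>a. x a - (x a - y a))" by simp
    then have "nrm2 I y \<le> 2 * nrm2 I x + 2 * nrm2 I (\<lambda>a. x a - y a)"
      using nrm2_diff_le[of I x "\<lambda>a. x a - y a"] by simp
    also have "\<dots> \<le> 4" using x y(2) by (simp add: power2_eq_square)
    finally have "\<bar>Re (qform I H y)\<bar> \<le> t" by (rule t[OF y(1)])
    moreover have "\<bar>Re (qform I H x) - Re (qform I H y)\<bar> \<le> 11 / 2 * (1 / 11) * s"
      by (rule qform_diff_le[OF assms(2) scaled[OF le_s] _ s0 x y(2)]) auto
    ultimately show ?thesis by linarith
  qed
  then have "s \<le> t + s / 2" unfolding s_def[symmetric] by (subst s_def, intro cSup_least ne) auto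
  then have "s \<le> 2 * t" by simp
  then show ?thesis
    using scaled[OF le_s, of x] nrm2_nonneg[of I x] by (meson mult_right_mono order_trans)
qed

section \<open>The random matrix as a witness, and the final probability estimate\<close>

lemma gue0_hermitian: "hermitian_on I (gue0 d g)"
  unfolding hermitian_on_def gue0_def gue_herm_def by (simp add: add.commute)

lemma gue0_trace:
  assumes "0 < d" shows "(\<Sum>a\<in>idx d. gue0 d g a a) = 0"
  unfolding gue0_def using assms by (simp add: sum_subtractf card_idx)

text \<open>The trace of the state against the witness is computed twice: from the decomposition, as
  a convex combination of values at most \<open>b\<close>, and from \<open>rho_of\<close>, where the
  identity part drops out because the witness is traceless.\<close>

lemma SN_witness_bound:
  assumes "0 < d" "rho_of \<alpha> d g \<in> SN k d" "0 \<le> \<alpha>"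
    and b: "\<And>\<psi>. nrm2 (idx d) \<psi> = 1 \<Longrightarrow> mat_rank d (ptrace_A_proj d \<psi>) \<le> k \<Longrightarrow> Re (qform (idx d) (gue0 d g) \<psi>) \<le> b"
  shows "\<alpha> * hs2 d (gue0 d g) \<le> real d ^ 3 * b"
proof -
  let ?I = "idx d" and ?G = "gue0 d g"
  obtain m p \<psi> where D: "schmidt_decomp k d (rho_of \<alpha> d g) m p \<psi>"
    using assms(2) unfolding SN_iff by blast
  note D' = D[unfolded schmidt_decomp_def]
  from D' have \<rho>: "\<forall>a\<in>?I. \<forall>b\<in>?I. rho_of \<alpha> d g a b = (\<Sum>l<m. complex_of_real (p l) * \<psi> l a * cnj (\<psi> l b))"
    by (elim conjE)
  from D' have p: "\<forall>l<m. 0 \<le> p l" by (elim conjE)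
  from D' have p1: "(\<Sum>l<m. p l) = 1" by (elim conjE)
  from D' have n1: "\<forall>l<m. nrm2 ?I (\<psi> l) = 1" by (elim conjE)
  from D' have rk: "\<forall>l<m. mat_rank d (ptrace_A_proj d (\<psi> l)) \<le> k" by (elim conjE)
  have "(\<Sum>a\<in>?I. \<Sum>b\<in>?I. rho_of \<alpha> d g a b * ?G b a)
     = (\<Sum>a\<in>?I. \<Sum>b\<in>?I. \<Sum>l<m. complex_of_real (p l) * (cnj (\<psi> l b) * ?G b a * \<psi> l a))"
  proof (intro sum.cong refl)
    fix a b assume "a \<in> ?I" "b \<in> ?I"
    then have "rho_of \<alpha> d g a b = (\<Sum>l<m. complex_of_real (p l) * \<psi> l a * cnj (\<psi> l b))" using \<rho> by blast
    then show "rho_of \<alpha> d g a b * ?G b a = (\<Sum>l<m. complex_of_real (p l) * (cnj (\<psi> l b) * ?G b a * \<psi> l a))"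
      by (simp only: sum_distrib_right) (intro sum.cong refl, simp only: mult_ac)
  qed
  also have "\<dots> = (\<Sum>l<m. \<Sum>a\<in>?I. \<Sum>b\<in>?I. complex_of_real (p l) * (cnj (\<psi> l b) * ?G b a * \<psi> l a))"
    by (subst sum.swap[of _ "{..<m}"], subst sum.swap[of _ "{..<m}"]) (rule refl)
  also have "\<dots> = (\<Sum>l<m. complex_of_real (p l) * qform ?I ?G (\<psi> l))"
    unfolding qform_def sum_distrib_left by (intro sum.cong refl sum.swap)
  finally have 1: "(\<Sum>a\<in>?I. \<Sum>b\<in>?I. rho_of \<alpha> d g a b * ?G b a) = (\<Sum>l<m. complex_of_real (p l) * qform ?I ?G (\<psi> l))" .
  have GG: "?G a b * ?G b a = complex_of_real ((cmod (?G a b))\<^sup>2)" for a b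
  proof -
    have "?G b a = cnj (?G a b)" using gue0_hermitian[of UNIV d g] by (metis UNIV_I hermitian_on_def)
    then show ?thesis by (simp only: complex_norm_square)
  qed
  have "(\<Sum>a\<in>?I. \<Sum>b\<in>?I. rho_of \<alpha> d g a b * ?G b a)
     = (\<Sum>a\<in>?I. \<Sum>b\<in>?I. (1 / of_nat (d\<^sup>2)) * ((if a = b then ?G b a else 0) +
         complex_of_real (\<alpha> / real d) * complex_of_real ((cmod (?G a b))\<^sup>2)))"
    unfolding GG[symmetric] rho_of_def by (intro sum.cong refl) (simp add: algebra_simps)
  also have "\<dots> = (1 / of_nat (d\<^sup>2)) * ((\<Sum>a\<in>?I. \<Sum>b\<in>?I. if a = b then ?G b a else 0) +
         complex_of_real (\<alpha> / real d) * complex_of_real (hs2 d ?G))"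
    unfolding hs2_def of_real_sum sum_distrib_left[symmetric] sum.distrib ..
  also have "\<dots> = complex_of_real (\<alpha> / real d ^ 3 * hs2 d ?G)"
    unfolding sum_diag[OF finite_idx] gue0_trace[OF assms(1)]
    by (simp add: power2_eq_square power3_eq_cube)
  finally have "complex_of_real (\<alpha> / real d ^ 3 * hs2 d ?G) = (\<Sum>l<m. complex_of_real (p l) * qform ?I ?G (\<psi> l))"
    unfolding 1 by simp
  then have "Re (complex_of_real (\<alpha> / real d ^ 3 * hs2 d ?G)) = Re (\<Sum>l<m. complex_of_real (p l) * qform ?I ?G (\<psi> l))"
    by (rule arg_cong)
  then have "\<alpha> / real d ^ 3 * hs2 d ?G = (\<Sum>l<m. p l * Re (qform ?I ?G (\<psi> l)))"
    by simp
  also have "\<dots> \<le> (\<Sum>l<m. p l * b)"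
    using p n1 rk by (intro sum_mono mult_left_mono b) auto
  also have "\<dots> = b" using p1 by (simp add: sum_distrib_right[symmetric])
  finally show ?thesis using assms(1) by (simp add: field_simps)
qed

lemma measurable_rho_of [measurable]:
  assumes "a \<in> idx d" "b \<in> idx d"
  shows "(\<lambda>g. rho_of \<alpha> d g a b) \<in> borel_measurable (ginibre d)"
proof -
  have cnj: "cnj \<in> borel_measurable borel"
    by (intro borel_measurable_continuous_onI continuous_intros)
  have herm: "(\<lambda>g. gue_herm d g a b) \<in> borel_measurable (ginibre d)" if "a \<in> idx d" "b \<in> idx d" for a b
  proof -
    have "(\<lambda>g. g (a, b)) \<in> borel_measurable (ginibre d)" "(\<lambda>g. g (b, a)) \<in> borel_measurable (ginibre d)"
      using that by (auto intro: measurable_ginibre_component)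
    then have "(\<lambda>g. g (a, b)) \<in> borel_measurable (ginibre d)" "(\<lambda>g. cnj (g (b, a))) \<in> borel_measurable (ginibre d)"
      using measurable_compose[OF _ cnj] by auto
    then show ?thesis unfolding gue_herm_def by (intro borel_measurable_divide borel_measurable_add) auto
  qed
  show ?thesis unfolding rho_of_def gue0_def
    using assms by (cases "a = b") (auto intro!: borel_measurable_times borel_measurable_add borel_measurable_diff
        borel_measurable_divide borel_measurable_sum herm)
qed

text \<open>Under the hypotheses each of the three exponents is at least \<open>d + 2\<close>. As
  \<open>exp (-2) <= 1/4\<close>, the total is at most 5/4 times \<open>exp (- d)\<close>.\<close>

lemma exp_sum_bound:
  fixes \<gamma> :: real
  assumes "3 / \<gamma> \<le> d" "4 \<le> d" "0 < \<gamma>"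
  shows "exp (- (d ^ 4 / 16)) + 2 * exp (- 176 * d\<^sup>2) + 2 * exp (- \<gamma> * d\<^sup>2) \<le> 2 * exp (- d)"
proof -
  have "2 \<le> exp (1::real)" using exp_ge_add_one_self[of "1::real"] by simp
  then have "2 * 2 \<le> exp (1::real) * exp 1" by (intro mult_mono) auto
  then have e2: "4 \<le> exp (2::real)" by (simp add: exp_add[symmetric])
  have *: "exp (- x) \<le> exp (- d) / 4" if "d + 2 \<le> x" for x
  proof -
    have "exp (- x) \<le> exp (- d - 2)" using that by simp
    also have "\<dots> = exp (- d) / exp 2" by (rule exp_diff)
    also have "\<dots> \<le> exp (- d) / 4" using e2 by (intro divide_left_mono) auto
    finally show ?thesis .
  qed
  have "16 \<le> d\<^sup>2" using power_mono[of 4 d 2] assms by simp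
  moreover have "4 * d \<le> d\<^sup>2" using assms by (simp add: power2_eq_square)
  ultimately have "16 * (4 * d) \<le> d\<^sup>2 * d\<^sup>2" using assms by (intro mult_mono) auto
  then have 1: "d + 2 \<le> d ^ 4 / 16" using assms by (simp add: power_add[symmetric])
  have 2: "d + 2 \<le> 176 * d\<^sup>2" using \<open>4 * d \<le> d\<^sup>2\<close> assms by simp
  have "3 \<le> \<gamma> * d" using assms by (simp add: field_simps)
  then have "3 * d \<le> \<gamma> * d * d" using assms by (intro mult_right_mono) auto
  moreover have "\<gamma> * d * d = \<gamma> * d\<^sup>2" by (simp add: power2_eq_square)
  ultimately have 3: "d + 2 \<le> \<gamma> * d\<^sup>2" using assms by linarith
  have "exp (- 176 * d\<^sup>2) \<le> exp (- d) / 4" "exp (- \<gamma> * d\<^sup>2) \<le> exp (- d) / 4"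
    using *[OF 2] *[OF 3] by simp_all
  then show ?thesis using *[OF 1] exp_ge_zero[of "- d"] by linarith
qed

text \<open>The constants: on the net for all vectors, \<open>976 - 192\<^sup>2 / 32 = - 176\<close>, and the operator norm is then
  at most \<open>384 d\<close>.  On the low rank net the threshold \<open>\<alpha> d / 64\<close> has tail \<open>exp (- 2 \<gamma> d\<^sup>2)\<close>, and \<open>k\<close> is
  restricted so that the net has at most \<open>exp (\<gamma> d\<^sup>2)\<close> points; \<open>\<epsilon>\<close> keeps the approximation error
  \<open>11 / 2 \<cdot> \<epsilon> \<cdot> 384 d\<close> below \<open>\<alpha> d / 64\<close>, so that the two bounds on \<open>tr (\<rho> G)\<close> are
  \<open>\<alpha> d / 16\<close> and \<open>\<alpha> d / 32\<close>.\<close>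

lemma prob_SN_le:
  fixes \<alpha> :: real
  defines "\<epsilon> \<equiv> \<alpha> / 140000" and "\<gamma> \<equiv> \<alpha>\<^sup>2 / 262144"
  assumes \<alpha>: "0 < \<alpha>" "\<alpha> < 1 / 2" and k: "1 \<le> k" "(500 / \<epsilon>\<^sup>2 + 16) * real k \<le> \<gamma> * real d" and d: "2 \<le> d"
  shows "measure (ginibre d) {g \<in> space (ginibre d). rho_of \<alpha> d g \<in> SN k d}
    \<le> exp (- (real d ^ 4 / 16)) + 2 * exp (- 176 * (real d)\<^sup>2) + 2 * exp (- \<gamma> * (real d)\<^sup>2)"
proof -
  interpret prob_space "ginibre d" by (rule prob_space_ginibre)
  let ?I = "idx d"
  have \<epsilon>: "0 < \<epsilon>" "\<epsilon> \<le> 1" using \<alpha> by (auto simp: \<epsilon>_def)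
  have "card ?I \<noteq> 0" using d by (simp add: card_idx)
  then have ne: "?I \<noteq> {}" by auto
  obtain N1 :: "(nat \<times> nat \<Rightarrow> complex) set" where N1: "finite N1" "real (card N1) \<le> exp ((8 / (1 / 11)\<^sup>2 + 8) * card ?I)"
      "\<And>x. nrm2 ?I x \<le> 1 \<Longrightarrow> \<exists>y\<in>N1. nrm2 ?I (\<lambda>i. x i - y i) \<le> (1 / 11)\<^sup>2"
    using unit_ball_net[of "1 / 11" ?I] ne by auto
  have "0 < d" "0 < k" using d k by auto
  from low_rank_net[OF \<epsilon> this] obtain N2 where N2: "finite N2" "real (card N2) \<le> exp ((500 / \<epsilon>\<^sup>2 + 16) * real (k * d))"
    "\<forall>q r. (\<forall>l<k. nrm2 {..<d} (q l) \<le> 1) \<longrightarrow>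
       (\<forall>c. nrm2 {..<d} (\<lambda>i. \<Sum>l<k. q l i * c l) \<le> nrm2 {..<k} c) \<longrightarrow>
       (\<Sum>l<k. nrm2 {..<d} (r l)) \<le> 1 \<longrightarrow>
       (\<exists>y\<in>N2. nrm2 (idx d) (\<lambda>a. (\<Sum>l<k. q l (fst a) * r l (snd a)) - y a) \<le> \<epsilon>\<^sup>2)"
    by blast
  let ?t = "192 * real d" and ?b = "\<alpha> / 64 * real d"
  let ?F1 = "{y \<in> N1. nrm2 ?I y \<le> 4}" and ?F2 = "{y \<in> N2. nrm2 ?I y \<le> 4}"
  define B1 where "B1 = {g \<in> space (ginibre d). (\<Sum>p\<in>lex_pairs d. (sym_re g p)\<^sup>2) < real d ^ 4 / 16}"
  define B2 where "B2 = {g \<in> space (ginibre d). \<exists>x\<in>?F1. ?t < \<bar>Re (qform ?I (gue0 d g) x)\<bar>}"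
  define B3 where "B3 = {g \<in> space (ginibre d). \<exists>x\<in>?F2. ?b < \<bar>Re (qform ?I (gue0 d g) x)\<bar>}"
  have B1: "B1 \<in> events"
  proof -
    have "(\<lambda>g. \<Sum>p\<in>lex_pairs d. (sym_re g p)\<^sup>2) \<in> borel_measurable (ginibre d)"
      using lex_pairs_subset by (intro borel_measurable_sum borel_measurable_power measurable_sym_re) auto
    then show ?thesis unfolding B1_def by measurable
  qed
  have Q: "{g \<in> space (ginibre d). \<exists>x\<in>F. t < \<bar>Re (qform ?I (gue0 d g) x)\<bar>} \<in> events" if "finite F" for F t
    unfolding qform_gue0 Re_complex_of_real using that by measurable
  have B2: "B2 \<in> events" unfolding B2_def using N1(1) by (intro Q) simp
  have B3: "B3 \<in> events" unfolding B3_def using N2(1) by (intro Q) simp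
  have sub: "{g \<in> space (ginibre d). rho_of \<alpha> d g \<in> SN k d} \<subseteq> B1 \<union> B2 \<union> B3"
  proof (rule subsetI, rule ccontr)
    fix g assume g: "g \<in> {g \<in> space (ginibre d). rho_of \<alpha> d g \<in> SN k d}" and "g \<notin> B1 \<union> B2 \<union> B3"
    then have g1: "real d ^ 4 / 16 \<le> (\<Sum>p\<in>lex_pairs d. (sym_re g p)\<^sup>2)"
      and g2: "\<And>x. x \<in> N1 \<Longrightarrow> nrm2 ?I x \<le> 4 \<Longrightarrow> \<bar>Re (qform ?I (gue0 d g) x)\<bar> \<le> ?t"
      and g3: "\<And>x. x \<in> N2 \<Longrightarrow> nrm2 ?I x \<le> 4 \<Longrightarrow> \<bar>Re (qform ?I (gue0 d g) x)\<bar> \<le> ?b"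
      and SN: "rho_of \<alpha> d g \<in> SN k d"
      by (auto simp: B1_def B2_def B3_def not_less)
    have op: "\<bar>Re (qform ?I (gue0 d g) x)\<bar> \<le> (384 * real d) * nrm2 ?I x" for x
      using qform_bound_from_net[OF finite_idx gue0_hermitian N1(3) g2] by simp
    have "Re (qform ?I (gue0 d g) \<psi>) \<le> ?b + 11 / 2 * \<epsilon> * (384 * real d)"
      if \<psi>: "nrm2 ?I \<psi> = 1" "mat_rank d (ptrace_A_proj d \<psi>) \<le> k" for \<psi>
    proof -
      obtain q r where qr: "ortho_sys {..<d} k q" "\<forall>i<d. \<forall>j<d. \<psi> (i, j) = (\<Sum>l<k. q l i * r l j)"
        "(\<Sum>l<k. nrm2 {..<d} (r l)) = nrm2 ?I \<psi>"
        using low_rank_factor[OF \<psi>(2)] by blast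
      have "\<exists>y\<in>N2. nrm2 ?I (\<lambda>a. (\<Sum>l<k. q l (fst a) * r l (snd a)) - y a) \<le> \<epsilon>\<^sup>2"
        using ortho_nrm2_le_1[OF qr(1)] nrm2_ortho_sum_le[OF qr(1)] qr(3) \<psi>(1)
        by (intro N2(3)[rule_format]) auto
      then obtain y where y: "y \<in> N2" "nrm2 ?I (\<lambda>a. (\<Sum>l<k. q l (fst a) * r l (snd a)) - y a) \<le> \<epsilon>\<^sup>2" by blast
      have "nrm2 ?I (\<lambda>a. \<psi> a - y a) = nrm2 ?I (\<lambda>a. (\<Sum>l<k. q l (fst a) * r l (snd a)) - y a)"
        unfolding nrm2_def using qr(2) by (intro sum.cong refl) (auto simp: idx_def)
      then have close: "nrm2 ?I (\<lambda>a. \<psi> a - y a) \<le> \<epsilon>\<^sup>2" using y(2) by simp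
      have "nrm2 ?I y \<le> 2 * nrm2 ?I \<psi> + 2 * nrm2 ?I (\<lambda>a. \<psi> a - y a)"
        using nrm2_diff_le[of ?I \<psi> "\<lambda>a. \<psi> a - y a"] by simp
      also have "\<dots> \<le> 4" using \<psi>(1) close power_le_one[of \<epsilon> 2] \<epsilon> by simp
      finally have "\<bar>Re (qform ?I (gue0 d g) y)\<bar> \<le> ?b" by (rule g3[OF y(1)])
      moreover have "\<bar>Re (qform ?I (gue0 d g) \<psi>) - Re (qform ?I (gue0 d g) y)\<bar> \<le> 11 / 2 * \<epsilon> * (384 * real d)"
        by (rule qform_diff_le[OF gue0_hermitian op \<epsilon>(1) _ _ close \<epsilon>(2)]) (use \<psi>(1) in auto)
      ultimately show ?thesis by linarith
    qed
    then have "\<alpha> * hs2 d (gue0 d g) \<le> real d ^ 3 * (?b + 11 / 2 * \<epsilon> * (384 * real d))"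
      using SN \<alpha> \<open>0 < d\<close> by (intro SN_witness_bound) auto
    also have "\<dots> = (\<alpha> / 64 + 11 / 2 * (\<alpha> / 140000) * 384) * real d ^ 4"
      by (simp add: \<epsilon>_def power_numeral_reduce algebra_simps)
    also have "\<dots> < (\<alpha> / 16) * real d ^ 4"
      using \<alpha> \<open>0 < d\<close> by (intro mult_strict_right_mono) auto
    also have "\<dots> \<le> \<alpha> * hs2 d (gue0 d g)"
      using \<alpha> order_trans[OF g1 hs2_gue0_ge] mult_left_mono[of "real d ^ 4 / 16" "hs2 d (gue0 d g)" \<alpha>] by simp
    finally show False by simp
  qed
  have n: "real (card ?I) = (real d)\<^sup>2" by (simp add: card_idx)
  have P1: "prob B1 \<le> exp (- (real d ^ 4 / 16))"
    unfolding B1_def by (rule hs2_lower_tail[OF d])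
  have P2: "prob B2 \<le> 2 * exp (- 176 * (real d)\<^sup>2)"
  proof -
    have "prob B2 \<le> 2 * real (card ?F1) * exp (- ?t\<^sup>2 / 32)"
      unfolding B2_def using N1(1) by (intro qform_net_tail) auto
    also have "\<dots> \<le> 2 * exp (976 * (real d)\<^sup>2) * exp (- ?t\<^sup>2 / 32)"
    proof -
      \<comment> \<open>For radius 1/11 the net exponent is \<open>8 * 121 + 8 = 976\<close> per
        coordinate.\<close>
      have "real (card ?F1) \<le> real (card N1)" using N1(1) by (intro of_nat_mono card_mono) auto
      also have "\<dots> \<le> exp (976 * (real d)\<^sup>2)" using N1(2) unfolding n by (simp add: power2_eq_square)
      finally show ?thesis by (intro mult_right_mono mult_left_mono) auto
    qed
    also have "\<dots> = 2 * exp (- 176 * (real d)\<^sup>2)"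
      by (simp add: mult.assoc exp_add[symmetric] power_mult_distrib)
    finally show ?thesis .
  qed
  have P3: "prob B3 \<le> 2 * exp (- \<gamma> * (real d)\<^sup>2)"
  proof -
    have "prob B3 \<le> 2 * real (card ?F2) * exp (- ?b\<^sup>2 / 32)"
      unfolding B3_def using N2(1) \<alpha> by (intro qform_net_tail) auto
    also have "\<dots> \<le> 2 * exp (\<gamma> * (real d)\<^sup>2) * exp (- ?b\<^sup>2 / 32)"
    proof -
      have "real (card ?F2) \<le> real (card N2)" using N2(1) by (intro of_nat_mono card_mono) auto
      also have "\<dots> \<le> exp ((500 / \<epsilon>\<^sup>2 + 16) * real k * real d)" using N2(2) by (simp add: mult.assoc)
      also have "\<dots> \<le> exp (\<gamma> * real d * real d)" using k(2) by (simp add: mult_right_mono)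
      finally show ?thesis by (intro mult_right_mono mult_left_mono) (auto simp: power2_eq_square mult.assoc)
    qed
    also have "\<dots> = 2 * exp (- \<gamma> * (real d)\<^sup>2)"
      by (simp add: mult.assoc exp_add[symmetric] power_mult_distrib power_divide \<gamma>_def)
    finally show ?thesis .
  qed
  have "prob {g \<in> space (ginibre d). rho_of \<alpha> d g \<in> SN k d} \<le> prob (B1 \<union> B2 \<union> B3)"
    using B1 B2 B3 by (intro finite_measure_mono sub) auto
  also have "\<dots> \<le> prob B1 + prob B2 + prob B3"
    using B1 B2 B3 by (intro order_trans[OF measure_Un_le] add_mono measure_Un_le) auto
  finally show ?thesis using P1 P2 P3 by linarith
qed

theorem theorem14:
  shows "\<exists>c>0. \<forall>\<alpha>::real. 0 < \<alpha> \<and> \<alpha> < 1/2 \<longrightarrow>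
           (\<exists>c'>0. \<forall>(d::nat) (k::nat). 1 \<le> k \<and> real k \<le> c' * real d \<longrightarrow>
              measure (ginibre d) {g \<in> space (ginibre d). rho_of \<alpha> d g \<notin> SN k d}
                \<ge> 1 - 2 * exp (- c * real d))"
proof (rule exI[of _ 1], intro conjI allI impI)
  fix \<alpha> :: real assume "0 < \<alpha> \<and> \<alpha> < 1 / 2"
  then have \<alpha>: "0 < \<alpha>" "\<alpha> < 1 / 2" by auto
  define \<epsilon> where "\<epsilon> = \<alpha> / 140000"
  define \<gamma> where "\<gamma> = \<alpha>\<^sup>2 / 262144"
  \<comment> \<open>Chosen so that \<open>k <= c' * d\<close> is exactly the hypothesis on
    \<open>k\<close> in \<open>prob_SN_le\<close>, which balances the size of the low rank net
    against the Gaussian tail.\<close>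
  define c' where "c' = \<gamma> / (500 / \<epsilon>\<^sup>2 + 16)"
  have \<gamma>: "0 < \<gamma>" "\<gamma> \<le> 1" using \<alpha> power_le_one[of \<alpha> 2] by (auto simp: \<gamma>_def)
  have den: "16 \<le> 500 / \<epsilon>\<^sup>2 + 16" by simp
  have c': "0 < c'" unfolding c'_def using \<gamma> den by (intro divide_pos_pos) linarith+
  have "c' \<le> \<gamma> / 16" unfolding c'_def using \<gamma> den by (intro divide_left_mono mult_pos_pos) linarith+
  then have c'2: "3 * c' \<le> \<gamma>" "4 * c' \<le> 1" using \<gamma> by auto
  show "\<exists>c'>0. \<forall>d k. 1 \<le> k \<and> real k \<le> c' * real d \<longrightarrow>
      1 - 2 * exp (- 1 * real d) \<le> measure (ginibre d) {g \<in> space (ginibre d). rho_of \<alpha> d g \<notin> SN k d}"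
  proof (intro exI[of _ c'] conjI allI impI c')
    fix d k :: nat assume dk: "1 \<le> k \<and> real k \<le> c' * real d"
    \<comment> \<open>Since \<open>k >= 1\<close>, the dimension is at least \<open>1 / c'\<close>.
      This yields both \<open>4 <= d\<close> and \<open>3 / \<gamma> <= d\<close>, so the failure
      probability can be absorbed with the universal constant 1.\<close>
    then have cd: "1 \<le> c' * real d" by linarith
    interpret prob_space "ginibre d" by (rule prob_space_ginibre)
    have "4 * c' * real d \<le> 1 * real d" using c'2 by (intro mult_right_mono) auto
    then have d4: "4 \<le> real d" using cd by simp
    have "3 * c' * real d \<le> \<gamma> * real d" using c'2 by (intro mult_right_mono) auto
    then have "3 \<le> \<gamma> * real d" using cd by (simp only: mult.assoc)
    then have d3: "3 / \<gamma> \<le> real d" using \<gamma> by (simp add: pos_divide_le_eq mult.commute)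
    have "(500 / \<epsilon>\<^sup>2 + 16) * real k \<le> (500 / \<epsilon>\<^sup>2 + 16) * (c' * real d)"
      using dk den by (intro mult_left_mono) auto
    also have "\<dots> = \<gamma> * real d" proof -
      have "500 / \<epsilon>\<^sup>2 + 16 \<noteq> 0" using den by linarith
      then show ?thesis unfolding c'_def by simp
    qed
    finally have "prob {g \<in> space (ginibre d). rho_of \<alpha> d g \<in> SN k d}
        \<le> exp (- (real d ^ 4 / 16)) + 2 * exp (- 176 * (real d)\<^sup>2) + 2 * exp (- \<gamma> * (real d)\<^sup>2)"
      using \<alpha> dk d4 unfolding \<epsilon>_def \<gamma>_def by (intro prob_SN_le) auto
    also have "\<dots> \<le> 2 * exp (- real d)" using d3 d4 \<gamma>(1) by (rule exp_sum_bound)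
    finally have le: "prob {g \<in> space (ginibre d). rho_of \<alpha> d g \<in> SN k d} \<le> 2 * exp (- real d)" .
    have ev: "{g \<in> space (ginibre d). rho_of \<alpha> d g \<in> SN k d} \<in> events"
      by (rule borel_SN) (rule measurable_rho_of)
    have "{g \<in> space (ginibre d). rho_of \<alpha> d g \<notin> SN k d} = space (ginibre d) - {g \<in> space (ginibre d). rho_of \<alpha> d g \<in> SN k d}"
      by auto
    then show "1 - 2 * exp (- 1 * real d) \<le> prob {g \<in> space (ginibre d). rho_of \<alpha> d g \<notin> SN k d}"
      using prob_compl[OF ev] le by simp
  qed
qed simp

end
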